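(* Let $f,g\in L^2(\mathbb{R}^{2d},\mathbb{H})$ with $f\neq0$ and $g\neq0$. Let $U\subseteq\mathbb{R}^{2d}\times\mathbb{R}^{2d}$ be a measurable set and $\varepsilon\ge0$. If $A(f,g)$ is $\varepsilon$-concentrated on $U$, then for all $p>2$, $$\mu_{4d}(U)\ge(1-\varepsilon^2)^{\frac{p}{p-2}}\,C_{p,q}^{\frac{2p}{2-p}},$$ where $C_{p,q}=\left(\frac4p\right)^{\frac dp}\left(\frac1q\right)^{\frac dq}$ and $\frac1p+\frac1q=1$.
   Context: $d\ge 1$ is an integer and $\mathbb{H}$ is the algebra of quaternions with units $i,j,k$. On $\mathbb{R}^n$, $d\mu_n(x)=dx/(2\pi)^{n/2}$, $\|F\|_{2,n}=\big(\int_{\mathbb{R}^n}|F|^2d\mu_n\big)^{1/2}$, and $\mathbb{R}^{2d}\times\mathbb{R}^{2d}$ is identified with $\mathbb{R}^{4d}$. The radar quaternion ambiguity function of $f,g\in L^2(\mathbb{R}^{2d},\mathbb{H})$ is $$A(f,g)(x,w)=\int_{\mathbb{R}^{2d}}e^{-i\,t_1\cdot w_1}f\big(t+\tfrac x2\big)\overline{g\big(t-\tfrac x2\big)}e^{-j\,t_2\cdot w_2}\,d\mu_{2d}(t),\quad x\in\mathbb{R}^{2d},\ w=(w_1,w_2),\ t=(t_1,t_2)\in\mathbb{R}^d\times\mathbb{R}^d.$$ A function $F\in L^2(\mathbb{R}^{2d}\times\mathbb{R}^{2d},\mathbb{H})$ is $\varepsilon$-concentrated on a measurable set $U\subseteq\mathbb{R}^{2d}\times\mathbb{R}^{2d}$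 if $\big(\int_{U^c}|F|^2d\mu_{4d}\big)^{1/2}\le\varepsilon\|F\|_{2,4d}$, where $U^c$ is the complement of $U$.
   Formalization: For ε > 1 the base 1−ε² is negative, so the stated bound is undefined or false (e.g. ε = 2, p = 4, U empty); the formal version replaces 1−ε² by max(0, 1−ε²), giving the trivial bound 0 for ε > 1 and the stated inequality for 0 ≤ ε ≤ 1. *)

theory Defs
  imports "HOL-Analysis.Analysis"
begin

datatype quat = Quat (qRe: real) (qI: real) (qJ: real) (qK: real)

lemma quat_eq_iff: "x = y \<longleftrightarrow> qRe x = qRe y \<and> qI x = qI y \<and> qJ x = qJ y \<and> qK x = qK y"
  by (cases x; cases y) auto

instantiation quat :: ab_group_add
begin

definition "0 = Quat 0 0 0 0"
definition "x + y = Quat (qRe x + qRe y) (qI x + qI y) (qJ x + qJ y) (qK x + qK y)"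
definition "- x = Quat (- qRe x) (- qI x) (- qJ x) (- qK x)"
definition "x - y = Quat (qRe x - qRe y) (qI x - qI y) (qJ x - qJ y) (qK x - qK y)"

instance
  by standard
    (simp_all add: quat_eq_iff zero_quat_def plus_quat_def uminus_quat_def minus_quat_def)

end

lemma quat_add_simps [simp]:
  "qRe 0 = 0" "qI 0 = 0" "qJ 0 = 0" "qK 0 = 0"
  "qRe (x + y) = qRe x + qRe y" "qI (x + y) = qI x + qI y"
  "qJ (x + y) = qJ x + qJ y" "qK (x + y) = qK x + qK y"
  "qRe (- x) = - qRe x" "qI (- x) = - qI x" "qJ (- x) = - qJ x" "qK (- x) = - qK x"
  "qRe (x - y) = qRe x - qRe y" "qI (x - y) = qI x - qI y"
  "qJ (x - y) = qJ x - qJ y" "qK (x - y) = qK x - qK y"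
  by (simp_all add: zero_quat_def plus_quat_def uminus_quat_def minus_quat_def)

instantiation quat :: ring_1
begin

definition "1 = Quat 1 0 0 0"
definition "x * y = Quat
   (qRe x * qRe y - qI x * qI y - qJ x * qJ y - qK x * qK y)
   (qRe x * qI y + qI x * qRe y + qJ x * qK y - qK x * qJ y)
   (qRe x * qJ y - qI x * qK y + qJ x * qRe y + qK x * qI y)
   (qRe x * qK y + qI x * qJ y - qJ x * qI y + qK x * qRe y)"

instance
  by standard (simp_all add: quat_eq_iff one_quat_def times_quat_def algebra_simps)

end

lemma quat_mult_simps [simp]:
  "qRe 1 = 1" "qI 1 = 0" "qJ 1 = 0" "qK 1 = 0"
  "qRe (x * y) = qRe x * qRe y - qI x * qI y - qJ x * qJ y - qK x * qK y"
  "qI (x * y) = qRe x * qI y + qI x * qRe y + qJ x * qK y - qK x * qJ y"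
  "qJ (x * y) = qRe x * qJ y - qI x * qK y + qJ x * qRe y + qK x * qI y"
  "qK (x * y) = qRe x * qK y + qI x * qJ y - qJ x * qI y + qK x * qRe y"
  by (simp_all add: one_quat_def times_quat_def)

instantiation quat :: real_algebra_1
begin

definition "r *\<^sub>R x = Quat (r * qRe x) (r * qI x) (r * qJ x) (r * qK x)"

instance
  by standard (simp_all add: quat_eq_iff scaleR_quat_def algebra_simps)

end

lemma quat_scaleR_simps [simp]:
  "qRe (r *\<^sub>R x) = r * qRe x" "qI (r *\<^sub>R x) = r * qI x"
  "qJ (r *\<^sub>R x) = r * qJ x" "qK (r *\<^sub>R x) = r * qK x"
  by (simp_all add: scaleR_quat_def)

lemma quat_sum_squares_eq_0_iff:
  "(qRe x)\<^sup>2 + (qI x)\<^sup>2 + (qJ x)\<^sup>2 + (qK x)\<^sup>2 = 0 \<longleftrightarrow> x = 0"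
  by (auto simp: quat_eq_iff add_nonneg_eq_0_iff)

instantiation quat :: real_inner
begin

definition "inner x y = qRe x * qRe y + qI x * qI y + qJ x * qJ y + qK x * qK y"
definition "norm x = sqrt ((qRe x)\<^sup>2 + (qI x)\<^sup>2 + (qJ x)\<^sup>2 + (qK x)\<^sup>2)"
definition "sgn x = x /\<^sub>R norm x" for x :: quat
definition "dist x y = norm (x - y)" for x y :: quat
definition "(uniformity :: (quat \<times> quat) filter) =
  (INF e\<in>{0<..}. principal {(x, y). dist x y < e})"
definition "open U \<longleftrightarrow> (\<forall>x\<in>U. eventually (\<lambda>(x', y). x' = x \<longrightarrow> y \<in> U) uniformity)"
  for U :: "quat set"

instance
proof
  fix x y z :: quat and r :: real and U :: "quat set"
  show "inner x x = 0 \<longleftrightarrow> x = 0"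
    using quat_sum_squares_eq_0_iff[of x] by (simp add: inner_quat_def power2_eq_square)
  show "norm x = sqrt (inner x x)"
    by (simp add: inner_quat_def norm_quat_def power2_eq_square)
  show "inner x y = inner y x" "inner (x + y) z = inner x z + inner y z"
    "inner (r *\<^sub>R x) y = r * inner x y" "0 \<le> inner x x"
    by (simp_all add: inner_quat_def distrib_left distrib_right mult.commute mult.left_commute)
qed (rule sgn_quat_def dist_quat_def uniformity_quat_def open_quat_def)+

end

instantiation quat :: real_normed_div_algebra
begin

definition "inverse x = Quat (qRe x) (- qI x) (- qJ x) (- qK x) /\<^sub>R (norm x)\<^sup>2"
definition "x div y = x * inverse y" for x y :: quat

instance
proof
  fix x y :: quat
  have *: "(norm x)\<^sup>2 = (qRe x)\<^sup>2 + (qI x)\<^sup>2 + (qJ x)\<^sup>2 + (qK x)\<^sup>2" for x :: quat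
    by (simp add: norm_quat_def)
  show "inverse x * x = 1" "x * inverse x = 1" if "x \<noteq> 0"
  proof -
    define n where "n = (norm x)\<^sup>2"
    have "n \<noteq> 0" using that by (simp add: n_def)
    have n: "qRe x * qRe x + (qI x * qI x + (qJ x * qJ x + qK x * qK x)) = n"
      unfolding n_def * by (simp add: power2_eq_square)
    let ?y = "Quat (qRe x) (- qI x) (- qJ x) (- qK x)"
    have "?y * x = n *\<^sub>R 1" "x * ?y = n *\<^sub>R 1"
      unfolding n[symmetric] by (simp_all add: quat_eq_iff)
    then show "inverse x * x = 1" "x * inverse x = 1"
      unfolding inverse_quat_def n_def[symmetric] using \<open>n \<noteq> 0\<close> by simp_all
  qed
  show "x div y = x * inverse y"
    by (rule divide_quat_def)
  show "inverse (0::quat) = 0"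
    by (simp add: inverse_quat_def quat_eq_iff)
  have "(norm (x * y))\<^sup>2 = (norm x * norm y)\<^sup>2"
    unfolding power_mult_distrib * quat_mult_simps by algebra
  then show "norm (x * y) = norm x * norm y"
    by (simp add: power2_eq_iff_nonneg)
qed

end

definition quat_i :: quat where "quat_i = Quat 0 1 0 0"
definition quat_j :: quat where "quat_j = Quat 0 0 1 0"
definition quat_k :: quat where "quat_k = Quat 0 0 0 1"

lemma quat_unit_products:
  "quat_i * quat_i = -1" "quat_j * quat_j = -1" "quat_k * quat_k = -1"
  "quat_i * quat_j = quat_k" "quat_j * quat_k = quat_i" "quat_k * quat_i = quat_j"
  "quat_j * quat_i = - quat_k" "quat_k * quat_j = - quat_i" "quat_i * quat_k = - quat_j"
  by (simp_all add: quat_eq_iff quat_i_def quat_j_def quat_k_def)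

instantiation quat :: euclidean_space
begin

definition "Basis = {1, quat_i, quat_j, quat_k}"

instance
proof
  fix u v x :: quat
  show "(Basis :: quat set) \<noteq> {}" "finite (Basis :: quat set)"
    by (simp_all add: Basis_quat_def)
  show "inner u v = (if u = v then 1 else 0)" if "u \<in> Basis" "v \<in> Basis"
    using that unfolding Basis_quat_def
    by (elim insertE emptyE)
      (simp_all add: quat_i_def quat_j_def quat_k_def inner_quat_def quat_eq_iff)
  show "(\<forall>u\<in>Basis. inner x u = 0) \<longleftrightarrow> x = 0"
    by (simp add: Basis_quat_def quat_i_def quat_j_def quat_k_def inner_quat_def quat_eq_iff[of x])
qed

end

definition qcnj :: "quat \<Rightarrow> quat" where
  "qcnj x = Quat (qRe x) (- qI x) (- qJ x) (- qK x)"

text \<open>The measure \<open>dx / (2\<pi>)\<^bsup>n/2\<^esup>\<close>, where \<open>n\<close> is the dimension of the type.\<close>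

definition mu :: "'a::euclidean_space measure" where
  "mu = density lebesgue (\<lambda>_. ennreal (1 / (2 * pi) powr (real DIM('a) / 2)))"

text \<open>Membership in \<open>L\<^sup>2\<close> is stated for representatives; being non-zero in \<open>L\<^sup>2\<close> therefore
  means not being almost everywhere zero.\<close>

definition L2 :: "('a::euclidean_space \<Rightarrow> quat) set" where
  "L2 = {F. F \<in> borel_measurable lebesgue \<and> integrable mu (\<lambda>x. (norm (F x))\<^sup>2)}"

definition norm2 :: "('a::euclidean_space \<Rightarrow> quat) \<Rightarrow> real" where
  "norm2 F = sqrt (LINT x|mu. (norm (F x))\<^sup>2)"

text \<open>\<open>\<real>\<^bsup>2d\<^esup>\<close> is the type \<open>(real ^ 'd) \<times> (real ^ 'd)\<close> with \<open>d = CARD('d)\<close>. Since quaternions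
  do not commute, the order of the factors matters. For \<open>f\<close> and \<open>g\<close> in \<open>L\<^sup>2\<close> the integrand is
  integrable for all arguments.\<close>

definition ambiguity ::
  "((real ^ 'd) \<times> (real ^ 'd) \<Rightarrow> quat) \<Rightarrow> ((real ^ 'd) \<times> (real ^ 'd) \<Rightarrow> quat) \<Rightarrow>
   ((real ^ 'd) \<times> (real ^ 'd)) \<times> ((real ^ 'd) \<times> (real ^ 'd)) \<Rightarrow> quat" where
  "ambiguity f g = (\<lambda>(x, w). LINT t|mu.
     exp (- ((fst t \<bullet> fst w) *\<^sub>R quat_i)) * f (t + x /\<^sub>R 2) * qcnj (g (t - x /\<^sub>R 2)) *
     exp (- ((snd t \<bullet> snd w) *\<^sub>R quat_j)))"

text \<open>The notion is meant for \<open>F \<in> L2\<close> only: Bochner integrals of non-integrable functions are \<open>0\<close>.\<close>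

definition concentrated ::
  "real \<Rightarrow> 'a::euclidean_space set \<Rightarrow> ('a \<Rightarrow> quat) \<Rightarrow> bool" where
  "concentrated \<epsilon> U F \<longleftrightarrow> sqrt (LINT x:-U|mu. (norm (F x))\<^sup>2) \<le> \<epsilon> * norm2 F"

text \<open>In a lower bound \<open>(1 - \<epsilon>\<^sup>2) powr a\<close> the case \<open>\<epsilon> > 1\<close> has a negative base, for which a real
  power has no meaning (\<^term>\<open>(powr)\<close> would use the absolute value). There the bound is read as the
  trivial bound \<open>0\<close> by writing \<open>max 0 (1 - \<epsilon>\<^sup>2)\<close> for the base.\<close>

definition C_const :: "nat \<Rightarrow> real \<Rightarrow> real \<Rightarrow> real" where
  "C_const d p q = (4 / p) powr (real d / p) * (1 / q) powr (real d / q)"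

end

theory Submission
  imports Defs "HOL-Probability.Characteristic_Functions"
begin

text \<open>
  Write \<open>n = 2d\<close>, and for fixed \<open>x\<close> let \<open>h\<^sub>x(t) = f(t + x/2) cnj(g(t - x/2))\<close>, so that \<open>A(f,g)(x, \<cdot>)\<close> is the
  two-sided quaternion Fourier transform of \<open>h\<^sub>x\<close>. Plancherel's theorem gives
  \<open>\<parallel>A(f,g)\<parallel>\<^sub>2 = \<parallel>f\<parallel>\<^sub>2 \<parallel>g\<parallel>\<^sub>2\<close>. For a set \<open>V\<close> of frequencies, duality and the trivial bounds of the transform
  from \<open>L\<^sup>1\<close> to \<open>L\<^sup>\<infinity>\<close> and from \<open>L\<^sup>2\<close> to \<open>L\<^sup>2\<close> show that the energy of the transform of \<open>h\<^sub>x\<close> on \<open>V\<close> is at most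
  \<open>\<mu>(V)\<close> to the power \<open>1 - 2/p\<close> times the square of the norm of \<open>h\<^sub>x\<close> in \<open>L\<^sup>q\<close>. Applying this to the slices of \<open>U\<close>
  and using Hoelder's inequality in \<open>x\<close> bounds the energy of \<open>A(f,g)\<close> on \<open>U\<close> by \<open>\<mu>(U)\<close> to the power
  \<open>1 - 2/p\<close> times a norm in \<open>L\<close> to the \<open>p/q\<close> of a convolution of powers of \<open>|f|\<^sup>2\<close> and \<open>|g|\<^sup>2\<close>. The sharp Young
  inequality evaluates the latter to \<open>C\<^sub>p\<^sub>,\<^sub>q\<^sup>2 \<parallel>f\<parallel>\<^sup>2 \<parallel>g\<parallel>\<^sup>2\<close>.

  The sharp Young inequality is proved on the line by transporting the three densities to Gaussians:
  a weighted arithmetic-geometric mean inequality bounds the product of the derivatives of the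
  transport maps by the Jacobian of a plane map, and a change of variables leaves a Gaussian
  integral. It passes to higher dimension by integrating out one coordinate at a time.
\<close>

section \<open>Sharp Young inequality on the real line\<close>

text \<open>All exponents are governed by \<kappa> = q/2. Hoelder's inequality in x leaves the
  L^(p/q) norm of a correlation of |f|^q and |g|^q. What is known about f and g is that |f|^2 and
  |g|^2 are integrable, so Young's inequality is written for the powers \<kappa> of integrable
  functions and in terms of their masses. The balance of its exponents is the identity q - 1 = q/p,
  and 1/2 < \<kappa> < 1 says p > 2. The bounds on the Fourier side contribute only powers of 2 pi,
  which the normalisation of the measures absorbs exactly; the constant of the theorem is therefore
  entirely that of Young's inequality in dimension 2d. Two obstacles shape the details. Transport
  maps require continuous positive densities, and the duality argument for convolutions must divide
  by a quantity known to be finite. Young's inequality is therefore stated for bounded functions of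
  bounded support, a class stable under integrating out a coordinate, and general f and g are
  reached at the very end. Since the product of the shifted functions is integrable for every x, the
  transform is always an absolutely convergent integral and is never extended by density.\<close>

lemma density_cdf:
  fixes \<phi> :: "real \<Rightarrow> real"
  assumes cont: "continuous_on UNIV \<phi>" and pos: "\<And>x. \<phi> x > 0"
    and total: "(\<integral>\<^sup>+x. ennreal (\<phi> x) \<partial>lborel) = 1"
  obtains \<Phi> where "\<And>x. (\<Phi> has_real_derivative \<phi> x) (at x)"
    "\<And>x. 0 < \<Phi> x" "\<And>x. \<Phi> x < 1" "(\<Phi> \<longlongrightarrow> 0) at_bot" "(\<Phi> \<longlongrightarrow> 1) at_top"
proof -
  have [measurable]: "\<phi> \<in> borel_measurable borel"
    using cont by (rule borel_measurable_continuous_onI)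
  define M where "M = density lborel (\<lambda>x. ennreal (\<phi> x))"
  have em: "emeasure M A = (\<integral>\<^sup>+x. ennreal (\<phi> x) * indicator A x \<partial>lborel)" if "A \<in> sets borel" for A
    unfolding M_def using that by (subst emeasure_density) auto
  interpret prob_space M
    by (rule prob_spaceI) (simp add: M_def emeasure_density total)
  interpret real_distribution M
    by unfold_locales (simp add: M_def)
  have incr: "cdf M y - cdf M x = integral {x..y} \<phi>" if "x < y" for x y
  proof -
    have c: "continuous_on {x..y} \<phi>" using cont continuous_on_subset by blast
    have "cdf M y - cdf M x = measure M {x<..y}" by (rule cdf_diff_eq[OF that])
    also have "\<dots> = integral {x..y} \<phi>"
    proof -
      have "emeasure M {x<..y} = (\<integral>\<^sup>+z. ennreal (\<phi> z) * indicator {x..y} z \<partial>lborel)"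
        unfolding em[of "{x<..y}", simplified]
        by (intro nn_integral_cong_AE, use AE_lborel_singleton[of x] in eventually_elim)
           (auto simp: indicator_def)
      also have "\<dots> = (\<integral>\<^sup>+z. ennreal (if z \<in> {x..y} then \<phi> z else 0) \<partial>lborel)"
        by (intro nn_integral_cong) (auto simp: indicator_def)
      also have "\<dots> = ennreal (integral {x..y} \<phi>)"
        by (rule nn_integral_has_integral_lborel)
           (use integrable_integral[OF integrable_continuous_real[OF c]] pos
             in \<open>auto simp only: has_integral_restrict_UNIV less_imp_le split: if_splits, auto\<close>)
      finally show ?thesis
        using integral_nonneg[OF integrable_continuous_real[OF c]] pos
        by (simp add: measure_def less_imp_le)
    qed
    finally show ?thesis .
  qed
  have d: "(cdf M has_real_derivative \<phi> x) (at x)" for x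
  proof -
    have c: "continuous_on {x-1..x+1} \<phi>" using cont continuous_on_subset by blast
    have "((\<lambda>y. integral {x-1..y} \<phi>) has_real_derivative \<phi> x) (at x within {x-1..x+1})"
      by (rule integral_has_real_derivative[OF c]) auto
    then have "((\<lambda>y. cdf M (x-1) + integral {x-1..y} \<phi>) has_real_derivative \<phi> x) (at x)"
      by (auto simp: at_within_Icc_at intro!: derivative_eq_intros)
    then show ?thesis
    proof (rule has_field_derivative_transform_within_open[of _ _ _ "{x-1<..<x+1}"])
      fix y assume "y \<in> {x-1<..<x+1}"
      then show "cdf M (x-1) + integral {x-1..y} \<phi> = cdf M y"
        using incr[of "x-1" y] by auto
    qed auto
  qed
  \<comment> \<open>Positivity of \<open>\<phi>\<close> makes the distribution function strictly
    increasing, so its limits 0 and 1 are never attained. The strict bounds later place its values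
    inside the range of another distribution function.\<close>
  have mono: "cdf M x < cdf M y" if "x < y" for x y
    by (rule DERIV_pos_imp_increasing[OF that]) (use d pos in blast)
  show ?thesis
  proof (rule that[OF d])
    show "0 < cdf M x" for x using mono[of "x-1" x] cdf_nonneg[of "x-1"] by auto
    show "cdf M x < 1" for x using mono[of x "x+1"] cdf_bounded_prob[of "x+1"] by auto
  qed (rule cdf_lim_at_bot, rule cdf_lim_at_top_prob)
qed

text \<open>The monotone transport map: the inverse of one distribution function composed with the
  other. Only the differential equation is kept; its right-hand side is positive, so strict
  monotonicity can be recovered from it.\<close>

lemma increasing_transport:
  fixes \<phi> \<gamma> :: "real \<Rightarrow> real"
  assumes \<phi>: "continuous_on UNIV \<phi>" "\<And>x. \<phi> x > 0" "(\<integral>\<^sup>+x. ennreal (\<phi> x) \<partial>lborel) = 1"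
    and \<gamma>: "continuous_on UNIV \<gamma>" "\<And>x. \<gamma> x > 0" "(\<integral>\<^sup>+x. ennreal (\<gamma> x) \<partial>lborel) = 1"
  obtains T where "\<And>x. (T has_real_derivative \<phi> x / \<gamma> (T x)) (at x)"
proof -
  obtain \<Phi> where P: "\<And>x. (\<Phi> has_real_derivative \<phi> x) (at x)"
    "\<And>x. 0 < \<Phi> x" "\<And>x. \<Phi> x < 1" "(\<Phi> \<longlongrightarrow> 0) at_bot" "(\<Phi> \<longlongrightarrow> 1) at_top"
    using density_cdf[OF \<phi>] by metis
  obtain \<Gamma> where G: "\<And>x. (\<Gamma> has_real_derivative \<gamma> x) (at x)"
    "\<And>x. 0 < \<Gamma> x" "\<And>x. \<Gamma> x < 1" "(\<Gamma> \<longlongrightarrow> 0) at_bot" "(\<Gamma> \<longlongrightarrow> 1) at_top"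
    using density_cdf[OF \<gamma>] by metis
  have Gc: "continuous_on A \<Gamma>" for A
    using G(1) DERIV_isCont continuous_at_imp_continuous_on by blast
  have mono: "\<Gamma> x < \<Gamma> y" if "x < y" for x y
    by (rule DERIV_pos_imp_increasing[OF that]) (use G \<gamma> in blast)
  then have inj: "inj \<Gamma>" by (metis linorder_injI less_irrefl)
  have ex: "\<exists>u. \<Gamma> u = \<Phi> x" for x
  proof -
    have "eventually (\<lambda>u. \<Gamma> u < \<Phi> x) at_bot" using G(4) P(2) by (rule order_tendstoD)
    then obtain l where l: "\<Gamma> l < \<Phi> x" by (auto simp: eventually_at_bot_linorder)
    have "eventually (\<lambda>u. \<Gamma> u > \<Phi> x) at_top" using G(5) P(3) by (rule order_tendstoD)
    then obtain r where r: "\<Gamma> r > \<Phi> x" by (auto simp: eventually_at_top_linorder)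
    have "l \<le> r" using l r mono[of r l] by (auto simp: not_le[symmetric])
    then show ?thesis using IVT'[of \<Gamma> l "\<Phi> x" r] l r Gc by auto
  qed
  define T where "T x = inv \<Gamma> (\<Phi> x)" for x
  have GT: "\<Gamma> (T x) = \<Phi> x" for x unfolding T_def using ex[of x] by (metis f_inv_into_f rangeI)
  show ?thesis
  proof (rule that[of T])
    fix x
    have "(inv \<Gamma> has_derivative (\<lambda>h. inverse (\<gamma> (T x)) * h)) (at (\<Gamma> (T x)))"
      by (rule has_derivative_inverse_strong[of UNIV _ \<Gamma> _ "\<lambda>h. \<gamma> (T x) * h"])
         (use \<gamma>(2)[of "T x"] Gc inj G(1)[of "T x"] in \<open>auto simp: has_field_derivative_def fun_eq_iff\<close>)
    then have "(inv \<Gamma> has_real_derivative inverse (\<gamma> (T x))) (at (\<Gamma> (T x)))"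
      by (simp add: has_field_derivative_def)
    then have "(inv \<Gamma> has_real_derivative inverse (\<gamma> (T x))) (at (\<Phi> x))" by (simp add: GT)
    from DERIV_chain2[OF this P(1)] show "(T has_real_derivative \<phi> x / \<gamma> (T x)) (at x)"
      unfolding T_def[abs_def] by (simp add: field_simps)
  qed
qed

section \<open>Change of variables for maps of the plane\<close>

lemma lborel_real_pair:
  "(lborel :: (real \<times> real) measure) = distr (lborel :: (real^2) measure) borel (\<lambda>v. (v $ 1, v $ 2))"
proof (rule lborel_eqI)
  fix l u :: "real \<times> real"
  assume le: "\<And>b. b \<in> Basis \<Longrightarrow> l \<bullet> b \<le> u \<bullet> b"
  have B2: "(Basis :: (real^2) set) = {axis 1 1, axis 2 1}"
    by (auto simp: Basis_vec_def UNIV_2)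
  have ne: "axis 1 1 \<noteq> (axis 2 1 :: real^2)" by (simp add: axis_eq_axis)
  have "fst l \<le> fst u \<and> snd l \<le> snd u"
    using le[of "(1,0)"] le[of "(0,1)"] by (cases l; cases u) (auto simp: Basis_prod_def)
  then have le': "fst l \<le> fst u" "snd l \<le> snd u" by auto
  have ip: "(u - l) \<bullet> (1, 0) = fst u - fst l" "(u - l) \<bullet> (0, 1) = snd u - snd l"
    by (cases l; cases u; simp)+
  have "(\<lambda>v::real^2. (v $ 1, v $ 2)) -` box l u
      = box (vector [fst l, snd l]) (vector [fst u, snd u])"
    by (cases l; cases u) (auto simp: mem_box_cart mem_box Basis_prod_def forall_2 ball_Un)
  then show "emeasure (distr (lborel :: (real^2) measure) borel (\<lambda>v. (v $ 1, v $ 2))) (box l u)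
      = (\<Prod>b\<in>Basis. (u - l) \<bullet> b)"
    using le' ne by (subst emeasure_distr)
      (auto simp: B2 inner_axis emeasure_lborel_box_eq Basis_prod_def prod.union_disjoint
          prod.reindex inj_on_def ip ennreal_mult[symmetric] mult.commute intro!: borel_measurable_continuous_onI continuous_intros)
qed simp

text \<open>An inequality because nothing says that \<open>\<Theta>\<close> is onto: the left side
  is the integral of \<open>f\<close> over the range of \<open>\<Theta>\<close>, and
  \<open>f\<close> is nonnegative elsewhere. The map is carried to \<open>real^2\<close>, where its
  Jacobian is the determinant of a matrix.\<close>

lemma nn_integral_change_of_variables_le:
  fixes \<Theta> :: "real \<times> real \<Rightarrow> real \<times> real" and f :: "real \<times> real \<Rightarrow> real"
  assumes der: "\<And>z. (\<Theta> has_derivative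
        (\<lambda>h. (A z * fst h + B z * snd h, C z * fst h + D z * snd h))) (at z)"
    and inj: "inj \<Theta>"
    and meas: "A \<in> borel_measurable borel" "B \<in> borel_measurable borel"
       "C \<in> borel_measurable borel" "D \<in> borel_measurable borel"
    and f: "f \<in> borel_measurable borel" "\<And>z. 0 \<le> f z" "integrable lborel f"
  shows "(\<integral>\<^sup>+z. ennreal (\<bar>A z * D z - B z * C z\<bar> * f (\<Theta> z)) \<partial>lborel) \<le> (\<integral>\<^sup>+z. ennreal (f z) \<partial>lborel)"
proof -
  define p :: "real^2 \<Rightarrow> real \<times> real" where "p v = (v $ 1, v $ 2)" for v
  define v :: "real \<times> real \<Rightarrow> real^2" where "v z = vector [fst z, snd z]" for z
  have pv [simp]: "p (v z) = z" "v (p w) = w" for z w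
    by (simp_all add: p_def v_def vec_eq_iff forall_2)
  have linp: "bounded_linear p"
    unfolding p_def[abs_def] by (auto intro!: bounded_linear_Pair bounded_linear_vec_nth)
  have linv: "bounded_linear v"
    by (rule linear_conv_bounded_linear[THEN iffD1], rule linearI) (auto simp: v_def vec_eq_iff forall_2)
  have [measurable]: "p \<in> borel_measurable borel" "v \<in> borel_measurable borel"
    by (auto intro!: borel_measurable_continuous_onI linear_continuous_on linp linv)
  have nn: "(\<integral>\<^sup>+z. F z \<partial>lborel) = (\<integral>\<^sup>+w. F (p w) \<partial>lborel)" if "F \<in> borel_measurable borel" for F
    using that unfolding lborel_real_pair p_def[abs_def, symmetric] by (simp add: nn_integral_distr)
  define g where "g w = v (\<Theta> (p w))" for w
  define g' where "g' w h = v ((\<lambda>h. (A (p w) * fst h + B (p w) * snd h, C (p w) * fst h + D (p w) * snd h)) (p h))" for w h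
  have dg: "(g has_derivative g' w) (at w)" for w
    unfolding g_def[abs_def] g'_def[abs_def]
    by (rule bounded_linear.has_derivative[OF linv])
       (rule has_derivative_compose[OF bounded_linear.has_derivative[OF linp has_derivative_ident] der])
  have injg: "inj g"
    by (rule injI) (metis g_def inj injD pv)
  have det: "det (matrix (g' w)) = A (p w) * D (p w) - B (p w) * C (p w)" for w
    by (simp add: det_2 matrix_def g'_def p_def v_def axis_def)
  have contg: "continuous_on UNIV g"
    by (intro continuous_at_imp_continuous_on ballI has_derivative_continuous[OF dg])
  have cont\<Theta>: "continuous_on UNIV \<Theta>"
    by (intro continuous_at_imp_continuous_on ballI has_derivative_continuous[OF der])
  then have [measurable]: "\<Theta> \<in> borel_measurable borel" by (rule borel_measurable_continuous_onI)
  \<comment> \<open>Invariance of domain makes the range open, hence measurable, so that the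
    integrand can be restricted to it.\<close>
  have opn: "open (g ` UNIV)" by (rule invariance_of_domain[OF contg _ injg]) simp
  have intfp: "integrable lborel (\<lambda>w. f (p w))"
    using f(3) unfolding lborel_real_pair p_def[abs_def, symmetric] by (rule integrable_distr[rotated]) simp
  then have abs1: "(\<lambda>w. f (p w)) absolutely_integrable_on (g ` UNIV)"
    using opn set_integrable_subset[of lebesgue UNIV "\<lambda>w. f (p w)" "range g"]
    by (auto simp: set_integrable_def integrable_completion f)
  define I where "I = integral (range g) (\<lambda>w. f (p w))"
  \<comment> \<open>The change of variables theorem speaks of vector-valued integrands, so the
    scalar one is wrapped in \<open>real^1\<close> and unwrapped afterwards.\<close>
  let ?vec = "vec :: real \<Rightarrow> real^1"
  have lvec: "bounded_linear ?vec"
    by (rule linear_conv_bounded_linear[THEN iffD1], rule linearI) (auto simp: vec_eq_iff)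
  have "(\<lambda>w. ?vec (f (p w))) absolutely_integrable_on (range g)"
    using absolutely_integrable_linear[OF abs1 lvec] by (simp add: o_def)
  moreover have "integral (range g) (\<lambda>w. ?vec (f (p w))) = ?vec I"
    using integral_linear[OF _ lvec, of "\<lambda>w. f (p w)" "range g"] abs1
    by (simp add: o_def I_def absolutely_integrable_on_def)
  ultimately have cov: "(\<lambda>w. \<bar>det (matrix (g' w))\<bar> *\<^sub>R ?vec (f (p (g w)))) absolutely_integrable_on UNIV"
    "integral UNIV (\<lambda>w. \<bar>det (matrix (g' w))\<bar> *\<^sub>R ?vec (f (p (g w)))) = ?vec I"
    using has_absolute_integral_change_of_variables[of UNIV g g' "\<lambda>w. ?vec (f (p w))" "?vec I"]
      dg injg by auto
  have "((\<lambda>w. \<bar>det (matrix (g' w))\<bar> *\<^sub>R ?vec (f (p (g w)))) has_integral ?vec I) UNIV"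
    using cov by (simp add: absolutely_integrable_on_def has_integral_iff)
  from has_integral_linear[OF this bounded_linear_vec_nth[of 1]]
  have "((\<lambda>w. \<bar>det (matrix (g' w))\<bar> * f (p (g w))) has_integral I) UNIV"
    by (simp add: o_def)
  from nn_integral_has_integral_lebesgue[OF _ this]
  have 1: "(\<integral>\<^sup>+w. ennreal (\<bar>det (matrix (g' w))\<bar> * f (p (g w))) \<partial>lborel) = ennreal I"
    using f(2) by simp
  have "((\<lambda>w. f (p w)) has_integral I) (range g)"
    using abs1 by (simp add: absolutely_integrable_on_def has_integral_iff I_def)
  from nn_integral_has_integral_lebesgue[OF _ this]
  have 2: "(\<integral>\<^sup>+w. ennreal (indicator (range g) w * f (p w)) \<partial>lborel) = ennreal I"
    using f(2) by simp
  have "(\<integral>\<^sup>+z. ennreal (\<bar>A z * D z - B z * C z\<bar> * f (\<Theta> z)) \<partial>lborel) = ennreal I"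
    unfolding 1[symmetric] using f(1) meas
    by (subst nn) (auto simp: det g_def)
  also have "\<dots> \<le> (\<integral>\<^sup>+w. ennreal (f (p w)) \<partial>lborel)"
    unfolding 2[symmetric] by (intro nn_integral_mono ennreal_leI) (auto simp: indicator_def f)
  also have "\<dots> = (\<integral>\<^sup>+z. ennreal (f z) \<partial>lborel)" using f by (subst nn) auto
  finally show ?thesis .
qed

text \<open>The best constant, in dimension one, in Young's inequality with exponents \<open>1/\<kappa>\<close>, \<open>1/\<kappa>\<close> and
  \<open>1/(2 - 2\<kappa>)\<close>.\<close>

definition young_const :: "real \<Rightarrow> real" where
  "young_const \<kappa> = (2*\<kappa>-1) powr (\<kappa> - 1/2) * 2 powr (\<kappa> - 1) * \<kappa> powr (-\<kappa>)"

section \<open>Gaussian masses and the pointwise inequality under transport\<close>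

lemma nn_integral_gaussian:
  assumes "q > 0"
  shows "(\<integral>\<^sup>+x. ennreal (exp (- pi * q * x\<^sup>2)) \<partial>lborel) = ennreal (1 / sqrt q)"
proof -
  define \<sigma> where "\<sigma> = 1 / sqrt (2 * pi * q)"
  have \<sigma>: "\<sigma> > 0" "\<sigma>\<^sup>2 = 1 / (2 * pi * q)"
    using assms by (auto simp: \<sigma>_def power_divide)
  have e: "exp (- pi * q * x\<^sup>2) = (1 / sqrt q) * normal_density 0 \<sigma> x" for x
    using assms by (simp add: normal_density_def \<sigma>(2) real_sqrt_divide)
  have "ennreal (exp (- pi * q * x\<^sup>2)) = ennreal (1 / sqrt q) * ennreal (normal_density 0 \<sigma> x)" for x
    unfolding e using assms by (intro ennreal_mult) auto
  then have "(\<integral>\<^sup>+x. ennreal (exp (- pi * q * x\<^sup>2)) \<partial>lborel)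
      = (\<integral>\<^sup>+x. ennreal (1 / sqrt q) * ennreal (normal_density 0 \<sigma> x) \<partial>lborel)"
    by simp
  also have "\<dots> = ennreal (1 / sqrt q)"
    using \<sigma> prob_space.emeasure_space_1[OF prob_space_normal_density[of \<sigma> 0]] assms
    by (subst nn_integral_cmult) (auto simp: emeasure_density)
  finally show ?thesis .
qed

text \<open>Gibbs' inequality: \<open>ln_le_minus_one\<close> is applied to the ratios of the
  probability weights a/S, b/S, c/S to l, m, n, and the linear terms cancel. Dividing by the weights
  keeps the bound sharp, with equality when a : b : c = l : m : n.\<close>

lemma weighted_am_gm3:
  fixes a b c l m n :: real
  assumes "a > 0" "b > 0" "c > 0" "l > 0" "m > 0" "n > 0" "l + m + n = 1"
  shows "(a / l) powr l * (b / m) powr m * (c / n) powr n \<le> a + b + c"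
proof -
  define S where "S = a + b + c"
  have S: "S > 0" using assms by (simp add: S_def)
  have "l * ln (a / (l * S)) + m * ln (b / (m * S)) + n * ln (c / (n * S))
      \<le> l * (a / (l * S) - 1) + m * (b / (m * S) - 1) + n * (c / (n * S) - 1)"
    using assms S by (intro add_mono mult_left_mono ln_le_minus_one) auto
  also have "\<dots> = (a + b + c) / S - (l + m + n)"
  proof -
    have "k * (d / (k * S) - 1) = d / S - k" if "k > 0" for k d
      using that S by (simp add: field_simps)
    then show ?thesis using assms by (simp add: add_divide_distrib)
  qed
  also have "\<dots> = 0" using assms S by (simp add: S_def)
  finally have "l * ln (a / l) + m * ln (b / m) + n * ln (c / n) \<le> (l + m + n) * ln S"
    using assms(1-6) S by (simp add: ln_div ln_mult algebra_simps)
  then have "exp (l * ln (a / l) + m * ln (b / m) + n * ln (c / n)) \<le> exp (ln S)"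
    using assms by simp
  then show ?thesis using assms S by (simp add: powr_def exp_add S_def)
qed

text \<open>The constant \<open>\<beta>\<close> is the one that makes the bound sharp. The quadratic forms in the exponents
  satisfy \<open>\<kappa>/2 (u + v)\<^sup>2 + \<kappa> (2\<kappa> - 1)/2 (u - v + 2\<beta>w)\<^sup>2 \<le> \<kappa> u\<^sup>2 + \<kappa> v\<^sup>2 + (2 - 2\<kappa>) w\<^sup>2\<close>, and
  \<open>2 (XY + \<beta>XZ + \<beta>YZ)\<close> is the Jacobian determinant of the change of variables in
  \<open>young_trilinear_continuous\<close>.\<close>

lemma young_pointwise:
  fixes \<kappa> X Y Z u v w :: real
  assumes \<kappa>: "1/2 < \<kappa>" "\<kappa> < 1" and XYZ: "X > 0" "Y > 0" "Z > 0"
  defines "\<beta> \<equiv> sqrt (2 / (\<kappa> * (2*\<kappa>-1))) * (1 - \<kappa>)"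
  shows "(exp (- pi * u\<^sup>2) * X) powr \<kappa> * (exp (- pi * v\<^sup>2) * Y) powr \<kappa> * (exp (- pi * w\<^sup>2) * Z) powr (2 - 2*\<kappa>)
    \<le> young_const \<kappa> * (\<kappa> * sqrt (2*\<kappa>-1)) *
       ((X * Y + \<beta> * X * Z + \<beta> * Y * Z) *
        (exp (- pi * (\<kappa>/2) * (u + v)\<^sup>2) * exp (- pi * (\<kappa> * (2*\<kappa>-1) / 2) * (u - v + 2*\<beta>*w)\<^sup>2)))"
proof -
  define s where "s = \<kappa> * (2*\<kappa>-1) / 2"
  have s: "s > 0" using \<kappa> by (simp add: s_def)
  have b: "\<beta> = (1 - \<kappa>) / sqrt s"
    using \<kappa> by (simp add: \<beta>_def s_def real_sqrt_divide real_sqrt_mult)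
  have b0: "\<beta> > 0" using \<kappa> s by (simp add: b)
  have b2: "s * \<beta>\<^sup>2 = (1-\<kappa>)\<^sup>2" using s by (simp add: b power_divide)
  \<comment> \<open>The difference of the two sides is 1 - \<kappa> times a perfect square in u - v
    and w; \<open>b2\<close> says that \<beta> is the positive value at which the discriminant of
    this quadratic form vanishes.\<close>
  have quad: "\<kappa>/2 * (u + v)\<^sup>2 + s * (u - v + 2*\<beta>*w)\<^sup>2 \<le> \<kappa> * u\<^sup>2 + \<kappa> * v\<^sup>2 + (2 - 2*\<kappa>) * w\<^sup>2"
  proof -
    have "\<kappa> * u\<^sup>2 + \<kappa> * v\<^sup>2 + (2 - 2*\<kappa>) * w\<^sup>2 - \<kappa>/2 * (u + v)\<^sup>2 - s * (u - v + 2*\<beta>*w)\<^sup>2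
       = (\<kappa>/2 - s) * (u-v)\<^sup>2 + ((2 - 2*\<kappa>) - 4 * (s*\<beta>\<^sup>2)) * w\<^sup>2 - 4 * s * \<beta> * (u-v) * w"
      by (simp add: power2_eq_square algebra_simps)
    also have "\<dots> = \<kappa> * (1-\<kappa>) * (u-v)\<^sup>2 + 2*(1-\<kappa>)*(2*\<kappa>-1) * w\<^sup>2 - 4 * s * \<beta> * (u-v) * w"
      unfolding b2 by (simp add: s_def power2_eq_square field_simps)
    also have "4 * s * \<beta> = 4 * (s / sqrt s) * (1-\<kappa>)" by (simp add: b)
    also have "s / sqrt s = sqrt s" using s by (simp add: real_div_sqrt)
    also have "\<kappa> * (1-\<kappa>) * (u-v)\<^sup>2 + 2*(1-\<kappa>)*(2*\<kappa>-1) * w\<^sup>2 - 4 * sqrt s * (1-\<kappa>) * (u-v) * w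
       = (1-\<kappa>) * (sqrt \<kappa> * (u-v) - sqrt (2*(2*\<kappa>-1)) * w)\<^sup>2"
    proof -
      have "sqrt \<kappa> * sqrt (2*(2*\<kappa>-1)) = sqrt (4 * s)" by (simp add: s_def flip: real_sqrt_mult)
      also have "\<dots> = 2 * sqrt s" by (simp add: real_sqrt_mult)
      finally have e: "sqrt \<kappa> * sqrt (2*(2*\<kappa>-1)) = 2 * sqrt s" .
      have "(sqrt \<kappa> * (u-v) - sqrt (2*(2*\<kappa>-1)) * w)\<^sup>2
        = (sqrt \<kappa>)\<^sup>2 * (u-v)\<^sup>2 + (sqrt (2*(2*\<kappa>-1)))\<^sup>2 * w\<^sup>2 - 2 * (sqrt \<kappa> * sqrt (2*(2*\<kappa>-1))) * (u-v) * w"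
        by (simp only: power2_eq_square algebra_simps)
      also have "\<dots> = \<kappa> * (u-v)\<^sup>2 + (2*(2*\<kappa>-1)) * w\<^sup>2 - 4 * sqrt s * (u-v) * w"
        unfolding e using \<kappa> by simp
      finally have e2: "(sqrt \<kappa> * (u-v) - sqrt (2*(2*\<kappa>-1)) * w)\<^sup>2
        = \<kappa> * (u-v)\<^sup>2 + (2*(2*\<kappa>-1)) * w\<^sup>2 - 4 * sqrt s * (u-v) * w" .
      show ?thesis unfolding e2 by (simp add: algebra_simps)
    qed
    also have "\<dots> \<ge> 0" using \<kappa> by simp
    finally show ?thesis by simp
  qed
  \<comment> \<open>The weights 2\<kappa> - 1, 1 - \<kappa>, 1 - \<kappa> of the products XY, XZ, YZ
    add up to 1 and give X and Y the total exponent \<kappa> and Z the exponent 2 -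
    2\<kappa>.\<close>
  have amgm: "X powr \<kappa> * Y powr \<kappa> * Z powr (2 - 2*\<kappa>)
     \<le> young_const \<kappa> * (\<kappa> * sqrt (2*\<kappa>-1)) * (X * Y + \<beta> * X * Z + \<beta> * Y * Z)"
  proof -
    \<comment> \<open>This factor undoes the division by the weights: it collects 2\<kappa> - 1 from
      XY, and \<beta> / (1 - \<kappa>) = 1 / sqrt s from each of the two other products.\<close>
    let ?D = "(2*\<kappa>-1) powr (2*\<kappa>-1) * s powr (1-\<kappa>)"
    have D: "?D = young_const \<kappa> * (\<kappa> * sqrt (2*\<kappa>-1))"
    proof -
      have p: "0 < 2*\<kappa>-1" "0 < \<kappa>" using \<kappa> by auto
      have "s powr (1-\<kappa>) = \<kappa> powr (1-\<kappa>) * (2*\<kappa>-1) powr (1-\<kappa>) * 2 powr (\<kappa>-1)"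
        using p powr_minus_divide[of 2 "1-\<kappa>"] by (simp add: s_def powr_divide powr_mult)
      then have "?D = (2*\<kappa>-1) powr ((2*\<kappa>-1) + (1-\<kappa>)) * 2 powr (\<kappa>-1) * \<kappa> powr (1-\<kappa>)"
        by (simp only: powr_add mult_ac)
      also have "(2*\<kappa>-1) + (1-\<kappa>) = (\<kappa> - 1/2) + 1/2" by simp
      also have "\<kappa> powr (1-\<kappa>) = \<kappa> powr (-\<kappa>) * \<kappa>"
        using p powr_add[of \<kappa> "-\<kappa>" 1] by (simp add: add.commute)
      also have "(2*\<kappa>-1) powr ((\<kappa> - 1/2) + 1/2) = (2*\<kappa>-1) powr (\<kappa> - 1/2) * sqrt (2*\<kappa>-1)"
        using p by (simp only: powr_add powr_half_sqrt less_imp_le)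
      finally show ?thesis by (simp only: young_const_def mult_ac)
    qed
    have "(X * Y / (2*\<kappa>-1)) powr (2*\<kappa>-1) * (\<beta>*X*Z / (1-\<kappa>)) powr (1-\<kappa>) * (\<beta>*Y*Z / (1-\<kappa>)) powr (1-\<kappa>)
        \<le> X * Y + \<beta>*X*Z + \<beta>*Y*Z"
      using \<kappa> XYZ b0 by (intro weighted_am_gm3) auto
    moreover have "(X * Y / (2*\<kappa>-1)) powr (2*\<kappa>-1) * (\<beta>*X*Z / (1-\<kappa>)) powr (1-\<kappa>) * (\<beta>*Y*Z / (1-\<kappa>)) powr (1-\<kappa>)
       * ?D = X powr \<kappa> * Y powr \<kappa> * Z powr (2 - 2*\<kappa>)"
    proof -
      have e: "\<beta> * x * Z / (1-\<kappa>) = x * Z / sqrt s" for x using \<kappa> by (simp add: b)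
      have sq: "s powr (1-\<kappa>) = sqrt s powr (1-\<kappa>) * sqrt s powr (1-\<kappa>)"
        using s by (simp flip: powr_mult)
      have "X powr \<kappa> = X powr (2*\<kappa>-1) * X powr (1-\<kappa>)" "Y powr \<kappa> = Y powr (2*\<kappa>-1) * Y powr (1-\<kappa>)"
        "Z powr (2 - 2*\<kappa>) = Z powr (1-\<kappa>) * Z powr (1-\<kappa>)"
        by (simp_all flip: powr_add)
      then show ?thesis unfolding e sq using \<kappa> XYZ s
        by (simp add: powr_mult powr_divide)
    qed
    ultimately have "X powr \<kappa> * Y powr \<kappa> * Z powr (2 - 2*\<kappa>) \<le> (X * Y + \<beta>*X*Z + \<beta>*Y*Z) * ?D"
      by (metis mult_right_mono powr_ge_zero mult_nonneg_nonneg)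
    then show ?thesis unfolding D by (simp add: mult.commute)
  qed
  have "(exp (- pi * u\<^sup>2) * X) powr \<kappa> * (exp (- pi * v\<^sup>2) * Y) powr \<kappa> * (exp (- pi * w\<^sup>2) * Z) powr (2 - 2*\<kappa>)
     = exp (- pi * (\<kappa> * u\<^sup>2 + \<kappa> * v\<^sup>2 + (2 - 2*\<kappa>) * w\<^sup>2)) * (X powr \<kappa> * Y powr \<kappa> * Z powr (2 - 2*\<kappa>))"
    using XYZ by (simp add: powr_mult exp_powr_real algebra_simps flip: exp_add)
  also have "\<dots> \<le> exp (- pi * (\<kappa>/2 * (u + v)\<^sup>2 + s * (u - v + 2*\<beta>*w)\<^sup>2)) *
      (young_const \<kappa> * (\<kappa> * sqrt (2*\<kappa>-1)) * (X * Y + \<beta> * X * Z + \<beta> * Y * Z))"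
    by (rule mult_mono[OF _ amgm]) (use quad in auto)
  also have "\<dots> = young_const \<kappa> * (\<kappa> * sqrt (2*\<kappa>-1)) *
       ((X * Y + \<beta> * X * Z + \<beta> * Y * Z) *
        (exp (- pi * (\<kappa>/2) * (u + v)\<^sup>2) * exp (- pi * s * (u - v + 2*\<beta>*w)\<^sup>2)))"
    by (simp add: algebra_simps flip: exp_add)
  finally show ?thesis unfolding s_def .
qed

lemma young_trilinear_continuous:
  fixes \<phi> \<psi> \<eta> :: "real \<Rightarrow> real"
  assumes \<kappa>: "1/2 < \<kappa>" "\<kappa> < 1"
    and \<phi>: "continuous_on UNIV \<phi>" "\<And>x. \<phi> x > 0" "(\<integral>\<^sup>+x. ennreal (\<phi> x) \<partial>lborel) = 1"
    and \<psi>: "continuous_on UNIV \<psi>" "\<And>x. \<psi> x > 0" "(\<integral>\<^sup>+x. ennreal (\<psi> x) \<partial>lborel) = 1"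
    and \<eta>: "continuous_on UNIV \<eta>" "\<And>x. \<eta> x > 0" "(\<integral>\<^sup>+x. ennreal (\<eta> x) \<partial>lborel) = 1"
  shows "(\<integral>\<^sup>+z. ennreal (\<phi> (fst z) powr \<kappa> * \<psi> (snd z) powr \<kappa> * \<eta> (fst z - snd z) powr (2 - 2*\<kappa>)) \<partial>lborel)
    \<le> ennreal (young_const \<kappa>)"
proof -
  define \<gamma> :: "real \<Rightarrow> real" where "\<gamma> u = exp (- pi * u\<^sup>2)" for u
  have \<gamma>: "continuous_on UNIV \<gamma>" "\<And>x. \<gamma> x > 0" "(\<integral>\<^sup>+x. ennreal (\<gamma> x) \<partial>lborel) = 1"
    using nn_integral_gaussian[of 1] by (auto simp: \<gamma>_def[abs_def] intro!: continuous_intros)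
  obtain T1 where T1: "\<And>x. (T1 has_real_derivative \<phi> x / \<gamma> (T1 x)) (at x)"
    using increasing_transport[OF \<phi> \<gamma>] by metis
  obtain T2 where T2: "\<And>x. (T2 has_real_derivative \<psi> x / \<gamma> (T2 x)) (at x)"
    using increasing_transport[OF \<psi> \<gamma>] by metis
  obtain T3 where T3: "\<And>x. (T3 has_real_derivative \<eta> x / \<gamma> (T3 x)) (at x)"
    using increasing_transport[OF \<eta> \<gamma>] by metis
  define X where "X x = \<phi> x / \<gamma> (T1 x)" for x
  define Y where "Y x = \<psi> x / \<gamma> (T2 x)" for x
  define Z where "Z x = \<eta> x / \<gamma> (T3 x)" for x
  have pos: "X x > 0" "Y x > 0" "Z x > 0" for x
    using \<phi> \<psi> \<eta> \<gamma> by (auto simp: X_def Y_def Z_def)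
  have incr: "T x < T y" if "\<And>x. (T has_real_derivative D x) (at x)" "\<And>x. D x > 0" "x < y"
    for T D :: "real \<Rightarrow> real" and x y
    by (rule DERIV_pos_imp_increasing[OF that(3)]) (use that in blast)
  have mono: "T1 x < T1 y" "T2 x < T2 y" "T3 x < T3 y" if "x < y" for x y
    using incr[OF T1[folded X_def] pos(1) that] incr[OF T2[folded Y_def] pos(2) that]
      incr[OF T3[folded Z_def] pos(3) that] .
  have cT: "continuous_on UNIV T1" "continuous_on UNIV T2" "continuous_on UNIV T3"
    by (intro continuous_at_imp_continuous_on ballI DERIV_isCont[OF T1] DERIV_isCont[OF T2] DERIV_isCont[OF T3])+
  have c\<gamma>: "continuous_on UNIV (\<lambda>x. \<gamma> (T1 x))" "continuous_on UNIV (\<lambda>x. \<gamma> (T2 x))" "continuous_on UNIV (\<lambda>x. \<gamma> (T3 x))"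
    using cT by (auto simp: \<gamma>_def intro!: continuous_intros)
  have "continuous_on UNIV X" "continuous_on UNIV Y" "continuous_on UNIV Z"
    unfolding X_def Y_def Z_def using c\<gamma> \<phi> \<psi> \<eta> \<gamma>(2)
    by (auto intro!: continuous_intros simp: less_imp_neq[symmetric])
  then have mXYZ: "(\<lambda>z. X (fst z)) \<in> borel_measurable (borel :: (real \<times> real) measure)"
    "(\<lambda>z. Y (snd z)) \<in> borel_measurable (borel :: (real \<times> real) measure)"
    "(\<lambda>z. Z (fst z - snd z)) \<in> borel_measurable (borel :: (real \<times> real) measure)"
  proof -
    assume c: "continuous_on UNIV X" "continuous_on UNIV Y" "continuous_on UNIV Z"
    note m = c[THEN borel_measurable_continuous_onI]
    have "(\<lambda>z::real\<times>real. fst z) \<in> borel_measurable borel" "(\<lambda>z::real\<times>real. snd z) \<in> borel_measurable borel"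
      "(\<lambda>z::real\<times>real. fst z - snd z) \<in> borel_measurable borel"
      by (intro borel_measurable_continuous_onI continuous_intros)+
    from measurable_compose[OF this(1) m(1)] measurable_compose[OF this(2) m(2)] measurable_compose[OF this(3) m(3)]
    show "(\<lambda>z. X (fst z)) \<in> borel_measurable (borel :: (real \<times> real) measure)"
    "(\<lambda>z. Y (snd z)) \<in> borel_measurable (borel :: (real \<times> real) measure)"
    "(\<lambda>z. Z (fst z - snd z)) \<in> borel_measurable (borel :: (real \<times> real) measure)" .
  qed
  note [measurable] = mXYZ
  define \<beta> where "\<beta> = sqrt (2 / (\<kappa> * (2*\<kappa>-1))) * (1 - \<kappa>)"
  have \<beta>: "\<beta> > 0" using \<kappa> by (simp add: \<beta>_def)
  \<comment> \<open>The components are the linear forms u + v and u - v + 2\<beta>w of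
    \<open>young_pointwise\<close> evaluated along the transport maps. Its Gaussian factor thus
    becomes \<open>f (\<Theta> z)\<close>, and XY + \<beta>XZ + \<beta>YZ is minus half the Jacobian
    determinant.\<close>
  define \<Theta> where "\<Theta> z = (T1 (fst z) + T2 (snd z), T1 (fst z) - T2 (snd z) + 2*\<beta> * T3 (fst z - snd z))" for z
  define f :: "real \<times> real \<Rightarrow> real" where
    "f z = exp (- pi * (\<kappa>/2) * (fst z)\<^sup>2) * exp (- pi * (\<kappa> * (2*\<kappa>-1) / 2) * (snd z)\<^sup>2)" for z
  have mf [measurable]: "f \<in> borel_measurable borel" unfolding f_def[abs_def]
    by (intro borel_measurable_continuous_onI continuous_intros)
  \<comment> \<open>This mass is the reciprocal of \<kappa> sqrt(2\<kappa> - 1) / 2, the factor that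
    accompanies \<open>young_const \<kappa>\<close> after the change of variables, so that only the
    constant survives.\<close>
  have nnf: "(\<integral>\<^sup>+z. ennreal (f z) \<partial>lborel) = ennreal (2 / (\<kappa> * sqrt (2*\<kappa>-1)))"
  proof -
    have "(\<integral>\<^sup>+z. ennreal (f z) \<partial>lborel) = (\<integral>\<^sup>+x. \<integral>\<^sup>+y. ennreal (f (x, y)) \<partial>lborel \<partial>lborel)"
      unfolding lborel_prod[symmetric] by (subst lborel.nn_integral_fst[symmetric]) (simp_all add: lborel_prod)
    also have "\<dots> = ennreal (1 / sqrt (\<kappa>/2)) * ennreal (1 / sqrt (\<kappa> * (2*\<kappa>-1) / 2))"
    proof -
      have "(\<integral>\<^sup>+x. \<integral>\<^sup>+y. ennreal (exp (- pi * a * x\<^sup>2) * exp (- pi * b * y\<^sup>2)) \<partial>lborel \<partial>lborel)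
        = ennreal (1 / sqrt a) * ennreal (1 / sqrt b)" if "a > 0" "b > 0" for a b :: real
      proof -
        have "(\<integral>\<^sup>+x. \<integral>\<^sup>+y. ennreal (exp (- pi * a * x\<^sup>2) * exp (- pi * b * y\<^sup>2)) \<partial>lborel \<partial>lborel)
          = (\<integral>\<^sup>+x. ennreal (exp (- pi * a * x\<^sup>2)) \<partial>lborel) * (\<integral>\<^sup>+y. ennreal (exp (- pi * b * y\<^sup>2)) \<partial>lborel)"
          by (simp add: ennreal_mult nn_integral_cmult nn_integral_multc)
        then show ?thesis by (simp only: nn_integral_gaussian that)
      qed
      from this[of "\<kappa>/2" "\<kappa> * (2*\<kappa>-1) / 2"] show ?thesis using \<kappa> by (simp only: f_def fst_conv snd_conv) simp
    qed
    also have "\<dots> = ennreal (1 / (sqrt (\<kappa>/2) * sqrt (\<kappa> * (2*\<kappa>-1) / 2)))"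
      using \<kappa> by (subst ennreal_mult[symmetric]) auto
    also have "sqrt (\<kappa>/2) * sqrt (\<kappa> * (2*\<kappa>-1) / 2) = sqrt ((\<kappa>/2)\<^sup>2 * (2*\<kappa>-1))"
      by (simp add: power2_eq_square flip: real_sqrt_mult)
    also have "\<dots> = \<kappa>/2 * sqrt (2*\<kappa>-1)"
      using \<kappa> by (simp add: real_sqrt_mult)
    finally show ?thesis by simp
  qed
  have inj: "inj \<Theta>"
  proof (rule injI)
    fix z z' assume eq: "\<Theta> z = \<Theta> z'"
    \<comment> \<open>If the first coordinate grows while T1 + T2 is fixed, then T2 and with it the
      second coordinate decrease, so the difference of the coordinates grows. All terms of the
      second component of \<open>\<Theta>\<close> then move strictly up, as \<beta> > 0.\<close>
    have *: False if lt: "fst x < fst y" and eq: "\<Theta> x = \<Theta> y" for x y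
    proof -
      have a: "T1 (fst x) < T1 (fst y)" using lt mono by auto
      then have b: "T2 (snd x) > T2 (snd y)" using eq by (auto simp: \<Theta>_def)
      then have "snd x > snd y" using mono(2)[of "snd x" "snd y"] by (auto simp: neq_iff intro: ccontr)
         (metis less_irrefl less_trans not_less_iff_gr_or_eq)
      then have "T3 (fst x - snd x) < T3 (fst y - snd y)" using lt mono(3) by auto
      then have "2*\<beta> * T3 (fst x - snd x) < 2*\<beta> * T3 (fst y - snd y)" using \<beta> by simp
      then show False using a b eq by (auto simp: \<Theta>_def)
    qed
    have f: "fst z = fst z'" using *[of z z'] *[of z' z] eq by (auto simp: neq_iff intro: ccontr)
       (metis eq linorder_neqE)
    then have "T2 (snd z) = T2 (snd z')" using eq by (auto simp: \<Theta>_def)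
    then have "snd z = snd z'" using mono(2) by (metis less_irrefl linorder_neqE)
    then show "z = z'" using f by (simp add: prod_eq_iff)
  qed
  have "(\<integral>\<^sup>+z. ennreal (\<phi> (fst z) powr \<kappa> * \<psi> (snd z) powr \<kappa> * \<eta> (fst z - snd z) powr (2 - 2*\<kappa>)) \<partial>lborel)
    \<le> (\<integral>\<^sup>+z. ennreal (young_const \<kappa> * (\<kappa> * sqrt (2*\<kappa>-1)) / 2) *
       ennreal (\<bar>X (fst z) * (- Y (snd z) - 2*\<beta>*Z (fst z - snd z)) - Y (snd z) * (X (fst z) + 2*\<beta>*Z (fst z - snd z))\<bar> * f (\<Theta> z)) \<partial>lborel)"
  proof (intro nn_integral_mono)
    fix z :: "real \<times> real"
    obtain a b where z: "z = (a, b)" by (cases z)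
    have e: "\<phi> a = exp (- pi * (T1 a)\<^sup>2) * X a" "\<psi> b = exp (- pi * (T2 b)\<^sup>2) * Y b"
       "\<eta> (a - b) = exp (- pi * (T3 (a - b))\<^sup>2) * Z (a - b)"
      using \<gamma>(2) by (auto simp: X_def Y_def Z_def \<gamma>_def)
    have "\<bar>X a * (- Y b - 2*\<beta>*Z (a - b)) - Y b * (X a + 2*\<beta>*Z (a - b))\<bar>
        = \<bar>- (2 * (X a * Y b + \<beta> * X a * Z (a - b) + \<beta> * Y b * Z (a - b)))\<bar>"
      by (simp add: algebra_simps)
    also have "\<dots> = 2 * (X a * Y b + \<beta> * X a * Z (a - b) + \<beta> * Y b * Z (a - b))"
      using pos \<beta> by (subst abs_minus_cancel, subst abs_of_nonneg) (auto intro!: add_nonneg_nonneg mult_nonneg_nonneg simp: less_imp_le)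
    finally have d: "\<bar>X a * (- Y b - 2*\<beta>*Z (a - b)) - Y b * (X a + 2*\<beta>*Z (a - b))\<bar>
       = 2 * (X a * Y b + \<beta> * X a * Z (a - b) + \<beta> * Y b * Z (a - b))" .
    have yc: "0 \<le> young_const \<kappa> * (\<kappa> * sqrt (2*\<kappa>-1)) / 2" using \<kappa> by (simp add: young_const_def)
    define S where "S = X a * Y b + \<beta> * X a * Z (a - b) + \<beta> * Y b * Z (a - b)"
    have "\<phi> a powr \<kappa> * \<psi> b powr \<kappa> * \<eta> (a - b) powr (2 - 2*\<kappa>)
      \<le> young_const \<kappa> * (\<kappa> * sqrt (2*\<kappa>-1)) * (S * f (\<Theta> (a, b)))"
      using young_pointwise[OF \<kappa> pos(1)[of a] pos(2)[of b] pos(3)[of "a-b"], of "T1 a" "T2 b" "T3 (a-b)", folded \<beta>_def e]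
      by (simp only: S_def f_def \<Theta>_def fst_conv snd_conv)
    also have "\<dots> = young_const \<kappa> * (\<kappa> * sqrt (2*\<kappa>-1)) / 2 * (2 * S * f (\<Theta> (a, b)))"
      by simp
    finally show "ennreal (\<phi> (fst z) powr \<kappa> * \<psi> (snd z) powr \<kappa> * \<eta> (fst z - snd z) powr (2 - 2*\<kappa>))
      \<le> ennreal (young_const \<kappa> * (\<kappa> * sqrt (2*\<kappa>-1)) / 2) *
       ennreal (\<bar>X (fst z) * (- Y (snd z) - 2*\<beta>*Z (fst z - snd z)) - Y (snd z) * (X (fst z) + 2*\<beta>*Z (fst z - snd z))\<bar> * f (\<Theta> z))"
      unfolding z fst_conv snd_conv d S_def[symmetric] ennreal_mult'[OF yc, symmetric] by (rule ennreal_leI)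
  qed
  also have "\<dots> = ennreal (young_const \<kappa> * (\<kappa> * sqrt (2*\<kappa>-1)) / 2) *
     (\<integral>\<^sup>+z. ennreal (\<bar>X (fst z) * (- Y (snd z) - 2*\<beta>*Z (fst z - snd z)) - Y (snd z) * (X (fst z) + 2*\<beta>*Z (fst z - snd z))\<bar> * f (\<Theta> z)) \<partial>lborel)"
  proof (rule nn_integral_cmult)
    have "continuous_on UNIV \<Theta>" unfolding \<Theta>_def[abs_def]
      by (intro continuous_intros continuous_on_compose2[OF cT(1)] continuous_on_compose2[OF cT(2)] continuous_on_compose2[OF cT(3)]) auto
    from measurable_compose[OF borel_measurable_continuous_onI[OF this] mf]
    have "(\<lambda>z. f (\<Theta> z)) \<in> borel_measurable borel" .
    then show "(\<lambda>z. ennreal (\<bar>X (fst z) * (- Y (snd z) - 2*\<beta>*Z (fst z - snd z)) - Y (snd z) * (X (fst z) + 2*\<beta>*Z (fst z - snd z))\<bar> * f (\<Theta> z))) \<in> borel_measurable lborel"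
      using mXYZ by simp
  qed
  also have "\<dots> \<le> ennreal (young_const \<kappa> * (\<kappa> * sqrt (2*\<kappa>-1)) / 2) * (\<integral>\<^sup>+z. ennreal (f z) \<partial>lborel)"
  proof (intro mult_left_mono nn_integral_change_of_variables_le inj)
    show "(\<Theta> has_derivative (\<lambda>h. (X (fst z) * fst h + Y (snd z) * snd h,
       (X (fst z) + 2*\<beta>*Z (fst z - snd z)) * fst h + (- Y (snd z) - 2*\<beta>*Z (fst z - snd z)) * snd h))) (at z)" for z
    proof -
      have d: "((\<lambda>z. T1 (fst z)) has_derivative (\<lambda>h. X (fst z) * fst h)) (at z)"
        "((\<lambda>z. T2 (snd z)) has_derivative (\<lambda>h. Y (snd z) * snd h)) (at z)"
        "((\<lambda>z. T3 (fst z - snd z)) has_derivative (\<lambda>h. Z (fst z - snd z) * (fst h - snd h))) (at z)"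
        using has_derivative_compose[OF has_derivative_fst[OF has_derivative_ident] T1[folded X_def, unfolded has_field_derivative_def]]
          has_derivative_compose[OF has_derivative_snd[OF has_derivative_ident] T2[folded Y_def, unfolded has_field_derivative_def]]
          has_derivative_compose[OF has_derivative_diff[OF has_derivative_fst[OF has_derivative_ident]
             has_derivative_snd[OF has_derivative_ident]] T3[folded Z_def, unfolded has_field_derivative_def]]
        by simp_all
      show ?thesis unfolding \<Theta>_def[abs_def]
        by (rule has_derivative_eq_rhs[OF has_derivative_Pair[OF has_derivative_add[OF d(1,2)]
              has_derivative_add[OF has_derivative_diff[OF d(1,2)] has_derivative_mult_right[OF d(3)]]]])
           (auto simp: fun_eq_iff algebra_simps)
    qed
    show "integrable lborel f" 
      by (rule integrableI_nonneg) (simp_all add: nnf, simp add: f_def)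
    show "f \<in> borel_measurable borel" by (rule mf)
    show "0 \<le> f z" for z by (simp add: f_def)
  qed (use mXYZ in auto)
  also have "\<dots> = ennreal (young_const \<kappa>)"
    unfolding nnf using \<kappa> by (subst ennreal_mult'[symmetric]) (auto simp: young_const_def)
  finally show ?thesis .
qed

section \<open>Removing continuity and positivity by approximation\<close>

lemma bounded_support_continuous_approx:
  fixes f :: "'a::euclidean_space \<Rightarrow> 'b::euclidean_space"
  assumes meas: "f \<in> borel_measurable borel" and M: "\<And>x. norm (f x) \<le> M"
    and supp: "\<And>x. norm x > R \<Longrightarrow> f x = 0"
  shows "\<exists>g :: nat \<Rightarrow> 'a \<Rightarrow> 'b. (\<forall>n. continuous_on UNIV (g n)) \<and> (\<forall>n x. norm (g n x) \<le> M) \<and>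
    (\<forall>n x. norm x \<ge> R + 1 \<longrightarrow> g n x = 0) \<and> (AE x in lborel. (\<lambda>n. g n x) \<longlonglongrightarrow> f x)"
proof -
  have "f measurable_on UNIV"
    using meas by (intro lebesgue_measurable_imp_measurable_on) (auto intro: measurable_completion)
  then obtain N g where N: "negligible N" and g: "\<And>n. continuous_on UNIV (g n)"
    and lim: "\<And>x. x \<notin> N \<Longrightarrow> (\<lambda>n. g n x) \<longlonglongrightarrow> f x"
    unfolding measurable_on_def by auto
  have M0: "M \<ge> 0" using M[of 0] norm_ge_zero order_trans by blast
  \<comment> \<open>The cutoff is 1 on the ball of radius R and 0 beyond R + 1;
    \<open>closest_point\<close> projects continuously onto the ball of radius M. Both leave the
    values of \<open>f\<close> unchanged, so they impose support and bound without disturbing the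
    limit.\<close>
  define c where "c x = min 1 (max 0 (R + 1 - norm x))" for x :: 'a
  define h where "h n x = c x *\<^sub>R closest_point (cball 0 M) (g n x)" for n x
  have cc: "continuous_on UNIV c" unfolding c_def by (intro continuous_intros)
  have cont: "continuous_on UNIV (closest_point (cball 0 M :: 'b set))"
    using M0 by (intro continuous_on_closest_point) auto
  have inb: "norm (closest_point (cball 0 M) y) \<le> M" for y :: 'b
    using closest_point_in_set[of "cball 0 M" y] M0 by auto
  show ?thesis
  proof (intro exI[of _ h] conjI allI impI)
    show "continuous_on UNIV (h n)" for n
      unfolding h_def by (intro continuous_intros cc continuous_on_compose2[OF cont g]) auto
    have c01: "0 \<le> c x" "c x \<le> 1" for x by (auto simp: c_def)
    show "norm (h n x) \<le> M" for n x
      using mult_mono[OF c01(2)[of x] inb[of "g n x"]] c01 by (auto simp: h_def)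
    show "h n x = 0" if "norm x \<ge> R + 1" for n x using that by (auto simp: h_def c_def)
    have "AE x in lebesgue. x \<notin> N"
      using N by (intro AE_not_in) (simp add: negligible_iff_null_sets)
    then have "AE x in lborel. x \<notin> N" by (simp add: AE_completion_iff)
    then show "AE x in lborel. (\<lambda>n. h n x) \<longlonglongrightarrow> f x"
    proof eventually_elim
      case (elim x)
      have "(\<lambda>n. closest_point (cball 0 M) (g n x)) \<longlonglongrightarrow> closest_point (cball 0 M) (f x)"
        using continuous_on_tendsto_compose[OF cont lim[OF elim]] by simp
      also have "closest_point (cball 0 M) (f x) = f x"
        using M[of x] by (intro closest_point_self) auto
      finally have "(\<lambda>n. h n x) \<longlonglongrightarrow> c x *\<^sub>R f x" unfolding h_def by (intro tendsto_intros)
      also have "c x *\<^sub>R f x = f x" using supp[of x] by (cases "norm x > R") (auto simp: c_def)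
      finally show ?case .
    qed
  qed
qed

lemma integral_bounded_support_approx:
  fixes f :: "'a::euclidean_space \<Rightarrow> 'b::euclidean_space"
  assumes "\<And>n. g n \<in> borel_measurable borel" "f \<in> borel_measurable borel"
    "\<And>n x. norm (g n x) \<le> M" "\<And>n x. norm x \<ge> R \<Longrightarrow> g n x = 0" "AE x in lborel. (\<lambda>n. g n x) \<longlonglongrightarrow> f x"
  shows "(\<lambda>n. LINT x|lborel. g n x) \<longlonglongrightarrow> (LINT x|lborel. f x)"
proof (rule integral_dominated_convergence)
  have "emeasure lborel (cball 0 R :: 'a set) < \<infinity>" by (rule emeasure_lborel_cball_finite)
  then show "integrable lborel (\<lambda>x::'a. M * indicator (cball 0 R) x)"
    by (intro integrable_mult_right) (auto simp: integrable_indicator_iff)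
  have "M \<ge> 0" using assms(3)[of 0 0] norm_ge_zero order_trans by blast
  then have "norm (g n x) \<le> M * indicator (cball 0 R) x" for n x
    using assms(3)[of n x] assms(4)[of x n] by (auto simp: indicator_def)
  then show "\<And>n. AE x in lborel. norm (g n x) \<le> M * indicator (cball 0 R) x" by simp
qed (use assms in auto)

lemma integrable_bounded_support:
  fixes f :: "'a::euclidean_space \<Rightarrow> 'b::{banach,second_countable_topology}"
  assumes "f \<in> borel_measurable borel" "\<And>x. norm (f x) \<le> M" "\<And>x. norm x > R \<Longrightarrow> f x = 0"
  shows "integrable lborel f"
  by (rule integrableI_bounded_set[where A="cball 0 R" and B=M])
     (use assms emeasure_lborel_cball_finite[of 0 R] in auto)

text \<open>Both sides are homogeneous of degrees \<kappa>, \<kappa> and 2 - 2\<kappa> in the three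
  functions. Dividing by the masses, which positivity keeps away from 0, reduces to densities of
  mass 1.\<close>

lemma young_trilinear_continuous_mass:
  fixes \<phi> \<psi> \<eta> :: "real \<Rightarrow> real"
  assumes \<kappa>: "1/2 < \<kappa>" "\<kappa> < 1"
    and \<phi>: "continuous_on UNIV \<phi>" "\<And>x. \<phi> x > 0" "integrable lborel \<phi>"
    and \<psi>: "continuous_on UNIV \<psi>" "\<And>x. \<psi> x > 0" "integrable lborel \<psi>"
    and \<eta>: "continuous_on UNIV \<eta>" "\<And>x. \<eta> x > 0" "integrable lborel \<eta>"
  shows "(\<integral>\<^sup>+a. \<integral>\<^sup>+b. ennreal (\<phi> a powr \<kappa> * \<psi> b powr \<kappa> * \<eta> (a - b) powr (2 - 2*\<kappa>)) \<partial>lborel \<partial>lborel)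
    \<le> ennreal (young_const \<kappa> * integral\<^sup>L lborel \<phi> powr \<kappa> * integral\<^sup>L lborel \<psi> powr \<kappa> *
        integral\<^sup>L lborel \<eta> powr (2 - 2*\<kappa>))"
proof -
  have norm: "integral\<^sup>L lborel f > 0 \<and> (\<integral>\<^sup>+x. ennreal (f x / integral\<^sup>L lborel f) \<partial>lborel) = 1"
    if f: "\<And>x. f x > 0" "integrable lborel f" for f :: "real \<Rightarrow> real"
  proof -
    have "integral\<^sup>L lborel f \<noteq> 0"
    proof
      assume "integral\<^sup>L lborel f = 0"
      then have "AE x in lborel. f x = 0"
        using f by (subst (asm) integral_nonneg_eq_0_iff_AE) (auto simp: less_imp_le)
      then have "AE x::real in lborel. False"
        by eventually_elim (use f in \<open>auto simp: less_imp_neq[symmetric]\<close>)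
      then show False by (subst (asm) AE_iff_null) (auto simp: null_sets_def)
    qed
    moreover have "integral\<^sup>L lborel f \<ge> 0" using f by (auto simp: less_imp_le)
    ultimately have pos: "integral\<^sup>L lborel f > 0" by linarith
    have "(\<integral>\<^sup>+x. ennreal (f x / integral\<^sup>L lborel f) \<partial>lborel) = ennreal (LINT x|lborel. f x / integral\<^sup>L lborel f)"
      using f pos by (intro nn_integral_eq_integral) (auto simp: less_imp_le)
    also have "\<dots> = 1" using pos by simp
    finally show ?thesis using pos by auto
  qed
  define A B C where "A = integral\<^sup>L lborel \<phi>" "B = integral\<^sup>L lborel \<psi>" "C = integral\<^sup>L lborel \<eta>"
  have p: "A > 0" "B > 0" "C > 0"
    and n: "(\<integral>\<^sup>+x. ennreal (\<phi> x / A) \<partial>lborel) = 1" "(\<integral>\<^sup>+x. ennreal (\<psi> x / B) \<partial>lborel) = 1"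
      "(\<integral>\<^sup>+x. ennreal (\<eta> x / C) \<partial>lborel) = 1"
    using norm[OF \<phi>(2,3)] norm[OF \<psi>(2,3)] norm[OF \<eta>(2,3)] by (auto simp: A_B_C_def)
  have [measurable]: "\<phi> \<in> borel_measurable borel" "\<psi> \<in> borel_measurable borel" "\<eta> \<in> borel_measurable borel"
    using \<phi> \<psi> \<eta> by (auto intro: borel_measurable_continuous_onI)
  define W where "W = A powr \<kappa> * B powr \<kappa> * C powr (2 - 2*\<kappa>)"
  let ?F = "\<lambda>a b. (\<phi> a / A) powr \<kappa> * (\<psi> b / B) powr \<kappa> * (\<eta> (a - b) / C) powr (2 - 2*\<kappa>)"
  have "(\<integral>\<^sup>+a. \<integral>\<^sup>+b. ennreal (\<phi> a powr \<kappa> * \<psi> b powr \<kappa> * \<eta> (a - b) powr (2 - 2*\<kappa>)) \<partial>lborel \<partial>lborel)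
    = (\<integral>\<^sup>+a. \<integral>\<^sup>+b. ennreal W * ennreal (?F a b) \<partial>lborel \<partial>lborel)"
  proof (intro nn_integral_cong)
    fix a b
    have "\<phi> a powr \<kappa> * \<psi> b powr \<kappa> * \<eta> (a - b) powr (2 - 2*\<kappa>) = W * ?F a b"
      using p \<phi>(2) \<psi>(2) \<eta>(2) by (simp add: W_def powr_divide less_imp_le)
    then show "ennreal (\<phi> a powr \<kappa> * \<psi> b powr \<kappa> * \<eta> (a - b) powr (2 - 2*\<kappa>)) = ennreal W * ennreal (?F a b)"
      by (simp add: ennreal_mult W_def)
  qed
  also have "\<dots> = ennreal W * (\<integral>\<^sup>+a. \<integral>\<^sup>+b. ennreal (?F a b) \<partial>lborel \<partial>lborel)"
    by (simp add: nn_integral_cmult)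
  also have "(\<integral>\<^sup>+a. \<integral>\<^sup>+b. ennreal (?F a b) \<partial>lborel \<partial>lborel)
     = (\<integral>\<^sup>+z. ennreal (?F (fst z) (snd z)) \<partial>lborel)"
    by (subst lborel_prod[symmetric], subst lborel.nn_integral_fst[symmetric]) auto
  also have "ennreal W * \<dots> \<le> ennreal W * ennreal (young_const \<kappa>)"
    by (intro mult_left_mono, rule young_trilinear_continuous[OF \<kappa>])
       (use p n \<phi> \<psi> \<eta> in \<open>auto intro!: continuous_intros\<close>)
  also have "\<dots> = ennreal (young_const \<kappa> * A powr \<kappa> * B powr \<kappa> * C powr (2 - 2*\<kappa>))"
    by (simp add: W_def ennreal_mult[symmetric] young_const_def mult_ac)
  finally show ?thesis by (simp only: A_B_C_def)
qed

text \<open>Along approximants the masses converge, so the right side passes to the limit; for the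
  left side Fatou's lemma, once in each variable, gives the direction that is wanted.\<close>

lemma young_trilinear_real:
  fixes \<phi> \<psi> \<eta> :: "real \<Rightarrow> real"
  assumes \<kappa>: "1/2 < \<kappa>" "\<kappa> < 1"
    and meas: "\<phi> \<in> borel_measurable borel" "\<psi> \<in> borel_measurable borel" "\<eta> \<in> borel_measurable borel"
    and nonneg: "\<And>x. 0 \<le> \<phi> x" "\<And>x. 0 \<le> \<psi> x" "\<And>x. 0 \<le> \<eta> x"
    and bdd: "\<And>x. \<phi> x \<le> M" "\<And>x. \<psi> x \<le> M" "\<And>x. \<eta> x \<le> M"
    and supp: "\<And>x. \<bar>x\<bar> > R \<Longrightarrow> \<phi> x = 0" "\<And>x. \<bar>x\<bar> > R \<Longrightarrow> \<psi> x = 0" "\<And>x. \<bar>x\<bar> > R \<Longrightarrow> \<eta> x = 0"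
  shows "(\<integral>\<^sup>+a. \<integral>\<^sup>+b. ennreal (\<phi> a powr \<kappa> * \<psi> b powr \<kappa> * \<eta> (a - b) powr (2 - 2*\<kappa>)) \<partial>lborel \<partial>lborel)
    \<le> ennreal (young_const \<kappa> * integral\<^sup>L lborel \<phi> powr \<kappa> * integral\<^sup>L lborel \<psi> powr \<kappa> *
        integral\<^sup>L lborel \<eta> powr (2 - 2*\<kappa>))"
proof -
  \<comment> \<open>A Gaussian of mass 1/(n + 1), added to the approximants to make them strictly
    positive; its values and its mass tend to 0.\<close>
  define e where "e n x = exp (- pi * 1 * x\<^sup>2) / real (Suc n)" for n and x :: real
  have e_cont: "continuous_on UNIV (e n)" for n unfolding e_def by (intro continuous_intros) auto
  have e_pos: "e n x > 0" for n x by (simp add: e_def)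
  have gauss: "integrable lborel (\<lambda>x::real. exp (- pi * 1 * x\<^sup>2))"
    by (rule integrableI_nonneg) (auto simp: nn_integral_gaussian[of 1, simplified])
  have e_int: "integrable lborel (e n)" for n unfolding e_def by (intro integrable_divide gauss)
  have e_lim: "(\<lambda>n. e n x) \<longlonglongrightarrow> 0" for x
    unfolding e_def by (rule lim_const_over_n[THEN LIMSEQ_Suc])
  have e_lim_int: "(\<lambda>n. integral\<^sup>L lborel (e n)) \<longlonglongrightarrow> 0"
    unfolding e_def integral_divide_zero by (rule lim_const_over_n[THEN LIMSEQ_Suc])
  have supp': "\<forall>x. \<bar>x\<bar> > R \<longrightarrow> \<phi> x = 0" "\<forall>x. \<bar>x\<bar> > R \<longrightarrow> \<psi> x = 0" "\<forall>x. \<bar>x\<bar> > R \<longrightarrow> \<eta> x = 0"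
    using supp by auto
  have approx: "\<exists>g :: nat \<Rightarrow> real \<Rightarrow> real. (\<forall>n. continuous_on UNIV (g n) \<and> integrable lborel (g n) \<and> (\<forall>x. g n x > 0)) \<and>
      (AE x in lborel. (\<lambda>n. g n x) \<longlonglongrightarrow> f x) \<and> (\<lambda>n. integral\<^sup>L lborel (g n)) \<longlonglongrightarrow> integral\<^sup>L lborel f"
    if f: "f \<in> borel_measurable borel" "\<And>x. 0 \<le> f x" "\<And>x. f x \<le> M" "\<forall>x. \<bar>x\<bar> > R \<longrightarrow> f x = 0" for f
  proof -
    have nM: "\<And>x. norm (f x) \<le> M" and supp': "\<And>x. norm x > R \<Longrightarrow> f x = 0" using f by auto
    obtain g :: "nat \<Rightarrow> real \<Rightarrow> real"
      where g: "\<And>n. continuous_on UNIV (g n)" "\<And>n x. norm (g n x) \<le> M"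
      "\<And>n x. norm x \<ge> R + 1 \<Longrightarrow> g n x = 0" "AE x in lborel. (\<lambda>n. g n x) \<longlonglongrightarrow> f x"
      using bounded_support_continuous_approx[of f M R, OF f(1) nM supp'] by auto
    define h where "h n x = max 0 (g n x)" for n x
    have h_cont: "continuous_on UNIV (h n)" for n unfolding h_def by (intro continuous_intros g)
    have h_meas [measurable]: "h n \<in> borel_measurable borel" for n
      using h_cont by (rule borel_measurable_continuous_onI)
    have h_bd: "norm (h n x) \<le> M" for n x using g(2)[of n x] by (auto simp: h_def)
    have h_supp: "h n x = 0" if "norm x \<ge> R + 1" for n x using g(3)[OF that] by (simp add: h_def)
    have h_int: "integrable lborel (h n)" for n
      by (rule integrable_bounded_support[of _ M "R+1"]) (use h_bd h_supp in auto)
    have h_lim: "AE x in lborel. (\<lambda>n. h n x) \<longlonglongrightarrow> f x"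
      using g(4)
    proof eventually_elim
      case (elim x)
      then have "(\<lambda>n. max 0 (g n x)) \<longlonglongrightarrow> max 0 (f x)" by (intro tendsto_intros)
      then show ?case using f(2)[of x] by (simp add: h_def)
    qed
    have h_lim_int: "(\<lambda>n. integral\<^sup>L lborel (h n)) \<longlonglongrightarrow> integral\<^sup>L lborel f"
      by (rule integral_bounded_support_approx[OF h_meas f(1) h_bd h_supp h_lim])
    show ?thesis
    proof (intro exI[of _ "\<lambda>n x. h n x + e n x"] conjI allI)
      show "continuous_on UNIV (\<lambda>x. h n x + e n x)" for n by (intro continuous_intros h_cont e_cont)
      show "integrable lborel (\<lambda>x. h n x + e n x)" for n by (rule Bochner_Integration.integrable_add[OF h_int e_int])
      show "h n x + e n x > 0" for n x using e_pos[of n x] by (simp add: h_def add_nonneg_pos)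
      show "AE x in lborel. (\<lambda>n. h n x + e n x) \<longlonglongrightarrow> f x"
        using h_lim by eventually_elim (use tendsto_add[OF _ e_lim] in fastforce)
      show "(\<lambda>n. LINT x|lborel. h n x + e n x) \<longlonglongrightarrow> integral\<^sup>L lborel f"
        using tendsto_add[OF h_lim_int e_lim_int] h_int e_int by simp
    qed
  qed
  from approx[OF meas(1) nonneg(1) bdd(1) supp'(1)] obtain g1 where
      G1: "\<forall>n. continuous_on UNIV (g1 n) \<and> integrable lborel (g1 n) \<and> (\<forall>x. g1 n x > 0)"
      and A1: "AE x in lborel. (\<lambda>n. g1 n x) \<longlonglongrightarrow> \<phi> x" "(\<lambda>n. integral\<^sup>L lborel (g1 n)) \<longlonglongrightarrow> integral\<^sup>L lborel \<phi>"
    by (elim exE conjE) (rule that; assumption)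
  have g1: "\<And>n. continuous_on UNIV (g1 n)" "\<And>n x. g1 n x > 0" "\<And>n. integrable lborel (g1 n)"
      "AE x in lborel. (\<lambda>n. g1 n x) \<longlonglongrightarrow> \<phi> x" "(\<lambda>n. integral\<^sup>L lborel (g1 n)) \<longlonglongrightarrow> integral\<^sup>L lborel \<phi>"
    using G1 A1 by (simp_all only: simp_thms)

  from approx[OF meas(2) nonneg(2) bdd(2) supp'(2)] obtain g2 where
      G2: "\<forall>n. continuous_on UNIV (g2 n) \<and> integrable lborel (g2 n) \<and> (\<forall>x. g2 n x > 0)"
      and A2: "AE x in lborel. (\<lambda>n. g2 n x) \<longlonglongrightarrow> \<psi> x" "(\<lambda>n. integral\<^sup>L lborel (g2 n)) \<longlonglongrightarrow> integral\<^sup>L lborel \<psi>"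
    by (elim exE conjE) (rule that; assumption)
  have g2: "\<And>n. continuous_on UNIV (g2 n)" "\<And>n x. g2 n x > 0" "\<And>n. integrable lborel (g2 n)"
      "AE x in lborel. (\<lambda>n. g2 n x) \<longlonglongrightarrow> \<psi> x" "(\<lambda>n. integral\<^sup>L lborel (g2 n)) \<longlonglongrightarrow> integral\<^sup>L lborel \<psi>"
    using G2 A2 by (simp_all only: simp_thms)

  from approx[OF meas(3) nonneg(3) bdd(3) supp'(3)] obtain g3 where
      G3: "\<forall>n. continuous_on UNIV (g3 n) \<and> integrable lborel (g3 n) \<and> (\<forall>x. g3 n x > 0)"
      and A3: "AE x in lborel. (\<lambda>n. g3 n x) \<longlonglongrightarrow> \<eta> x" "(\<lambda>n. integral\<^sup>L lborel (g3 n)) \<longlonglongrightarrow> integral\<^sup>L lborel \<eta>"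
    by (elim exE conjE) (rule that; assumption)
  have g3: "\<And>n. continuous_on UNIV (g3 n)" "\<And>n x. g3 n x > 0" "\<And>n. integrable lborel (g3 n)"
      "AE x in lborel. (\<lambda>n. g3 n x) \<longlonglongrightarrow> \<eta> x" "(\<lambda>n. integral\<^sup>L lborel (g3 n)) \<longlonglongrightarrow> integral\<^sup>L lborel \<eta>"
    using G3 A3 by (simp_all only: simp_thms)

  have gm [measurable]: "g1 n \<in> borel_measurable borel" "g2 n \<in> borel_measurable borel" "g3 n \<in> borel_measurable borel" for n
    using g1 g2 g3 by (auto intro: borel_measurable_continuous_onI)
  note meas [measurable]
  let ?F = "\<lambda>n a b. ennreal (g1 n a powr \<kappa> * g2 n b powr \<kappa> * g3 n (a - b) powr (2 - 2*\<kappa>))"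
  let ?J = "\<lambda>A B C. young_const \<kappa> * A powr \<kappa> * B powr \<kappa> * C powr (2 - 2*\<kappa>)"
  \<comment> \<open>Convergence almost everywhere is pulled back along b |-> a - b, which preserves
    null sets; hence it holds for every a.\<close>
  have AE3: "AE b in lborel. (\<lambda>n. g3 n (a - b)) \<longlonglongrightarrow> \<eta> (a - b)" for a
  proof -
    have "Measurable.pred borel (\<lambda>x. (\<lambda>n. g3 n x) \<longlonglongrightarrow> \<eta> x)" by measurable
    from AE_borel_affine[OF _ this g3(4), of "-1" a] show ?thesis by simp
  qed
  have int0: "integral\<^sup>L lborel \<phi> \<ge> 0" "integral\<^sup>L lborel \<psi> \<ge> 0" "integral\<^sup>L lborel \<eta> \<ge> 0"
    using nonneg by auto
  have "(\<integral>\<^sup>+a. \<integral>\<^sup>+b. ennreal (\<phi> a powr \<kappa> * \<psi> b powr \<kappa> * \<eta> (a - b) powr (2 - 2*\<kappa>)) \<partial>lborel \<partial>lborel)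
    \<le> (\<integral>\<^sup>+a. liminf (\<lambda>n. \<integral>\<^sup>+b. ?F n a b \<partial>lborel) \<partial>lborel)"
  proof (rule nn_integral_mono_AE, use g1(4) in eventually_elim)
    fix a assume a: "(\<lambda>n. g1 n a) \<longlonglongrightarrow> \<phi> a"
    have "(\<integral>\<^sup>+b. ennreal (\<phi> a powr \<kappa> * \<psi> b powr \<kappa> * \<eta> (a - b) powr (2 - 2*\<kappa>)) \<partial>lborel)
       = (\<integral>\<^sup>+b. liminf (\<lambda>n. ?F n a b) \<partial>lborel)"
    proof (rule nn_integral_cong_AE, use g2(4) AE3[of a] in eventually_elim)
      fix b assume b: "(\<lambda>n. g2 n b) \<longlonglongrightarrow> \<psi> b" "(\<lambda>n. g3 n (a - b)) \<longlonglongrightarrow> \<eta> (a - b)"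
      have "(\<lambda>n. ?F n a b) \<longlonglongrightarrow> ennreal (\<phi> a powr \<kappa> * \<psi> b powr \<kappa> * \<eta> (a - b) powr (2 - 2*\<kappa>))"
        using a b \<kappa> by (intro tendsto_ennrealI tendsto_mult tendsto_powr')
           (auto simp: less_imp_le[OF g1(2)] less_imp_le[OF g2(2)] less_imp_le[OF g3(2)])
      from lim_imp_Liminf[OF _ this]
      show "ennreal (\<phi> a powr \<kappa> * \<psi> b powr \<kappa> * \<eta> (a - b) powr (2 - 2*\<kappa>)) = liminf (\<lambda>n. ?F n a b)" by simp
    qed
    also have "\<dots> \<le> liminf (\<lambda>n. \<integral>\<^sup>+b. ?F n a b \<partial>lborel)"
      by (intro nn_integral_liminf) measurable
    finally show "(\<integral>\<^sup>+b. ennreal (\<phi> a powr \<kappa> * \<psi> b powr \<kappa> * \<eta> (a - b) powr (2 - 2*\<kappa>)) \<partial>lborel) \<le> \<dots>" .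
  qed
  also have "\<dots> \<le> liminf (\<lambda>n. \<integral>\<^sup>+a. \<integral>\<^sup>+b. ?F n a b \<partial>lborel \<partial>lborel)"
    by (intro nn_integral_liminf) measurable
  also have "\<dots> \<le> liminf (\<lambda>n. ennreal (?J (integral\<^sup>L lborel (g1 n)) (integral\<^sup>L lborel (g2 n)) (integral\<^sup>L lborel (g3 n))))"
    by (intro Liminf_mono always_eventually allI young_trilinear_continuous_mass[OF \<kappa>] g1 g2 g3)
  also have "\<dots> = ennreal (?J (integral\<^sup>L lborel \<phi>) (integral\<^sup>L lborel \<psi>) (integral\<^sup>L lborel \<eta>))"
  proof (rule lim_imp_Liminf)
    show "(\<lambda>n. ennreal (?J (integral\<^sup>L lborel (g1 n)) (integral\<^sup>L lborel (g2 n)) (integral\<^sup>L lborel (g3 n))))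
       \<longlonglongrightarrow> ennreal (?J (integral\<^sup>L lborel \<phi>) (integral\<^sup>L lborel \<psi>) (integral\<^sup>L lborel \<eta>))"
      using g1(5) g2(5) g3(5) \<kappa>
      by (intro tendsto_ennrealI tendsto_mult tendsto_powr' tendsto_const)
         (auto intro!: always_eventually integral_nonneg_AE simp: less_imp_le[OF g1(2)] less_imp_le[OF g2(2)] less_imp_le[OF g3(2)])
  qed simp
  finally show ?thesis .
qed

section \<open>Sharp Young inequality in Euclidean space\<close>

lemma integrable_PiM_lborel_bounded:
  fixes f :: "('i \<Rightarrow> real) \<Rightarrow> real"
  assumes I: "finite I" and f: "f \<in> borel_measurable (PiM I (\<lambda>_. lborel))"
    "\<And>x. 0 \<le> f x" "\<And>x. f x \<le> M" "\<And>x i. i \<in> I \<Longrightarrow> \<bar>x i\<bar> > R \<Longrightarrow> f x = 0"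
  shows "integrable (PiM I (\<lambda>_. lborel)) f"
proof -
  interpret product_sigma_finite "\<lambda>_::'i. lborel :: real measure" ..
  show ?thesis
  proof (rule integrableI_bounded_set[where A="PiE I (\<lambda>_. {-R..R})" and B=M])
    show "emeasure (PiM I (\<lambda>_. lborel)) (PiE I (\<lambda>_. {-R..R})) < \<infinity>"
      using I by (subst emeasure_PiM) (auto simp: emeasure_lborel_Icc_eq ennreal_power less_top[symmetric] power_eq_top_ennreal)
    show "PiE I (\<lambda>_. {-R..R}) \<in> sets (PiM I (\<lambda>_. lborel))"
      using I by (intro sets_PiM_I_finite) auto
    have "f x = 0" if "x \<in> space (PiM I (\<lambda>_. lborel))" "x \<notin> PiE I (\<lambda>_. {-R..R})" for x
    proof -
      have "\<exists>i\<in>I. x i \<notin> {-R..R}"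
      proof (rule ccontr)
        assume "\<not> ?thesis"
        then show False using that by (auto simp: space_PiM PiE_iff)
      qed
      then obtain i where "i \<in> I" "\<bar>x i\<bar> > R" by fastforce
      then show ?thesis by (rule f(4))
    qed
    then show "AE x in PiM I (\<lambda>_. lborel). x \<notin> PiE I (\<lambda>_. {-R..R}) \<longrightarrow> f x = 0" by (intro AE_I2) auto
  qed (use f in auto)
qed

text \<open>Tensorization: with the other coordinates frozen, the inequality on the line replaces
  each function by its integral over coordinate \<open>i\<close>, at the price of one factor
  \<open>young_const \<kappa>\<close>. The partial integrals are again bounded with bounded support,
  but \<open>M\<close> becomes 2 R M, which is why \<open>M\<close> varies in the induction.\<close>

lemma young_trilinear_PiM:
  fixes \<phi> \<psi> \<eta> :: "('i \<Rightarrow> real) \<Rightarrow> real"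
  assumes \<kappa>: "1/2 < \<kappa>" "\<kappa> < 1"
    and "finite I" "0 \<le> M" "0 \<le> R"
    and "\<phi> \<in> borel_measurable (PiM I (\<lambda>_. lborel))" "\<psi> \<in> borel_measurable (PiM I (\<lambda>_. lborel))"
      "\<eta> \<in> borel_measurable (PiM I (\<lambda>_. lborel))"
    and "\<And>x. 0 \<le> \<phi> x" "\<And>x. 0 \<le> \<psi> x" "\<And>x. 0 \<le> \<eta> x"
    and "\<And>x. \<phi> x \<le> M" "\<And>x. \<psi> x \<le> M" "\<And>x. \<eta> x \<le> M"
    and "\<And>x i. i \<in> I \<Longrightarrow> \<bar>x i\<bar> > R \<Longrightarrow> \<phi> x = 0" "\<And>x i. i \<in> I \<Longrightarrow> \<bar>x i\<bar> > R \<Longrightarrow> \<psi> x = 0"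
      "\<And>x i. i \<in> I \<Longrightarrow> \<bar>x i\<bar> > R \<Longrightarrow> \<eta> x = 0"
  shows "(\<integral>\<^sup>+a. \<integral>\<^sup>+b. ennreal (\<phi> a powr \<kappa> * \<psi> b powr \<kappa> * \<eta> (\<lambda>i\<in>I. a i - b i) powr (2 - 2*\<kappa>))
        \<partial>PiM I (\<lambda>_. lborel) \<partial>PiM I (\<lambda>_. lborel))
    \<le> ennreal (young_const \<kappa> ^ card I * integral\<^sup>L (PiM I (\<lambda>_. lborel)) \<phi> powr \<kappa> *
        integral\<^sup>L (PiM I (\<lambda>_. lborel)) \<psi> powr \<kappa> * integral\<^sup>L (PiM I (\<lambda>_. lborel)) \<eta> powr (2 - 2*\<kappa>))"
  using assms(3-)
proof (induction I arbitrary: M \<phi> \<psi> \<eta> rule: finite_induct)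
  interpret product_sigma_finite "\<lambda>_::'i. lborel :: real measure" ..
  case empty
  interpret finite_measure "PiM {} (\<lambda>_::'i. lborel :: real measure)"
    by standard (simp add: space_PiM)
  have [simp]: "measure (PiM {} (\<lambda>_::'i. lborel :: real measure)) {\<lambda>k. undefined} = 1"
    by (simp add: measure_def PiM_empty)
  show ?case
    using empty by (simp add: PiM_empty lebesgue_integral_count_space_finite nn_integral_count_space_finite restrict_def)
next
  interpret product_sigma_finite "\<lambda>_::'i. lborel :: real measure" ..
  case (insert i I)
  note prems = insert.prems
  let ?P = "PiM I (\<lambda>_::'i. lborel :: real measure)" and ?Q = "PiM (insert i I) (\<lambda>_::'i. lborel :: real measure)"
  interpret P: sigma_finite_measure ?P by (rule sigma_finite) fact
  interpret Q: sigma_finite_measure ?Q by (rule sigma_finite) (use insert in auto)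
  interpret PL: pair_sigma_finite lborel ?P ..
  define red where "red f x = (LINT s|lborel. f (x(i := s)))" for f :: "('i \<Rightarrow> real) \<Rightarrow> real" and x
  note [measurable] = prems(3-5)
  have upd [measurable]: "(\<lambda>z. (fst z)(i := snd z)) \<in> measurable (?P \<Otimes>\<^sub>M lborel) ?Q"
    using measurable_add_dim[of i I "\<lambda>_. lborel"] by (simp add: case_prod_beta')
  have red: "red f \<in> borel_measurable ?P" "\<And>x. 0 \<le> red f x" "\<And>x. red f x \<le> 2 * R * M"
      "\<And>x j. j \<in> I \<Longrightarrow> \<bar>x j\<bar> > R \<Longrightarrow> red f x = 0" "integral\<^sup>L ?P (red f) = integral\<^sup>L ?Q f"
    if f: "f \<in> borel_measurable ?Q" "\<And>x. 0 \<le> f x" "\<And>x. f x \<le> M"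
      "\<forall>x j. j \<in> insert i I \<longrightarrow> \<bar>x j\<bar> > R \<longrightarrow> f x = 0" for f
  proof -
    note f(1) [measurable]
    have "(\<lambda>z. f ((fst z)(i := snd z))) \<in> borel_measurable (?P \<Otimes>\<^sub>M lborel)" by measurable
    then show "red f \<in> borel_measurable ?P" unfolding red_def[abs_def]
      by (intro lborel.borel_measurable_lebesgue_integral) (simp add: case_prod_beta')
    show "0 \<le> red f x" for x unfolding red_def using f by (intro integral_nonneg_AE) auto
    show "red f x \<le> 2 * R * M" for x
    proof -
      have "red f x \<le> (LINT s|lborel. M * indicator {-R..R} s)" unfolding red_def
      proof (rule integral_mono')
        show "integrable lborel (\<lambda>s. M * indicator {-R..R} s)" by (auto intro!: integrable_mult_right integrable_real_indicator simp: emeasure_lborel_Icc_eq)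
        show "f (x(i := s)) \<le> M * indicator {-R..R} s" for s
          using f(3)[of "x(i := s)"] f(4)[rule_format, of i "x(i := s)"] by (auto simp: indicator_def)
        show "0 \<le> M * indicator {-R..R} s" for s using prems by (auto simp: indicator_def)
      qed
      also have "\<dots> = 2 * R * M" using prems by (simp add: measure_def emeasure_lborel_Icc_eq)
      finally show ?thesis .
    qed
    show "red f x = 0" if "j \<in> I" "\<bar>x j\<bar> > R" for x j
    proof -
      have "f (x(i := s)) = 0" for s
        using that insert.hyps by (intro f(4)[rule_format, of j]) auto
      then show ?thesis by (simp add: red_def)
    qed
    show "integral\<^sup>L ?P (red f) = integral\<^sup>L ?Q f" unfolding red_def
      using insert.hyps f
      by (subst product_integral_insert) (auto intro!: integrable_PiM_lborel_bounded[where M=M and R=R])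
  qed
  have sphi: "\<forall>x j. j \<in> insert i I \<longrightarrow> \<bar>x j\<bar> > R \<longrightarrow> \<phi> x = 0" using prems(12) by blast
  note r\<phi> = red[OF prems(3) prems(6) prems(9) sphi]
  have spsi: "\<forall>x j. j \<in> insert i I \<longrightarrow> \<bar>x j\<bar> > R \<longrightarrow> \<psi> x = 0" using prems(13) by blast
  note r\<psi> = red[OF prems(4) prems(7) prems(10) spsi]
  have seta: "\<forall>x j. j \<in> insert i I \<longrightarrow> \<bar>x j\<bar> > R \<longrightarrow> \<eta> x = 0" using prems(14) by blast
  note r\<eta> = red[OF prems(5) prems(8) prems(11) seta]
  let ?D = "\<lambda>J a b. (\<lambda>j\<in>J. a j - b j) :: 'i \<Rightarrow> real"
  have D [measurable]: "(\<lambda>z. ?D J (fst z) (snd z)) \<in> measurable (PiM J (\<lambda>_. lborel) \<Otimes>\<^sub>M PiM J (\<lambda>_. lborel)) (PiM J (\<lambda>_. lborel))" for J :: "'i set"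
    by (intro measurable_restrict) measurable
  define F where "F a b = ennreal (\<phi> a powr \<kappa> * \<psi> b powr \<kappa> * \<eta> (?D (insert i I) a b) powr (2 - 2*\<kappa>))" for a b
  have F [measurable]: "(\<lambda>z. F (fst z) (snd z)) \<in> borel_measurable (?Q \<Otimes>\<^sub>M ?Q)"
    unfolding F_def by measurable
  have Deq: "?D (insert i I) (x(i := s)) (y(i := t)) = (?D I x y)(i := s - t)" for x y s t
    using insert.hyps by (auto simp: fun_eq_iff restrict_def)
  have "(\<integral>\<^sup>+a. \<integral>\<^sup>+b. F a b \<partial>?Q \<partial>?Q) = (\<integral>\<^sup>+x. \<integral>\<^sup>+s. \<integral>\<^sup>+b. F (x(i := s)) b \<partial>?Q \<partial>lborel \<partial>?P)"
    using insert.hyps by (subst product_nn_integral_insert) auto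
  also have "\<dots> = (\<integral>\<^sup>+x. \<integral>\<^sup>+s. \<integral>\<^sup>+y. \<integral>\<^sup>+t. F (x(i := s)) (y(i := t)) \<partial>lborel \<partial>?P \<partial>lborel \<partial>?P)"
  proof (intro nn_integral_cong)
    fix x s assume x: "x \<in> space ?P"
    have "x(i := s) \<in> space ?Q" using x by (auto simp: space_PiM PiE_def extensional_def)
    from measurable_compose[OF measurable_Pair1'[OF this] F]
    show "(\<integral>\<^sup>+b. F (x(i := s)) b \<partial>?Q) = (\<integral>\<^sup>+y. \<integral>\<^sup>+t. F (x(i := s)) (y(i := t)) \<partial>lborel \<partial>?P)"
      using insert.hyps by (subst product_nn_integral_insert) auto
  qed
  \<comment> \<open>Tonelli's theorem brings the two integrals over coordinate \<open>i\<close>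
    together, where the inequality on the line applies.\<close>
  also have "\<dots> = (\<integral>\<^sup>+x. \<integral>\<^sup>+y. \<integral>\<^sup>+s. \<integral>\<^sup>+t. F (x(i := s)) (y(i := t)) \<partial>lborel \<partial>lborel \<partial>?P \<partial>?P)"
  proof (intro nn_integral_cong, rule PL.Fubini'[symmetric])
    fix x assume x: "x \<in> space ?P"
    have m: "(\<lambda>s. x(i := s)) \<in> measurable lborel ?Q"
      by (rule measurable_component_update[OF x insert.hyps(2)])
    have "(\<lambda>z. (x(i := fst (fst z)), (snd (fst z))(i := snd z))) \<in> measurable ((lborel \<Otimes>\<^sub>M ?P) \<Otimes>\<^sub>M lborel) (?Q \<Otimes>\<^sub>M ?Q)"
      using measurable_compose[OF _ m, of "\<lambda>z. fst (fst z)" "(lborel \<Otimes>\<^sub>M ?P) \<Otimes>\<^sub>M lborel"]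
        measurable_compose[OF _ upd, of "\<lambda>z. (snd (fst z), snd z)" "(lborel \<Otimes>\<^sub>M ?P) \<Otimes>\<^sub>M lborel"]
      by (intro measurable_Pair) auto
    from measurable_compose[OF this F]
    have "(\<lambda>z. F (x(i := fst (fst z))) ((snd (fst z))(i := snd z))) \<in> borel_measurable ((lborel \<Otimes>\<^sub>M ?P) \<Otimes>\<^sub>M lborel)"
      by simp
    then have "(\<lambda>z. \<integral>\<^sup>+t. F (x(i := fst z)) ((snd z)(i := t)) \<partial>lborel) \<in> borel_measurable (lborel \<Otimes>\<^sub>M ?P)"
      by (intro lborel.borel_measurable_nn_integral) (simp add: case_prod_beta')
    then show "(\<lambda>(s, y). \<integral>\<^sup>+t. F (x(i := s)) (y(i := t)) \<partial>lborel) \<in> borel_measurable (lborel \<Otimes>\<^sub>M ?P)"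
      by (simp add: case_prod_beta')
  qed
  also have "\<dots> \<le> (\<integral>\<^sup>+x. \<integral>\<^sup>+y. ennreal (young_const \<kappa>) * ennreal (red \<phi> x powr \<kappa> * red \<psi> y powr \<kappa> * red \<eta> (?D I x y) powr (2 - 2*\<kappa>)) \<partial>?P \<partial>?P)"
  proof (intro nn_integral_mono)
    fix x y assume xy: "x \<in> space ?P" "y \<in> space ?P"
    have dxy: "?D I x y \<in> space ?P" by (auto simp: space_PiM)
    have m: "(\<lambda>s. x(i := s)) \<in> measurable borel ?Q" if "x \<in> space ?P" for x
      using measurable_component_update[OF that insert.hyps(2)] by simp
    have "(\<integral>\<^sup>+s. \<integral>\<^sup>+t. F (x(i := s)) (y(i := t)) \<partial>lborel \<partial>lborel)
      \<le> ennreal (young_const \<kappa> * red \<phi> x powr \<kappa> * red \<psi> y powr \<kappa> * red \<eta> (?D I x y) powr (2 - 2*\<kappa>))"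
      unfolding F_def Deq red_def
    proof (rule young_trilinear_real[OF \<kappa>, where R=R and M=M])
      show "(\<lambda>s. \<phi> (x(i := s))) \<in> borel_measurable borel" by (rule measurable_compose[OF m[OF xy(1)] prems(3)])
      show "(\<lambda>s. \<psi> (y(i := s))) \<in> borel_measurable borel" by (rule measurable_compose[OF m[OF xy(2)] prems(4)])
      show "(\<lambda>s. \<eta> ((?D I x y)(i := s))) \<in> borel_measurable borel" by (rule measurable_compose[OF m[OF dxy] prems(5)])
      show "\<phi> (x(i := s)) = 0" "\<psi> (y(i := s)) = 0" "\<eta> ((?D I x y)(i := s)) = 0" if "\<bar>s\<bar> > R" for s
        by (rule prems(12)[of i] prems(13)[of i] prems(14)[of i], use that in simp, use that in simp)+
    qed (rule prems)+
    then show "(\<integral>\<^sup>+s. \<integral>\<^sup>+t. F (x(i := s)) (y(i := t)) \<partial>lborel \<partial>lborel)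
      \<le> ennreal (young_const \<kappa>) * ennreal (red \<phi> x powr \<kappa> * red \<psi> y powr \<kappa> * red \<eta> (?D I x y) powr (2 - 2*\<kappa>))"
      by (simp add: ennreal_mult''[symmetric] young_const_def mult_ac)
  qed
  also have "\<dots> = ennreal (young_const \<kappa>) * (\<integral>\<^sup>+x. \<integral>\<^sup>+y. ennreal (red \<phi> x powr \<kappa> * red \<psi> y powr \<kappa> * red \<eta> (?D I x y) powr (2 - 2*\<kappa>)) \<partial>?P \<partial>?P)"
  proof -
    note [measurable] = r\<phi>(1) r\<psi>(1) r\<eta>(1)
    show ?thesis by (simp add: nn_integral_cmult)
  qed
  also have "\<dots> \<le> ennreal (young_const \<kappa>) * ennreal (young_const \<kappa> ^ card I * integral\<^sup>L ?P (red \<phi>) powr \<kappa> *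
        integral\<^sup>L ?P (red \<psi>) powr \<kappa> * integral\<^sup>L ?P (red \<eta>) powr (2 - 2*\<kappa>))"
    using prems(1,2)
    by (intro mult_left_mono insert.IH[where M="2*R*M"] r\<phi> r\<psi> r\<eta>) auto
  also have "\<dots> = ennreal (young_const \<kappa> ^ card (insert i I) * integral\<^sup>L ?Q \<phi> powr \<kappa> *
        integral\<^sup>L ?Q \<psi> powr \<kappa> * integral\<^sup>L ?Q \<eta> powr (2 - 2*\<kappa>))"
    unfolding r\<phi>(5) r\<psi>(5) r\<eta>(5)
    using insert.hyps by (simp add: ennreal_mult''[symmetric] young_const_def mult_ac)
  finally show ?case unfolding F_def .
qed

lemma nn_integral_lborel_translate:
  fixes f :: "'a::euclidean_space \<Rightarrow> ennreal"
  assumes "f \<in> borel_measurable borel"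
  shows "(\<integral>\<^sup>+x. f (c + x) \<partial>lborel) = (\<integral>\<^sup>+x. f x \<partial>lborel)"
  using assms by (subst (2) lborel_distr_plus[of c, symmetric]) (simp add: nn_integral_distr)

lemma integral_lborel_translate:
  fixes f :: "'a::euclidean_space \<Rightarrow> 'b::{banach, second_countable_topology}"
  assumes [measurable]: "f \<in> borel_measurable borel"
  shows "(LINT x|lborel. f (c + x)) = integral\<^sup>L lborel f"
  by (subst (2) lborel_distr_plus[of c, symmetric], subst integral_distr) auto

lemma integrable_lborel_translate:
  fixes f :: "'a::euclidean_space \<Rightarrow> 'b::{banach, second_countable_topology}"
  assumes "integrable lborel f"
  shows "integrable lborel (\<lambda>x. f (c + x))"
proof -
  have "integrable (distr lborel borel ((+) c)) f" using assms by (simp add: lborel_distr_plus)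
  then show ?thesis using borel_measurable_integrable[OF assms] by (subst (asm) integrable_distr_eq) auto
qed

lemma young_trilinear_euclidean:
  fixes \<phi> \<psi> \<eta> :: "'a::euclidean_space \<Rightarrow> real"
  assumes \<kappa>: "1/2 < \<kappa>" "\<kappa> < 1"
    and meas: "\<phi> \<in> borel_measurable borel" "\<psi> \<in> borel_measurable borel" "\<eta> \<in> borel_measurable borel"
    and nonneg: "\<And>x. 0 \<le> \<phi> x" "\<And>x. 0 \<le> \<psi> x" "\<And>x. 0 \<le> \<eta> x"
    and bdd: "\<And>x. \<phi> x \<le> M" "\<And>x. \<psi> x \<le> M" "\<And>x. \<eta> x \<le> M"
    and supp: "\<And>x. norm x > R \<Longrightarrow> \<phi> x = 0" "\<And>x. norm x > R \<Longrightarrow> \<psi> x = 0" "\<And>x. norm x > R \<Longrightarrow> \<eta> x = 0"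
  shows "(\<integral>\<^sup>+a. \<integral>\<^sup>+b. ennreal (\<phi> a powr \<kappa> * \<psi> b powr \<kappa> * \<eta> (a - b) powr (2 - 2*\<kappa>)) \<partial>lborel \<partial>lborel)
    \<le> ennreal (young_const \<kappa> ^ DIM('a) * integral\<^sup>L lborel \<phi> powr \<kappa> * integral\<^sup>L lborel \<psi> powr \<kappa> *
        integral\<^sup>L lborel \<eta> powr (2 - 2*\<kappa>))"
proof -
  define s :: "('a \<Rightarrow> real) \<Rightarrow> 'a" where "s x = (\<Sum>b\<in>Basis. x b *\<^sub>R b)" for x
  let ?P = "PiM Basis (\<lambda>_::'a. lborel :: real measure)"
  have s [measurable]: "s \<in> measurable ?P borel" unfolding s_def[abs_def] by measurable
  have lb: "(lborel :: 'a measure) = distr ?P borel s" unfolding s_def[abs_def] by (rule lborel_eq)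
  have nn: "(\<integral>\<^sup>+x. f x \<partial>lborel) = (\<integral>\<^sup>+x. f (s x) \<partial>?P)" if "f \<in> borel_measurable borel" for f :: "'a \<Rightarrow> ennreal"
    using that unfolding lb by (subst nn_integral_distr) auto
  have int: "integral\<^sup>L lborel f = (LINT x|?P. f (s x))" if "f \<in> borel_measurable borel" for f :: "'a \<Rightarrow> real"
    using that unfolding lb by (subst integral_distr) auto
  note meas [measurable]
  have sb: "s x \<bullet> b = x b" if "b \<in> Basis" for x b
    using that by (simp add: s_def inner_sum_left inner_Basis sum.delta' if_distrib cong: if_cong)
  \<comment> \<open>The radius \<open>R\<close> may be negative, whereas
    \<open>young_trilinear_PiM\<close> asks for a nonnegative one; hence the absolute value.\<close>
  have big: "norm (s x) > \<bar>R\<bar>" if "b \<in> Basis" "\<bar>x b\<bar> > \<bar>R\<bar>" for x b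
    using Basis_le_norm[OF that(1), of "s x"] sb[OF that(1), of x] that by simp
  have sd: "s (\<lambda>i\<in>Basis. a i - b i) = s a - s b" for a b
    by (simp add: s_def sum_subtractf[symmetric] scaleR_left_diff_distrib)
  have M: "M \<ge> 0" using nonneg(1)[of 0] bdd(1)[of 0] by simp
  have "(\<integral>\<^sup>+a. \<integral>\<^sup>+b. ennreal (\<phi> a powr \<kappa> * \<psi> b powr \<kappa> * \<eta> (a - b) powr (2 - 2*\<kappa>)) \<partial>lborel \<partial>lborel)
    = (\<integral>\<^sup>+a. \<integral>\<^sup>+b. ennreal (\<phi> (s a) powr \<kappa> * \<psi> (s b) powr \<kappa> * \<eta> (s a - s b) powr (2 - 2*\<kappa>)) \<partial>?P \<partial>?P)"
    by (subst nn, measurable, intro nn_integral_cong, subst nn) measurable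
  also have "\<dots> = (\<integral>\<^sup>+a. \<integral>\<^sup>+b. ennreal (\<phi> (s a) powr \<kappa> * \<psi> (s b) powr \<kappa> * \<eta> (s (\<lambda>i\<in>Basis. a i - b i)) powr (2 - 2*\<kappa>)) \<partial>?P \<partial>?P)"
    by (simp only: sd)
  also have "\<dots> \<le> ennreal (young_const \<kappa> ^ DIM('a) * (LINT x|?P. \<phi> (s x)) powr \<kappa> * (LINT x|?P. \<psi> (s x)) powr \<kappa> *
        (LINT x|?P. \<eta> (s x)) powr (2 - 2*\<kappa>))"
  proof (rule young_trilinear_PiM[OF \<kappa>, of Basis M "\<bar>R\<bar>"])
    show "\<phi> (s x) = 0" "\<psi> (s x) = 0" "\<eta> (s x) = 0" if "i \<in> Basis" "\<bar>x i\<bar> > \<bar>R\<bar>" for x i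
      using big[of i x] that by (intro supp; simp)+
  qed (use nonneg bdd M in auto)
  finally show ?thesis by (simp only: int[OF meas(1)] int[OF meas(2)] int[OF meas(3)])
qed

text \<open>Duality tested on one extremal function. With S the integral on the left and C the
  constant, the trilinear inequality gives S <= C S^(2 - 2\<kappa>). Boundedness and bounded support
  make S finite, so the power of S can be divided out.\<close>

lemma young_convolution:
  fixes \<phi> \<psi> :: "'a::euclidean_space \<Rightarrow> real"
  assumes \<kappa>: "1/2 < \<kappa>" "\<kappa> < 1"
    and meas: "\<phi> \<in> borel_measurable borel" "\<psi> \<in> borel_measurable borel"
    and nonneg: "\<And>x. 0 \<le> \<phi> x" "\<And>x. 0 \<le> \<psi> x"
    and bdd: "\<And>x. \<phi> x \<le> M" "\<And>x. \<psi> x \<le> M"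
    and supp: "\<And>x. norm x > R \<Longrightarrow> \<phi> x = 0" "\<And>x. norm x > R \<Longrightarrow> \<psi> x = 0"
  defines "P \<equiv> \<lambda>x. LINT t|lborel. (\<phi> (t + x) * \<psi> t) powr \<kappa>"
  shows "(\<integral>\<^sup>+x. ennreal (P x powr (1 / (2*\<kappa> - 1))) \<partial>lborel)
    \<le> ennreal ((young_const \<kappa> ^ DIM('a) * (integral\<^sup>L lborel \<phi> * integral\<^sup>L lborel \<psi>) powr \<kappa>) powr (1 / (2*\<kappa> - 1)))"
proof -
  define r where "r = 1 / (2*\<kappa> - 1)"
  have r: "r > 0" "r * (2 - 2*\<kappa>) + 1 = r" "r * (2*\<kappa> - 1) = 1" using \<kappa> by (auto simp: r_def field_simps)
  note meas [measurable]
  have M: "M \<ge> 0" using nonneg(1)[of 0] bdd(1)[of 0] by simp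
  let ?h = "\<lambda>x t. (\<phi> (t + x) * \<psi> t) powr \<kappa>"
  have h0: "0 \<le> ?h x t" for x t by simp
  have hM: "?h x t \<le> (M * M) powr \<kappa>" for x t
    using \<kappa> M nonneg bdd by (intro powr_mono2 mult_mono) auto
  have hs: "?h x t = 0" if "norm t > R" for x t using supp(2)[OF that] by simp
  have hi: "integrable lborel (?h x)" for x
    by (rule integrable_bounded_support[of _ "(M * M) powr \<kappa>" R]) (use hM hs in auto)
  have Pnn: "(\<integral>\<^sup>+t. ennreal (?h x t) \<partial>lborel) = ennreal (P x)" for x
    unfolding P_def by (intro nn_integral_eq_integral hi) auto
  have P0: "0 \<le> P x" for x unfolding P_def by (intro integral_nonneg_AE) auto
  have [measurable]: "P \<in> borel_measurable borel"
    unfolding P_def by (intro lborel.borel_measurable_lebesgue_integral) measurable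
  define B where "B = (M * M) powr \<kappa> * measure lborel (cball 0 R :: 'a set)"
  have PB: "P x \<le> B" for x
  proof -
    have "P x \<le> (LINT t|lborel. (M * M) powr \<kappa> * indicator (cball (0::'a) R) t)" unfolding P_def
    proof (rule integral_mono)
      show "integrable lborel (\<lambda>t::'a. (M * M) powr \<kappa> * indicator (cball 0 R) t)"
        using emeasure_lborel_cball_finite[of "0::'a" R] by (intro integrable_mult_right) (auto simp: integrable_indicator_iff)
      show "?h x t \<le> (M * M) powr \<kappa> * indicator (cball 0 R) t" for t
        using hM[of t x] hs[of t x] by (auto simp: indicator_def)
    qed (rule hi)
    then show ?thesis by (simp add: B_def)
  qed
  have Ps: "P x = 0" if "norm x > 2 * R" for x
  proof -
    have "?h x t = 0" for t
    proof (cases "norm t > R")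
      case False
      have "norm x \<le> norm (t + x) + norm t" by (metis add_diff_cancel_left' norm_triangle_ineq4)
      then have "norm (t + x) > R" using that False by linarith
      then show ?thesis using supp(1) by simp
    qed (rule hs)
    then show ?thesis unfolding P_def by (intro integral_eq_zero_AE AE_I2)
  qed
  \<comment> \<open>the extremal third function: \<open>P \<eta> powr (2 - 2\<kappa>) = \<eta>\<close>\<close>
  define \<eta> where "\<eta> x = P x powr r" for x
  have [measurable]: "\<eta> \<in> borel_measurable borel" unfolding \<eta>_def by measurable
  have \<eta>B: "\<eta> x \<le> B powr r" for x unfolding \<eta>_def using P0 PB r by (intro powr_mono2) auto
  have \<eta>s: "\<eta> x = 0" if "norm x > 2 * R" for x using Ps[OF that] r by (simp add: \<eta>_def)
  have \<eta>i: "integrable lborel \<eta>"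
    by (rule integrable_bounded_support[of _ "B powr r" "2*R"]) (use \<eta>B \<eta>s in \<open>auto simp: \<eta>_def\<close>)
  define S where "S = integral\<^sup>L lborel \<eta>"
  have S0: "S \<ge> 0" unfolding S_def \<eta>_def by (intro integral_nonneg_AE) auto
  have Snn: "(\<integral>\<^sup>+x. ennreal (\<eta> x) \<partial>lborel) = ennreal S"
    unfolding S_def by (intro nn_integral_eq_integral \<eta>i) (auto simp: \<eta>_def)
  define C where "C = young_const \<kappa> ^ DIM('a) * (integral\<^sup>L lborel \<phi> * integral\<^sup>L lborel \<psi>) powr \<kappa>"
  have C0: "C \<ge> 0" by (simp add: C_def young_const_def)
  have "ennreal S = (\<integral>\<^sup>+x. \<integral>\<^sup>+t. ennreal (?h x t * \<eta> x powr (2 - 2*\<kappa>)) \<partial>lborel \<partial>lborel)"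
  proof -
    have "ennreal (\<eta> x) = (\<integral>\<^sup>+t. ennreal (?h x t * \<eta> x powr (2 - 2*\<kappa>)) \<partial>lborel)" for x
    proof -
      have "\<eta> x = P x * \<eta> x powr (2 - 2*\<kappa>)"
      proof (cases "P x = 0")
        case False
        then have "P x powr r = P x powr (1 + r * (2 - 2*\<kappa>))" using r(2) by (simp add: add.commute)
        also have "\<dots> = P x * P x powr (r * (2 - 2*\<kappa>))"
          using False P0[of x] by (simp only: powr_add powr_one_gt_zero_iff) simp
        finally show ?thesis unfolding \<eta>_def powr_powr .
      qed (use r in \<open>simp add: \<eta>_def\<close>)
      then have "ennreal (\<eta> x) = (\<integral>\<^sup>+t. ennreal (?h x t) \<partial>lborel) * ennreal (\<eta> x powr (2 - 2*\<kappa>))"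
        by (simp add: Pnn ennreal_mult''[symmetric])
      then show ?thesis by (simp add: nn_integral_multc[symmetric] ennreal_mult''[symmetric])
    qed
    then show ?thesis by (simp add: Snn[symmetric])
  qed
  also have "\<dots> = (\<integral>\<^sup>+t. \<integral>\<^sup>+x. ennreal (?h x t * \<eta> x powr (2 - 2*\<kappa>)) \<partial>lborel \<partial>lborel)"
    by (rule lborel_pair.Fubini'[symmetric]) measurable
  also have "\<dots> = (\<integral>\<^sup>+t. \<integral>\<^sup>+a. ennreal (\<phi> a powr \<kappa> * \<psi> t powr \<kappa> * \<eta> (a - t) powr (2 - 2*\<kappa>)) \<partial>lborel \<partial>lborel)"
  proof (rule nn_integral_cong)
    fix t :: 'a
    have "(\<integral>\<^sup>+a. ennreal (\<phi> a powr \<kappa> * \<psi> t powr \<kappa> * \<eta> (a - t) powr (2 - 2*\<kappa>)) \<partial>lborel)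
       = (\<integral>\<^sup>+x. ennreal (\<phi> (t + x) powr \<kappa> * \<psi> t powr \<kappa> * \<eta> (t + x - t) powr (2 - 2*\<kappa>)) \<partial>lborel)"
      by (rule nn_integral_lborel_translate[symmetric]) measurable
    then show "(\<integral>\<^sup>+x. ennreal (?h x t * \<eta> x powr (2 - 2*\<kappa>)) \<partial>lborel)
       = (\<integral>\<^sup>+a. ennreal (\<phi> a powr \<kappa> * \<psi> t powr \<kappa> * \<eta> (a - t) powr (2 - 2*\<kappa>)) \<partial>lborel)"
      using nonneg by (simp add: powr_mult)
  qed
  also have "\<dots> = (\<integral>\<^sup>+a. \<integral>\<^sup>+t. ennreal (\<phi> a powr \<kappa> * \<psi> t powr \<kappa> * \<eta> (a - t) powr (2 - 2*\<kappa>)) \<partial>lborel \<partial>lborel)"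
    by (rule lborel_pair.Fubini') measurable
  also have "\<dots> \<le> ennreal (young_const \<kappa> ^ DIM('a) * integral\<^sup>L lborel \<phi> powr \<kappa> * integral\<^sup>L lborel \<psi> powr \<kappa> *
        integral\<^sup>L lborel \<eta> powr (2 - 2*\<kappa>))"
  proof (rule young_trilinear_euclidean[OF \<kappa>, where M="max M (B powr r)" and R="max R (2*R)"])
    show "\<phi> x \<le> max M (B powr r)" "\<psi> x \<le> max M (B powr r)" "\<eta> x \<le> max M (B powr r)" for x
      using bdd[of x] \<eta>B[of x] by auto
    show "\<phi> x = 0" "\<psi> x = 0" "\<eta> x = 0" if "norm x > max R (2*R)" for x
      using that supp[of x] \<eta>s[of x] by auto
  qed (use nonneg in \<open>auto simp: \<eta>_def\<close>)
  also have "\<dots> = ennreal (C * S powr (2 - 2*\<kappa>))"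
    using nonneg by (simp add: C_def S_def powr_mult mult_ac)
  finally have le: "S \<le> C * S powr (2 - 2*\<kappa>)" using C0 by (simp add: ennreal_le_iff)
  have "S \<le> C powr r"
  proof (cases "S = 0")
    case False
    then have "S > 0" using S0 by simp
    then have "S powr (2*\<kappa> - 1) * S powr (2 - 2*\<kappa>) \<le> C * S powr (2 - 2*\<kappa>)"
      using le by (simp flip: powr_add)
    then have "S powr (2*\<kappa> - 1) \<le> C" using \<open>S > 0\<close> by simp
    then have "(S powr (2*\<kappa> - 1)) powr r \<le> C powr r" using r by (intro powr_mono2) auto
    then show ?thesis using \<open>S > 0\<close> r by (simp add: powr_powr mult.commute)
  qed simp
  then show ?thesis using Snn by (simp add: \<eta>_def[abs_def] C_def r_def ennreal_leI)
qed

section \<open>Plancherel theorem for the quaternion Fourier transform\<close>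

definition truncation :: "nat \<Rightarrow> ('a::real_normed_vector \<Rightarrow> 'b::real_normed_vector) \<Rightarrow> 'a \<Rightarrow> 'b" where
  "truncation k f t = (if norm t \<le> real k \<and> norm (f t) \<le> real k then f t else 0)"

lemma norm_truncation_le: "norm (truncation k f t) \<le> norm (f t)" "norm (truncation k f t) \<le> real k"
  by (auto simp: truncation_def)

lemma truncation_outside: "norm t > real k \<Longrightarrow> truncation k f t = 0"
  by (simp add: truncation_def)

lemma eventually_truncation: "\<forall>\<^sub>F k in sequentially. truncation k f t = f t"
proof -
  obtain N where N: "norm t \<le> real N" "norm (f t) \<le> real N"
    using real_arch_simple[of "max (norm t) (norm (f t))"] by auto
  show ?thesis using eventually_ge_at_top[of N]
    by eventually_elim (use N in \<open>auto simp: truncation_def\<close>)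
qed

lemma measurable_truncation [measurable]:
  fixes f :: "'a::euclidean_space \<Rightarrow> 'b::euclidean_space"
  assumes [measurable]: "f \<in> borel_measurable borel"
  shows "truncation k f \<in> borel_measurable borel"
  unfolding truncation_def[abs_def] by measurable

text \<open>Truncation, then continuous approximation of the truncated function: each errs by less
  than e/4 in squared norm, and the factor 2 in (a + b)^2 <= 2 a^2 + 2 b^2 brings the total below
  e.\<close>

lemma L2_continuous_approx:
  fixes h :: "'a::euclidean_space \<Rightarrow> 'b::euclidean_space"
  assumes h: "h \<in> borel_measurable borel" "integrable lborel (\<lambda>x. (norm (h x))\<^sup>2)" and e: "e > 0"
  shows "\<exists>c M R. continuous_on UNIV c \<and> (\<forall>x. norm (c x) \<le> M) \<and> (\<forall>x. norm x \<ge> R \<longrightarrow> c x = 0) \<and>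
     integrable lborel (\<lambda>x. (norm (h x - c x))\<^sup>2) \<and> (LINT x|lborel. (norm (h x - c x))\<^sup>2) < e"
proof -
  note h(1) [measurable]
  define T where "T m = truncation m h" for m
  have T_meas [measurable]: "T m \<in> borel_measurable borel" for m unfolding T_def by measurable
  have "(\<lambda>m. LINT x|lborel. (norm (h x - T m x))\<^sup>2) \<longlonglongrightarrow> (LINT x|(lborel :: 'a measure). (0::real))"
  proof (rule integral_dominated_convergence[where w="\<lambda>x. (norm (h x))\<^sup>2"])
    show "AE x in lborel. (\<lambda>m. (norm (h x - T m x))\<^sup>2) \<longlonglongrightarrow> 0"
    proof (rule AE_I2, rule tendsto_eventually)
      show "\<forall>\<^sub>F m in sequentially. (norm (h x - T m x))\<^sup>2 = 0" for x
        using eventually_truncation[of h x] by eventually_elim (simp add: T_def)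
    qed
    show "AE x in lborel. norm ((norm (h x - T m x))\<^sup>2) \<le> (norm (h x))\<^sup>2" for m
      by (auto simp: T_def truncation_def)
  qed (use h(2) in auto)
  then have "(\<lambda>m. LINT x|lborel. (norm (h x - T m x))\<^sup>2) \<longlonglongrightarrow> 0" by simp
  then have "\<forall>\<^sub>F m in sequentially. (LINT x|lborel. (norm (h x - T m x))\<^sup>2) < e / 4"
    using e by (intro order_tendstoD) auto
  then obtain m where m: "(LINT x|lborel. (norm (h x - T m x))\<^sup>2) < e / 4"
    by (auto simp: eventually_sequentially)
  have i1: "integrable lborel (\<lambda>x. (norm (h x - T m x))\<^sup>2)"
    by (rule Bochner_Integration.integrable_bound[OF h(2)]) (auto simp: T_def truncation_def)
  have Tb: "norm (T m x) \<le> real m" for x by (auto simp: T_def truncation_def)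
  have Ts: "T m x = 0" if "norm x > real m" for x using that by (auto simp: T_def truncation_def)
  obtain g where gc: "\<And>n. continuous_on UNIV (g n)" and gb: "\<And>n x. norm (g n x) \<le> real m"
    and gs: "\<And>n x. norm x \<ge> real m + 1 \<Longrightarrow> g n x = 0" and gl: "AE x in lborel. (\<lambda>n. g n x) \<longlonglongrightarrow> T m x"
    using bounded_support_continuous_approx[of "T m" "real m" "real m", OF T_meas Tb Ts] by auto
  have [measurable]: "g n \<in> borel_measurable borel" for n
    using gc by (rule borel_measurable_continuous_onI)
  have db: "norm ((norm (T m x - g n x))\<^sup>2) \<le> (real m + real m)\<^sup>2" for n x
  proof -
    have "norm (T m x - g n x) \<le> real m + real m"
      using norm_triangle_ineq4[of "T m x" "g n x"] Tb[of x] gb[of n x] by linarith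
    from power_mono[OF this norm_ge_zero, of 2] show ?thesis by simp
  qed
  have ds: "(norm (T m x - g n x))\<^sup>2 = 0" if "norm x \<ge> real m + 1" for n x
    using gs[OF that, of n] Ts[of x] that by auto
  have i2: "integrable lborel (\<lambda>x. (norm (T m x - g n x))\<^sup>2)" for n
    by (rule integrable_bounded_support[of _ "(real m + real m)\<^sup>2" "real m + 1"]) (use db ds in auto)
  have "(\<lambda>n. LINT x|lborel. (norm (T m x - g n x))\<^sup>2) \<longlonglongrightarrow> (LINT x|(lborel :: 'a measure). (0::real))"
  proof (rule integral_bounded_support_approx[OF _ _ db ds])
    show "AE x in lborel. (\<lambda>n. (norm (T m x - g n x))\<^sup>2) \<longlonglongrightarrow> 0"
      using gl by eventually_elim (auto intro!: tendsto_eq_intros)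
  qed auto
  then have "(\<lambda>n. LINT x|lborel. (norm (T m x - g n x))\<^sup>2) \<longlonglongrightarrow> 0" by simp
  then have "\<forall>\<^sub>F n in sequentially. (LINT x|lborel. (norm (T m x - g n x))\<^sup>2) < e / 4"
    using e by (intro order_tendstoD) auto
  then obtain n where n: "(LINT x|lborel. (norm (T m x - g n x))\<^sup>2) < e / 4"
    by (auto simp: eventually_sequentially)
  have par: "(norm (h x - g n x))\<^sup>2 \<le> 2 * (norm (h x - T m x))\<^sup>2 + 2 * (norm (T m x - g n x))\<^sup>2" for x
  proof -
    have "(norm (h x - g n x))\<^sup>2 \<le> (norm (h x - T m x) + norm (T m x - g n x))\<^sup>2"
      using norm_triangle_ineq[of "h x - T m x" "T m x - g n x"] by (intro power_mono) auto
    also have "\<dots> \<le> 2 * (norm (h x - T m x))\<^sup>2 + 2 * (norm (T m x - g n x))\<^sup>2" using sum_squares_bound[of "norm (h x - T m x)" "norm (T m x - g n x)"] by (simp add: power2_sum)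
    finally show ?thesis .
  qed
  have i3: "integrable lborel (\<lambda>x. 2 * (norm (h x - T m x))\<^sup>2 + 2 * (norm (T m x - g n x))\<^sup>2)"
    by (intro Bochner_Integration.integrable_add integrable_mult_right i1 i2)
  have i4: "integrable lborel (\<lambda>x. (norm (h x - g n x))\<^sup>2)"
    by (rule Bochner_Integration.integrable_bound[OF i3]) (use par in auto)
  have "(LINT x|lborel. (norm (h x - g n x))\<^sup>2) \<le> (LINT x|lborel. 2 * (norm (h x - T m x))\<^sup>2 + 2 * (norm (T m x - g n x))\<^sup>2)"
    by (rule integral_mono[OF i4 i3 par])
  also have "\<dots> < e" using m n i1 i2 by simp
  finally show ?thesis using gc gb gs i4 by blast
qed

lemma L2_translation_continuous:
  fixes h :: "'a::euclidean_space \<Rightarrow> 'b::euclidean_space"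
  assumes h: "h \<in> borel_measurable borel" "integrable lborel (\<lambda>x. (norm (h x))\<^sup>2)" and y: "y \<longlonglongrightarrow> 0"
  shows "(\<lambda>n. LINT x|lborel. (norm (h (y n + x) - h x))\<^sup>2) \<longlonglongrightarrow> 0"
proof (rule LIMSEQ_I)
  fix e :: real assume e: "e > 0"
  \<comment> \<open>A sum of three terms costs a factor 3 when squared, and 3 (e/12 + e/6 + e/12) =
    e. The first and last errors agree by translation invariance.\<close>
  obtain c M R where c: "continuous_on UNIV c" "\<And>x. norm (c x) \<le> M" "\<And>x. norm x \<ge> R \<Longrightarrow> c x = 0"
    and hc: "integrable lborel (\<lambda>x. (norm (h x - c x))\<^sup>2)" "(LINT x|lborel. (norm (h x - c x))\<^sup>2) < e / 12"
    using L2_continuous_approx[OF h, of "e/12"] e by auto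
  note h(1) [measurable]
  have cm [measurable]: "c \<in> borel_measurable borel" using c(1) by (rule borel_measurable_continuous_onI)
  have "Bseq y" using y by (intro convergent_imp_Bseq convergentI)
  then obtain B where B: "\<And>n. norm (y n) \<le> B" by (auto simp: Bseq_def)
  have db: "norm ((norm (c (y n + x) - c x))\<^sup>2) \<le> (M + M)\<^sup>2" for n x
  proof -
    have "norm (c (y n + x) - c x) \<le> M + M"
      using norm_triangle_ineq4[of "c (y n + x)" "c x"] c(2)[of x] c(2)[of "y n + x"] by linarith
    from power_mono[OF this norm_ge_zero, of 2] show ?thesis by simp
  qed
  \<comment> \<open>Beyond radius |R| + B both x and \<open>y n + x\<close> lie where
    \<open>c\<close> vanishes, uniformly in n.\<close>
  have ds: "(norm (c (y n + x) - c x))\<^sup>2 = 0" if "norm x \<ge> \<bar>R\<bar> + B" for n x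
  proof -
    have "norm x \<le> norm (y n + x) + norm (y n)" by (metis add_diff_cancel_left' norm_triangle_ineq4)
    moreover have "B \<ge> 0" using B[of 0] norm_ge_zero order_trans by blast
    ultimately have "norm (y n + x) \<ge> R" "norm x \<ge> R" using B[of n] that by linarith+
    then show ?thesis using c(3) by simp
  qed
  have ci: "integrable lborel (\<lambda>x. (norm (c (y n + x) - c x))\<^sup>2)" for n
    by (rule integrable_bounded_support[of _ "(M + M)\<^sup>2" "\<bar>R\<bar> + B"]) (use db ds in auto)
  have "(\<lambda>n. LINT x|lborel. (norm (c (y n + x) - c x))\<^sup>2) \<longlonglongrightarrow> (LINT x|(lborel :: 'a measure). (0::real))"
  proof (rule integral_bounded_support_approx[OF _ _ db ds])
    show "AE x in lborel. (\<lambda>n. (norm (c (y n + x) - c x))\<^sup>2) \<longlonglongrightarrow> 0"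
    proof (rule AE_I2)
      fix x
      have "(\<lambda>n. y n + x) \<longlonglongrightarrow> 0 + x" by (intro tendsto_intros y)
      then have "(\<lambda>n. c (y n + x)) \<longlonglongrightarrow> c x"
        using continuous_on_tendsto_compose[OF c(1), of "\<lambda>n. y n + x" x] by simp
      then show "(\<lambda>n. (norm (c (y n + x) - c x))\<^sup>2) \<longlonglongrightarrow> 0" by (auto intro!: tendsto_eq_intros)
    qed
  qed auto
  then have "(\<lambda>n. LINT x|lborel. (norm (c (y n + x) - c x))\<^sup>2) \<longlonglongrightarrow> 0" by simp
  then have "\<forall>\<^sub>F n in sequentially. (LINT x|lborel. (norm (c (y n + x) - c x))\<^sup>2) < e / 6"
    using e by (intro order_tendstoD) auto
  then obtain N where N: "\<And>n. n \<ge> N \<Longrightarrow> (LINT x|lborel. (norm (c (y n + x) - c x))\<^sup>2) < e / 6"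
    by (auto simp: eventually_sequentially)
  have shift: "integrable lborel (\<lambda>x. (norm (h (z + x) - c (z + x)))\<^sup>2)"
     "(LINT x|lborel. (norm (h (z + x) - c (z + x)))\<^sup>2) = (LINT x|lborel. (norm (h x - c x))\<^sup>2)" for z
    by (rule integrable_lborel_translate[OF hc(1)], rule integral_lborel_translate) measurable
  have "norm ((LINT x|lborel. (norm (h (y n + x) - h x))\<^sup>2) - 0) < e" if n: "n \<ge> N" for n
  proof -
    let ?b = "\<lambda>x. 3 * (norm (h (y n + x) - c (y n + x)))\<^sup>2 + 3 * (norm (c (y n + x) - c x))\<^sup>2 + 3 * (norm (h x - c x))\<^sup>2"
    have par: "(norm (h (y n + x) - h x))\<^sup>2 \<le> ?b x" for x
    proof -
      let ?p = "h (y n + x) - c (y n + x)" and ?q = "c (y n + x) - c x" and ?r = "h x - c x"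
      have "norm (h (y n + x) - h x) = norm (?p + ?q - ?r)" by (simp add: algebra_simps)
      also have "\<dots> \<le> norm ?p + norm ?q + norm ?r"
        using norm_triangle_ineq4[of "?p + ?q" ?r] norm_triangle_ineq[of ?p ?q] by linarith
      finally have "(norm (h (y n + x) - h x))\<^sup>2 \<le> (norm ?p + norm ?q + norm ?r)\<^sup>2" by (intro power_mono) auto
      also have "\<dots> \<le> ?b x"
        using sum_squares_bound[of "norm ?p" "norm ?q"] sum_squares_bound[of "norm ?p" "norm ?r"]
          sum_squares_bound[of "norm ?q" "norm ?r"]
        by (simp add: power2_eq_square algebra_simps)
      finally show ?thesis .
    qed
    have bi: "integrable lborel ?b"
      by (intro Bochner_Integration.integrable_add integrable_mult_right shift ci hc(1))
    have "(LINT x|lborel. (norm (h (y n + x) - h x))\<^sup>2) \<le> integral\<^sup>L lborel ?b"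
      by (rule integral_mono[OF Bochner_Integration.integrable_bound[OF bi] bi par]) (use par in auto)
    also have "\<dots> = 3 * (LINT x|lborel. (norm (h (y n + x) - c (y n + x)))\<^sup>2) +
       3 * (LINT x|lborel. (norm (c (y n + x) - c x))\<^sup>2) + 3 * (LINT x|lborel. (norm (h x - c x))\<^sup>2)"
      by (simp add: shift ci hc(1))
    also have "\<dots> < e" using N[OF n] hc(2) shift(2)[of "y n"] by linarith
    finally show ?thesis by simp
  qed
  then show "\<exists>N. \<forall>n\<ge>N. norm ((LINT x|lborel. (norm (h (y n + x) - h x))\<^sup>2) - 0) < e" by blast
qed

section \<open>Gaussian integrals and the two-sided quaternion kernel\<close>

lemma exp_scaleR_imaginary_unit:
  fixes u :: "'a::{real_normed_algebra_1, banach}"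
  assumes u: "u * u = -1"
  shows "exp (\<theta> *\<^sub>R u) = cos \<theta> *\<^sub>R 1 + sin \<theta> *\<^sub>R u"
proof -
  have even: "u ^ (2 * m) = (-1) ^ m *\<^sub>R 1" for m
    by (induction m) (simp_all add: u mult.assoc[symmetric])
  \<comment> \<open>The cosine coefficients live on even and the sine coefficients on odd indices,
    so the two series interleave into the exponential series.\<close>
  have term_eq: "(cos_coeff n *\<^sub>R \<theta> ^ n) *\<^sub>R 1 + (sin_coeff n *\<^sub>R \<theta> ^ n) *\<^sub>R u = (\<theta> *\<^sub>R u) ^ n /\<^sub>R fact n" for n
  proof (cases "even n")
    case True
    then obtain m where m: "n = 2 * m" by auto
    show ?thesis using even[of m] by (simp add: m cos_coeff_def sin_coeff_def scaleR_power field_simps)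
  next
    case False
    then obtain m where m: "n = Suc (2 * m)" by (auto elim: oddE)
    have "u ^ n = (-1) ^ m *\<^sub>R u" using even[of m] by (simp add: m power_commutes[symmetric] del: power_mult)
    then show ?thesis by (simp add: m cos_coeff_def sin_coeff_def scaleR_power field_simps del: power_Suc)
  qed
  have "(\<lambda>n. (cos_coeff n *\<^sub>R \<theta> ^ n) *\<^sub>R (1::'a) + (sin_coeff n *\<^sub>R \<theta> ^ n) *\<^sub>R u) sums (cos \<theta> *\<^sub>R 1 + sin \<theta> *\<^sub>R u)"
    by (intro sums_add sums_scaleR_left cos_converges sin_converges)
  then show ?thesis
    using exp_converges[of "\<theta> *\<^sub>R u"] unfolding term_eq by (metis sums_unique)
qed

text \<open>The characteristic function of the standard normal law after the substitution x ->
  sqrt(\<delta>) x.\<close>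

lemma gaussian_fourier_real:
  fixes s \<delta> :: real
  assumes \<delta>: "\<delta> > 0"
  shows "integrable lborel (\<lambda>x. exp (\<i> * of_real (s * x)) * of_real (exp (- \<delta> * x\<^sup>2 / 2)))"
    and "(LINT x|lborel. exp (\<i> * of_real (s * x)) * of_real (exp (- \<delta> * x\<^sup>2 / 2)))
      = of_real (sqrt (2 * pi / \<delta>) * exp (- s\<^sup>2 / (2 * \<delta>)))"
proof -
  define c where "c = sqrt \<delta>"
  have c: "c > 0" "c\<^sup>2 = \<delta>" using \<delta> by (auto simp: c_def)
  define f where "f x = std_normal_density x *\<^sub>R exp (\<i> * of_real (s / c * x))" for x
  have fi: "integrable lborel f"
  proof (rule Bochner_Integration.integrable_bound)
    show "integrable lborel std_normal_density" using integrable_normal_density[of 1 0] by simp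
    show "f \<in> borel_measurable lborel" unfolding f_def[abs_def] by measurable
    show "AE x in lborel. norm (f x) \<le> norm (std_normal_density x)" by (auto simp: f_def)
  qed
  have "of_real (exp (- ((s/c)\<^sup>2) / 2)) = char std_normal_distribution (s / c)"
    by (simp add: char_std_normal_distribution)
  also have "\<dots> = (LINT x|lborel. f x)"
    unfolding char_def f_def by (subst integral_density) (auto simp: normal_density_nonneg)
  finally have I: "(LINT x|lborel. f x) = of_real (exp (- ((s/c)\<^sup>2) / 2))" by simp
  have eq: "exp (\<i> * of_real (s * x)) * of_real (exp (- \<delta> * x\<^sup>2 / 2)) = sqrt (2 * pi) *\<^sub>R f (0 + c * x)" for x
  proof -
    have "(c * x)\<^sup>2 = \<delta> * x\<^sup>2" by (simp add: power_mult_distrib c)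
    then show ?thesis using c by (simp add: f_def normal_density_def scaleR_conv_of_real)
  qed
  show "integrable lborel (\<lambda>x. exp (\<i> * of_real (s * x)) * of_real (exp (- \<delta> * x\<^sup>2 / 2)))"
    unfolding eq using lborel_integrable_real_affine[OF fi, of c 0] c by (intro integrable_scaleR_right) auto
  have "(LINT x|lborel. f x) = \<bar>c\<bar> *\<^sub>R (LINT x|lborel. f (0 + c * x))"
    using c by (intro lborel_integral_real_affine) auto
  then have "(LINT x|lborel. f (0 + c * x)) = (1 / c) *\<^sub>R of_real (exp (- ((s/c)\<^sup>2) / 2))"
    using c unfolding I by (simp add: scaleR_conv_of_real)
  then show "(LINT x|lborel. exp (\<i> * of_real (s * x)) * of_real (exp (- \<delta> * x\<^sup>2 / 2)))
      = of_real (sqrt (2 * pi / \<delta>) * exp (- s\<^sup>2 / (2 * \<delta>)))"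
    unfolding eq integral_scaleR_right
    using c by (simp add: scaleR_conv_of_real power_divide real_sqrt_divide c_def[symmetric] mult.commute)
qed

text \<open>Unlike cosine and sine, the complex exponential factors over the coordinates, which
  reduces everything to the line. The resulting value is real, hence the zero in the sine
  integral.\<close>

lemma gaussian_fourier:
  fixes s :: "'a::euclidean_space" and \<delta> :: real
  assumes \<delta>: "\<delta> > 0"
  shows "integrable lborel (\<lambda>w::'a. exp (- \<delta> * (norm w)\<^sup>2 / 2))"
    and "(LINT w|lborel. cos (s \<bullet> w) * exp (- \<delta> * (norm w)\<^sup>2 / 2))
      = sqrt (2 * pi / \<delta>) ^ DIM('a) * exp (- (norm s)\<^sup>2 / (2 * \<delta>))"
    and "(LINT w|lborel. sin (s \<bullet> w) * exp (- \<delta> * (norm w)\<^sup>2 / 2)) = 0"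
proof -
  interpret product_sigma_finite "\<lambda>_::'a. lborel :: real measure" ..
  let ?P = "PiM Basis (\<lambda>_::'a. lborel :: real measure)"
  define t :: "('a \<Rightarrow> real) \<Rightarrow> 'a" where "t x = (\<Sum>b\<in>Basis. x b *\<^sub>R b)" for x
  have t [measurable]: "t \<in> measurable ?P borel" unfolding t_def[abs_def] by measurable
  have lb: "(lborel :: 'a measure) = distr ?P borel t" unfolding t_def[abs_def] by (rule lborel_eq)
  have tb: "t x \<bullet> b = x b" if "b \<in> Basis" for x b
    using that by (simp add: t_def inner_sum_left inner_Basis sum.delta' if_distrib cong: if_cong)
  define g where "g s w = exp (\<i> * of_real (s \<bullet> w)) * of_real (exp (- \<delta> * (norm w)\<^sup>2 / 2))" for s w :: 'a
  have gt: "g s (t x) = (\<Prod>b\<in>Basis. exp (\<i> * of_real ((s \<bullet> b) * x b)) * of_real (exp (- \<delta> * (x b)\<^sup>2 / 2)))" for s x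
  proof -
    have i: "s \<bullet> t x = (\<Sum>b\<in>Basis. (s \<bullet> b) * x b)"
      by (subst euclidean_inner) (simp add: tb)
    have n: "(norm (t x))\<^sup>2 = (\<Sum>b\<in>Basis. (x b)\<^sup>2)"
      unfolding power2_norm_eq_inner by (subst euclidean_inner) (simp add: tb power2_eq_square)
    have "g s (t x) = exp (\<Sum>b\<in>Basis. \<i> * of_real ((s \<bullet> b) * x b)) * of_real (exp (\<Sum>b\<in>Basis. - \<delta> * (x b)\<^sup>2 / 2))"
      by (simp add: g_def i n sum_distrib_left sum_negf sum_divide_distrib)
    then show ?thesis by (simp add: exp_sum prod.distrib)
  qed
  have gm: "g s \<in> borel_measurable borel" for s unfolding g_def[abs_def] by measurable
  have gi: "integrable lborel (g s)" for s
  proof -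
    have "integrable ?P (\<lambda>x. \<Prod>b\<in>Basis. exp (\<i> * of_real ((s \<bullet> b) * x b)) * of_real (exp (- \<delta> * (x b)\<^sup>2 / 2)))"
      by (intro product_integrable_prod gaussian_fourier_real(1)[OF \<delta>]) simp
    then have "integrable ?P (\<lambda>x. g s (t x))" by (simp only: gt)
    then show ?thesis unfolding lb using gm by (subst integrable_distr_eq) auto
  qed
  have gI: "integral\<^sup>L lborel (g s) = of_real (sqrt (2 * pi / \<delta>) ^ DIM('a) * exp (- (norm s)\<^sup>2 / (2 * \<delta>)))" for s
  proof -
    have "integral\<^sup>L lborel (g s) = (LINT x|?P. g s (t x))"
      unfolding lb using gm by (subst integral_distr) auto
    also have "\<dots> = (\<Prod>b\<in>Basis. of_real (sqrt (2 * pi / \<delta>) * exp (- (s \<bullet> b)\<^sup>2 / (2 * \<delta>))))"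
      unfolding gt using gaussian_fourier_real[OF \<delta>] by (subst product_integral_prod) simp_all
    also have "\<dots> = of_real (sqrt (2 * pi / \<delta>) ^ DIM('a) * exp (\<Sum>b\<in>Basis. - (s \<bullet> b)\<^sup>2 / (2 * \<delta>)))"
      by (simp add: prod.distrib exp_sum flip: of_real_prod)
    also have "(\<Sum>b\<in>Basis. - (s \<bullet> b)\<^sup>2 / (2 * \<delta>)) = - (norm s)\<^sup>2 / (2 * \<delta>)"
      unfolding power2_norm_eq_inner by (subst euclidean_inner[of s s]) (simp add: sum_negf sum_divide_distrib power2_eq_square)
    finally show ?thesis .
  qed
  have Re: "Re (g s w) = cos (s \<bullet> w) * exp (- \<delta> * (norm w)\<^sup>2 / 2)"
    and Im: "Im (g s w) = sin (s \<bullet> w) * exp (- \<delta> * (norm w)\<^sup>2 / 2)" for s w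
    by (simp_all add: g_def Re_exp Im_exp)
  show "integrable lborel (\<lambda>w::'a. exp (- \<delta> * (norm w)\<^sup>2 / 2))"
    using integrable_Re[OF gi[of 0]] by (simp add: Re)
  show "(LINT w|lborel. cos (s \<bullet> w) * exp (- \<delta> * (norm w)\<^sup>2 / 2))
      = sqrt (2 * pi / \<delta>) ^ DIM('a) * exp (- (norm s)\<^sup>2 / (2 * \<delta>))"
    using integral_Re[OF gi[of s]] by (simp add: Re gI)
  show "(LINT w|lborel. sin (s \<bullet> w) * exp (- \<delta> * (norm w)\<^sup>2 / 2)) = 0"
    using integral_Im[OF gi[of s]] by (simp add: Im gI)
qed

text \<open>The exponentials act from opposite sides and cannot be merged; as one operator they form
  a real-linear isometry of the quaternions, which is the form in which the estimates use
  them.\<close>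

definition qrot :: "real \<Rightarrow> real \<Rightarrow> quat \<Rightarrow> quat" where
  "qrot a b x = exp (- (a *\<^sub>R quat_i)) * x * exp (- (b *\<^sub>R quat_j))"

lemma exp_quat_i: "exp (- (a *\<^sub>R quat_i)) = Quat (cos a) (- sin a) 0 0"
  using exp_scaleR_imaginary_unit[OF quat_unit_products(1), of "- a"]
  by (simp add: quat_eq_iff quat_i_def)

lemma exp_quat_j: "exp (- (b *\<^sub>R quat_j)) = Quat (cos b) 0 (- sin b) 0"
  using exp_scaleR_imaginary_unit[OF quat_unit_products(2), of "- b"]
  by (simp add: quat_eq_iff quat_j_def)

lemma norm_qrot [simp]: "norm (qrot a b x) = norm x"
  by (simp add: qrot_def norm_mult exp_quat_i exp_quat_j) (simp add: norm_quat_def)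

text \<open>For the real inner product, multiplication by p on either side has multiplication by the
  conjugate of p as its adjoint, and conjugating these exponentials negates the angles. This moves
  the transform across a pairing.\<close>

lemma inner_qrot_left: "inner (qrot a b x) y = inner x (qrot (- a) (- b) y)"
proof -
  have "inner (p * x * q) y = inner x (Quat (qRe p) (- qI p) (- qJ p) (- qK p) * y * Quat (qRe q) (- qI q) (- qJ q) (- qK q))"
    for p q :: quat
    by (simp add: inner_quat_def algebra_simps)
  then show ?thesis unfolding qrot_def exp_quat_i exp_quat_j by simp
qed

text \<open>Only i occurs on the left and only j on the right, so the factors on each side commute
  and the angles add.\<close>

lemma qrot_qrot: "qrot a b (qrot a' b' x) = qrot (a + a') (b + b') x"
proof -
  have "exp (- (a *\<^sub>R quat_i)) * exp (- (a' *\<^sub>R quat_i)) = exp (- ((a + a') *\<^sub>R quat_i))"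
    by (simp add: exp_quat_i quat_eq_iff cos_add sin_add)
  moreover have "exp (- (b' *\<^sub>R quat_j)) * exp (- (b *\<^sub>R quat_j)) = exp (- ((b + b') *\<^sub>R quat_j))"
    by (simp add: exp_quat_j quat_eq_iff cos_add sin_add)
  ultimately show ?thesis by (metis qrot_def mult.assoc)
qed

text \<open>Splits the pairing into products of cosines and sines of the angle differences.
  Integrated against a Gaussian, every term with a sine disappears and only the one with
  \<open>inner x y\<close> remains.\<close>

lemma inner_qrot_qrot:
  "inner (qrot a b x) (qrot a' b' y) = cos (a - a') * cos (b - b') * inner x y
     - sin (a - a') * cos (b - b') * inner (quat_i * x) y
     - cos (a - a') * sin (b - b') * inner (x * quat_j) y
     + sin (a - a') * sin (b - b') * inner (quat_i * x * quat_j) y"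
proof -
  have "inner (qrot a b x) (qrot a' b' y) = inner (qrot (a - a') (b - b') x) y"
    using inner_qrot_left[of "- a'" "- b'" "qrot a b x" y] by (simp add: qrot_qrot)
  also have "\<dots> = cos (a - a') * cos (b - b') * inner x y
     - sin (a - a') * cos (b - b') * inner (quat_i * x) y
     - cos (a - a') * sin (b - b') * inner (x * quat_j) y
     + sin (a - a') * sin (b - b') * inner (quat_i * x * quat_j) y"
    unfolding qrot_def exp_quat_i exp_quat_j
    by (simp add: inner_quat_def quat_i_def quat_j_def algebra_simps)
  finally show ?thesis .
qed

lemma borel_measurable_qrot [measurable (raw)]:
  assumes "f \<in> borel_measurable M" "g \<in> borel_measurable M" "h \<in> borel_measurable M"
  shows "(\<lambda>z. qrot (f z) (g z) (h z)) \<in> borel_measurable M"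
proof -
  have "continuous_on UNIV (\<lambda>z. qrot (fst z) (fst (snd z)) (snd (snd z)))"
  proof -
    have "exp (- (a *\<^sub>R quat_i)) = cos a *\<^sub>R 1 - sin a *\<^sub>R quat_i"
      "exp (- (b *\<^sub>R quat_j)) = cos b *\<^sub>R 1 - sin b *\<^sub>R quat_j" for a b
      unfolding exp_quat_i exp_quat_j by (simp_all add: quat_eq_iff quat_i_def quat_j_def)
    then show ?thesis unfolding qrot_def by (simp only:) (intro continuous_intros)
  qed
  from measurable_compose[OF _ borel_measurable_continuous_onI[OF this], of "\<lambda>z. (f z, g z, h z)" M] assms
  show ?thesis by (simp add: borel_measurable_Pair)
qed

lemma borel_measurable_pair_continuous:
  fixes f :: "'a::second_countable_topology \<times> 'b::second_countable_topology \<Rightarrow> 'c::topological_space"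
  assumes "continuous_on UNIV f" "sets M = sets borel" "sets N = sets borel"
  shows "f \<in> borel_measurable (M \<Otimes>\<^sub>M N)"
proof -
  have "sets (M \<Otimes>\<^sub>M N) = sets (borel :: ('a \<times> 'b) measure)"
    unfolding borel_prod[symmetric] by (intro sets_pair_measure_cong assms)
  then show ?thesis
    using borel_measurable_continuous_onI[OF assms(1)] by (simp cong: measurable_cong_sets)
qed

abbreviation qker :: "'a::euclidean_space \<times> 'b::euclidean_space \<Rightarrow> 'a \<times> 'b \<Rightarrow> quat \<Rightarrow> quat" where
  "qker t w \<equiv> qrot (fst t \<bullet> fst w) (snd t \<bullet> snd w)"

text \<open>Unlike the ambiguity function, \<open>qft\<close> is taken with respect to unnormalised Lebesgue measure.\<close>

definition qft :: "('a::euclidean_space \<times> 'b::euclidean_space \<Rightarrow> quat) \<Rightarrow> 'a \<times> 'b \<Rightarrow> quat" where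
  "qft h w = (LINT t|lborel. qker t w (h t))"

lemma integrable_qrot:
  assumes "h \<in> borel_measurable borel" "integrable lborel (h :: 'a::euclidean_space \<times> 'b::euclidean_space \<Rightarrow> quat)"
  shows "integrable lborel (\<lambda>t. qker t w (h t))"
  by (rule Bochner_Integration.integrable_bound[OF assms(2)]) (use assms(1) in \<open>auto simp: borel_prod[symmetric]\<close>)

lemma qft_measurable [measurable]:
  assumes [measurable]: "h \<in> borel_measurable borel"
  shows "qft h \<in> borel_measurable (borel :: ('a::euclidean_space \<times> 'b::euclidean_space) measure)"
  unfolding qft_def[abs_def]
proof (intro lborel.borel_measurable_lebesgue_integral)
  have [measurable]: "(\<lambda>z::('a \<times> 'b) \<times> ('a \<times> 'b). fst (snd z) \<bullet> fst (fst z)) \<in> borel_measurable (borel \<Otimes>\<^sub>M lborel)"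
    "(\<lambda>z::('a \<times> 'b) \<times> ('a \<times> 'b). snd (snd z) \<bullet> snd (fst z)) \<in> borel_measurable (borel \<Otimes>\<^sub>M lborel)"
    by (intro borel_measurable_pair_continuous continuous_intros; simp)+
  show "(\<lambda>(x, y). qker y x (h y)) \<in> borel_measurable (borel \<Otimes>\<^sub>M lborel)"
    unfolding case_prod_beta' by measurable
qed

lemma integrable_lborel_pair_mult:
  fixes f :: "'a::euclidean_space \<Rightarrow> real" and g :: "'b::euclidean_space \<Rightarrow> real"
  assumes "integrable lborel f" "integrable lborel g"
  shows "integrable lborel (\<lambda>z. f (fst z) * g (snd z))"
    and "(LINT z|lborel. f (fst z) * g (snd z)) = integral\<^sup>L lborel f * integral\<^sup>L lborel g"
proof -
  have [measurable]: "f \<in> borel_measurable borel" "g \<in> borel_measurable borel"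
    using borel_measurable_integrable[OF assms(1)] borel_measurable_integrable[OF assms(2)] by auto
  have i: "integrable (lborel \<Otimes>\<^sub>M lborel) (\<lambda>z. f (fst z) * g (snd z))"
  proof (rule lborel_pair.Fubini_integrable)
    show "integrable lborel (\<lambda>x. LINT y|lborel. norm (f (fst (x, y)) * g (snd (x, y))))"
      using assms by (simp add: abs_mult)
  qed (use assms in auto)
  then show "integrable lborel (\<lambda>z. f (fst z) * g (snd z))" by (simp add: lborel_prod)
  have "(LINT z|lborel. f (fst z) * g (snd z)) = (LINT x|lborel. LINT y|lborel. f x * g y)"
    using lborel_pair.integral_fst'[OF i] by (simp add: lborel_prod)
  then show "(LINT z|lborel. f (fst z) * g (snd z)) = integral\<^sup>L lborel f * integral\<^sup>L lborel g" by simp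
qed

text \<open>Orthogonality of the kernels, regularised by a Gaussian. The weight splits over the two
  halves of \<open>w\<close>, and the cosine integrals recombine into a Gaussian in t - t' of mass
  (2 pi)^n, n being the dimension, which concentrates at t = t' as \<delta> tends to 0.\<close>

lemma gaussian_qft_kernel:
  fixes t t' :: "'a::euclidean_space \<times> 'b::euclidean_space" and x y :: quat
  assumes \<delta>: "\<delta> > 0"
  shows "(LINT w|lborel. exp (- \<delta> * (norm w)\<^sup>2 / 2) *
      inner (qker t w x) (qker t' w y))
    = sqrt (2 * pi / \<delta>) ^ DIM('a \<times> 'b) * exp (- (norm (t - t'))\<^sup>2 / (2 * \<delta>)) * inner x y"
proof -
  define s where "s = t - t'"
  let ?G1 = "\<lambda>w::'a. exp (- \<delta> * (norm w)\<^sup>2 / 2)" and ?G2 = "\<lambda>w::'b. exp (- \<delta> * (norm w)\<^sup>2 / 2)"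
  let ?c1 = "\<lambda>w. cos (fst s \<bullet> w) * ?G1 w" and ?s1 = "\<lambda>w. sin (fst s \<bullet> w) * ?G1 w"
  let ?c2 = "\<lambda>w. cos (snd s \<bullet> w) * ?G2 w" and ?s2 = "\<lambda>w. sin (snd s \<bullet> w) * ?G2 w"
  note G1 = gaussian_fourier(1)[OF \<delta>, where 'a='a] gaussian_fourier(2,3)[OF \<delta>, of "fst s"]
    and G2 = gaussian_fourier(1)[OF \<delta>, where 'a='b] gaussian_fourier(2,3)[OF \<delta>, of "snd s"]
  have i1: "integrable lborel ?c1" "integrable lborel ?s1"
    by (rule Bochner_Integration.integrable_bound[OF G1(1)]; simp add: abs_mult mult_left_le_one_le)+
  have i2: "integrable lborel ?c2" "integrable lborel ?s2"
    by (rule Bochner_Integration.integrable_bound[OF G2(1)]; simp add: abs_mult mult_left_le_one_le)+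
  have hb: "has_bochner_integral lborel (\<lambda>z. f (fst z) * g (snd z)) (integral\<^sup>L lborel f * integral\<^sup>L lborel g)"
    if "integrable lborel f" "integrable lborel g" for f :: "'a \<Rightarrow> real" and g :: "'b \<Rightarrow> real"
    using integrable_lborel_pair_mult[OF that] by (simp add: has_bochner_integral_iff)
  note p = hb[OF i1(1) i2(1)] hb[OF i1(2) i2(1)] hb[OF i1(1) i2(2)] hb[OF i1(2) i2(2)]
  have eq: "exp (- \<delta> * (norm w)\<^sup>2 / 2) *
      inner (qker t w x) (qker t' w y)
    = (?c1 (fst w) * ?c2 (snd w)) * inner x y - (?s1 (fst w) * ?c2 (snd w)) * inner (quat_i * x) y
     - (?c1 (fst w) * ?s2 (snd w)) * inner (x * quat_j) y + (?s1 (fst w) * ?s2 (snd w)) * inner (quat_i * x * quat_j) y" for w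
  proof -
    have n: "(norm w)\<^sup>2 = (norm (fst w))\<^sup>2 + (norm (snd w))\<^sup>2" by (simp add: norm_prod_def)
    have e: "exp (- \<delta> * (norm w)\<^sup>2 / 2) = ?G1 (fst w) * ?G2 (snd w)"
      unfolding n by (simp add: exp_add[symmetric] field_simps)
    have d: "fst t \<bullet> fst w - fst t' \<bullet> fst w = fst s \<bullet> fst w" "snd t \<bullet> snd w - snd t' \<bullet> snd w = snd s \<bullet> snd w"
      by (simp_all add: s_def inner_diff_left)
    show ?thesis unfolding e inner_qrot_qrot d by (simp add: algebra_simps)
  qed
  have "(LINT w|lborel. exp (- \<delta> * (norm w)\<^sup>2 / 2) *
      inner (qker t w x) (qker t' w y))
    = integral\<^sup>L lborel ?c1 * integral\<^sup>L lborel ?c2 * inner x y - integral\<^sup>L lborel ?s1 * integral\<^sup>L lborel ?c2 * inner (quat_i * x) y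
     - integral\<^sup>L lborel ?c1 * integral\<^sup>L lborel ?s2 * inner (x * quat_j) y + integral\<^sup>L lborel ?s1 * integral\<^sup>L lborel ?s2 * inner (quat_i * x * quat_j) y"
    unfolding eq
    by (rule has_bochner_integral_integral_eq)
      (intro has_bochner_integral_add has_bochner_integral_diff has_bochner_integral_mult_left p)
  also have "\<dots> = integral\<^sup>L lborel ?c1 * integral\<^sup>L lborel ?c2 * inner x y"
    by (simp only: G1(3) G2(3))
  also have "\<dots> = sqrt (2 * pi / \<delta>) ^ DIM('a \<times> 'b) * (exp (- (norm (fst s))\<^sup>2 / (2 * \<delta>)) * exp (- (norm (snd s))\<^sup>2 / (2 * \<delta>))) * inner x y"
    by (simp only: G1(2) G2(2)) (simp add: power_add)
  also have "exp (- (norm (fst s))\<^sup>2 / (2 * \<delta>)) * exp (- (norm (snd s))\<^sup>2 / (2 * \<delta>)) = exp (- (norm s)\<^sup>2 / (2 * \<delta>))"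
  proof -
    have n: "(norm s)\<^sup>2 = (norm (fst s))\<^sup>2 + (norm (snd s))\<^sup>2" by (simp add: norm_prod_def)
    show ?thesis unfolding n by (simp add: exp_add[symmetric] diff_divide_distrib)
  qed
  finally show ?thesis unfolding s_def .
qed

section \<open>Plancherel's theorem by Gaussian summation\<close>

lemma inner_le_sum_squares: "\<bar>x \<bullet> y\<bar> \<le> ((norm x)\<^sup>2 + (norm y)\<^sup>2) / 2" for x y :: "'a::real_inner"
  using Cauchy_Schwarz_ineq2[of x y] sum_squares_bound[of "norm x" "norm y"] by simp

lemma integral_lborel_scaleR:
  fixes f :: "'a::euclidean_space \<Rightarrow> real"
  assumes [measurable]: "f \<in> borel_measurable borel" and c: "c > 0"
  shows "integral\<^sup>L lborel f = c ^ DIM('a) * (LINT x|lborel. f (c *\<^sub>R x))"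
proof -
  have "integral\<^sup>L lborel f = integral\<^sup>L (density (distr lborel borel (\<lambda>x. 0 + c *\<^sub>R x)) (\<lambda>_. \<bar>c\<bar> ^ DIM('a))) f"
    using c by (subst lborel_affine[of c "0::'a"]) auto
  also have "\<dots> = c ^ DIM('a) * (LINT x|lborel. f (c *\<^sub>R x))"
    using c by (subst integral_density) (auto simp: integral_distr)
  finally show ?thesis .
qed

lemma integrable_lborel_Pair:
  fixes F :: "'a::euclidean_space \<Rightarrow> 'b::euclidean_space \<Rightarrow> real"
  assumes m: "(\<lambda>z. F (fst z) (snd z)) \<in> borel_measurable (lborel \<Otimes>\<^sub>M lborel)"
    and b: "\<And>x y. \<bar>F x y\<bar> \<le> f x * g y" and i: "integrable lborel f" "integrable lborel g"
  shows "integrable (lborel \<Otimes>\<^sub>M lborel) (\<lambda>z. F (fst z) (snd z))"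
proof (rule Bochner_Integration.integrable_bound)
  show "integrable (lborel \<Otimes>\<^sub>M lborel) (\<lambda>z. f (fst z) * g (snd z))"
    using integrable_lborel_pair_mult(1)[OF i] by (simp add: lborel_prod)
  show "AE z in lborel \<Otimes>\<^sub>M lborel. norm (F (fst z) (snd z)) \<le> norm (f (fst z) * g (snd z))"
    using b by (auto intro!: AE_I2 order_trans[OF b])
qed (rule m)

context
  fixes h :: "'a::euclidean_space \<times> 'b::euclidean_space \<Rightarrow> quat"
  assumes h [measurable]: "h \<in> borel_measurable borel" and h1: "integrable lborel h"
begin

lemma norm_qft_le: "norm (qft h w) \<le> (LINT t|lborel. norm (h t))"
  unfolding qft_def using integral_norm_bound[of lborel "\<lambda>t. qker t w (h t)"] by simp

lemma qft_sq_eq: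
  "(norm (qft h w))\<^sup>2 = (LINT z|lborel. inner (qker (fst z) w (h (fst z)))
      (qker (snd z) w (h (snd z))))"
proof -
  define E where "E t = qker t w (h t)" for t
  have Ei: "integrable lborel E" unfolding E_def[abs_def] by (rule integrable_qrot[OF h h1])
  then have [measurable]: "E \<in> borel_measurable borel" using borel_measurable_integrable by fastforce
  have i: "integrable (lborel \<Otimes>\<^sub>M lborel) (\<lambda>z. inner (E (fst z)) (E (snd z)))"
  proof (rule integrable_lborel_Pair)
    show "\<bar>inner (E x) (E y)\<bar> \<le> norm (E x) * norm (E y)" for x y by (rule Cauchy_Schwarz_ineq2)
  qed (use Ei in auto)
  have "(norm (qft h w))\<^sup>2 = inner (integral\<^sup>L lborel E) (integral\<^sup>L lborel E)"
    by (simp add: power2_norm_eq_inner qft_def E_def[abs_def])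
  also have "\<dots> = (LINT x|lborel. LINT y|lborel. inner (E x) (E y))"
    using Ei by simp
  also have "\<dots> = (LINT z|lborel. inner (E (fst z)) (E (snd z)))"
    using lborel_pair.integral_fst'[OF i] by (simp add: lborel_prod)
  finally show ?thesis unfolding E_def .
qed

text \<open>The square is opened into a double integral so that the integral over \<open>w\<close>
  can be done first. The Gaussian provides the integrability in \<open>w\<close> that Fubini's
  theorem requires; in the two other variables it comes from \<open>h\<close>.\<close>

lemma gaussian_qft_sq:
  assumes \<delta>: "\<delta> > 0"
  shows "(LINT w|lborel. exp (- \<delta> * (norm w)\<^sup>2 / 2) * (norm (qft h w))\<^sup>2)
    = (LINT t'|lborel. LINT t|lborel. sqrt (2 * pi / \<delta>) ^ DIM('a \<times> 'b) * exp (- (norm (t - t'))\<^sup>2 / (2 * \<delta>)) * inner (h t) (h t'))"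
proof -
  let ?E = "\<lambda>t w. qker t w (h t)"
  let ?G = "\<lambda>w::'a \<times> 'b. exp (- \<delta> * (norm w)\<^sup>2 / 2)"
  let ?\<Gamma> = "\<lambda>t t'. sqrt (2 * pi / \<delta>) ^ DIM('a \<times> 'b) * exp (- (norm (t - t'))\<^sup>2 / (2 * \<delta>)) * inner (h t) (h t')"
  have [measurable]: "(\<lambda>z::('a \<times> 'b) \<times> (('a \<times> 'b) \<times> ('a \<times> 'b)). fst (fst (snd z)) \<bullet> fst (fst z)) \<in> borel_measurable (lborel \<Otimes>\<^sub>M lborel)"
    "(\<lambda>z::('a \<times> 'b) \<times> (('a \<times> 'b) \<times> ('a \<times> 'b)). snd (fst (snd z)) \<bullet> snd (fst z)) \<in> borel_measurable (lborel \<Otimes>\<^sub>M lborel)"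
    "(\<lambda>z::('a \<times> 'b) \<times> (('a \<times> 'b) \<times> ('a \<times> 'b)). fst (snd (snd z)) \<bullet> fst (fst z)) \<in> borel_measurable (lborel \<Otimes>\<^sub>M lborel)"
    "(\<lambda>z::('a \<times> 'b) \<times> (('a \<times> 'b) \<times> ('a \<times> 'b)). snd (snd (snd z)) \<bullet> snd (fst z)) \<in> borel_measurable (lborel \<Otimes>\<^sub>M lborel)"
    by (intro borel_measurable_pair_continuous continuous_intros; simp)+
  have hm: "(\<lambda>z. h (fst z)) \<in> borel_measurable (borel :: (('a \<times> 'b) \<times> ('a \<times> 'b)) measure)"
    "(\<lambda>z. h (snd z)) \<in> borel_measurable (borel :: (('a \<times> 'b) \<times> ('a \<times> 'b)) measure)"
    by (rule measurable_compose[OF borel_measurable_continuous_onI h], intro continuous_intros)+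
  have [measurable]: "(\<lambda>z::('a \<times> 'b) \<times> (('a \<times> 'b) \<times> ('a \<times> 'b)). h (fst (snd z))) \<in> borel_measurable (lborel \<Otimes>\<^sub>M lborel)"
    "(\<lambda>z::('a \<times> 'b) \<times> (('a \<times> 'b) \<times> ('a \<times> 'b)). h (snd (snd z))) \<in> borel_measurable (lborel \<Otimes>\<^sub>M lborel)"
    using hm by (intro measurable_compose[OF measurable_snd]; simp)+
  have hh: "integrable lborel (\<lambda>z. norm (h (fst z)) * norm (h (snd z)))"
    by (intro integrable_lborel_pair_mult integrable_norm h1)
  have i: "integrable (lborel \<Otimes>\<^sub>M lborel) (\<lambda>x. (\<lambda>w z. ?G w * inner (?E (fst z) w) (?E (snd z) w)) (fst x) (snd x))"
  proof (rule integrable_lborel_Pair[OF _ _ gaussian_fourier(1)[OF \<delta>] hh])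
    show "\<bar>?G w * inner (?E (fst z) w) (?E (snd z) w)\<bar> \<le> ?G w * (norm (h (fst z)) * norm (h (snd z)))" for w z
      using Cauchy_Schwarz_ineq2[of "?E (fst z) w" "?E (snd z) w"] by (simp add: abs_mult)
  qed measurable
  have "(LINT w|lborel. ?G w * (norm (qft h w))\<^sup>2) = (LINT w|lborel. LINT z|lborel. ?G w * inner (?E (fst z) w) (?E (snd z) w))"
    by (simp add: qft_sq_eq)
  also have "\<dots> = (LINT z|lborel. LINT w|lborel. ?G w * inner (?E (fst z) w) (?E (snd z) w))"
    by (rule lborel_pair.Fubini_integral[symmetric]) (use i in \<open>simp add: case_prod_beta'\<close>)
  also have "\<dots> = (LINT z|lborel. ?\<Gamma> (fst z) (snd z))"
    by (simp only: gaussian_qft_kernel[OF \<delta>])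
  also have "\<dots> = (LINT t'|lborel. LINT t|lborel. ?\<Gamma> t t')"
  proof -
    have "integrable (lborel \<Otimes>\<^sub>M lborel) (\<lambda>z. ?\<Gamma> (fst z) (snd z))"
    proof (rule integrable_lborel_Pair[where f="\<lambda>t. sqrt (2 * pi / \<delta>) ^ DIM('a \<times> 'b) * norm (h t)" and g="\<lambda>t. norm (h t)"])
      show "\<bar>?\<Gamma> t t'\<bar> \<le> sqrt (2 * pi / \<delta>) ^ DIM('a \<times> 'b) * norm (h t) * norm (h t')" for t t'
      proof -
        have "exp (- (norm (t - t'))\<^sup>2 / (2 * \<delta>)) * \<bar>inner (h t) (h t')\<bar> \<le> 1 * (norm (h t) * norm (h t'))"
          using \<delta> by (intro mult_mono Cauchy_Schwarz_ineq2) auto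
        then have "sqrt (2 * pi / \<delta>) ^ DIM('a \<times> 'b) * (exp (- (norm (t - t'))\<^sup>2 / (2 * \<delta>)) * \<bar>inner (h t) (h t')\<bar>)
           \<le> sqrt (2 * pi / \<delta>) ^ DIM('a \<times> 'b) * (1 * (norm (h t) * norm (h t')))"
          using \<delta> by (intro mult_left_mono) auto
        then show ?thesis using \<delta> by (simp add: abs_mult mult.assoc)
      qed
      have "(\<lambda>z::('a \<times> 'b) \<times> ('a \<times> 'b). exp (- (norm (fst z - snd z))\<^sup>2 / (2 * \<delta>))) \<in> borel_measurable (lborel \<Otimes>\<^sub>M lborel)"
        by (intro borel_measurable_pair_continuous continuous_intros) (use \<delta> in auto)
      then show "(\<lambda>z. ?\<Gamma> (fst z) (snd z)) \<in> borel_measurable (lborel \<Otimes>\<^sub>M lborel)" by measurable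
    qed (use h1 in auto)
    from lborel_pair.integral_snd[of "?\<Gamma>"] this show ?thesis by (simp add: lborel_prod case_prod_beta')
  qed
  finally show ?thesis .
qed

end

text \<open>The energy weighted by a Gaussian is an average of the autocorrelation \<open>k\<close>
  over distances of order sqrt \<delta>. As \<delta> tends to 0 the weighted energies increase to
  the energy, and the averages tend to the value of \<open>k\<close> at 0 because translation is
  continuous in L2.\<close>

theorem qft_plancherel:
  fixes h :: "'a::euclidean_space \<times> 'b::euclidean_space \<Rightarrow> quat"
  assumes h [measurable]: "h \<in> borel_measurable borel" and h1: "integrable lborel h"
    and h2: "integrable lborel (\<lambda>t. (norm (h t))\<^sup>2)"
  shows "(\<integral>\<^sup>+w. ennreal ((norm (qft h w))\<^sup>2) \<partial>lborel) = ennreal ((2 * pi) ^ DIM('a \<times> 'b) * (LINT t|lborel. (norm (h t))\<^sup>2))"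
proof -
  let ?D = "DIM('a \<times> 'b)"
  define k where "k s = (LINT t|lborel. inner (h (s + t)) (h t))" for s
  define G where "G \<delta> w = exp (- \<delta> * (norm w)\<^sup>2 / 2)" for \<delta> and w :: "'a \<times> 'b"
  define \<Gamma> where "\<Gamma> \<delta> s = sqrt (2 * pi / \<delta>) ^ ?D * exp (- (norm s)\<^sup>2 / (2 * \<delta>))" for \<delta> and s :: "'a \<times> 'b"
  have hs: "(\<lambda>z. h (fst z + snd z)) \<in> borel_measurable (lborel \<Otimes>\<^sub>M lborel)"
    by (rule measurable_compose[OF borel_measurable_pair_continuous h]) (auto intro!: continuous_intros)
  have h2s: "integrable lborel (\<lambda>t. (norm (h (s + t)))\<^sup>2)" for s
    by (rule integrable_lborel_translate[OF h2])
  have h2s_eq: "(LINT t|lborel. (norm (h (s + t)))\<^sup>2) = (LINT t|lborel. (norm (h t))\<^sup>2)" for s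
    by (rule integral_lborel_translate) measurable
  have ii: "integrable lborel (\<lambda>t. ((norm (h (s + t)))\<^sup>2 + (norm (h t))\<^sup>2) / 2)" for s
    by (intro integrable_divide Bochner_Integration.integrable_add h2s h2)
  have ki: "integrable lborel (\<lambda>t. inner (h (s + t)) (h t))" for s
    by (rule Bochner_Integration.integrable_bound[OF ii[of s]])
       (use inner_le_sum_squares in \<open>auto intro!: AE_I2\<close>)
  have k0: "k 0 = (LINT t|lborel. (norm (h t))\<^sup>2)" by (simp add: k_def power2_norm_eq_inner)
  have k0_nonneg: "k 0 \<ge> 0" unfolding k0 by (intro integral_nonneg_AE) auto
  have absk: "(LINT t|lborel. \<bar>inner (h (s + t)) (h t)\<bar>) \<le> k 0" for s
  proof -
    have "(LINT t|lborel. \<bar>inner (h (s + t)) (h t)\<bar>) \<le> (LINT t|lborel. ((norm (h (s + t)))\<^sup>2 + (norm (h t))\<^sup>2) / 2)"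
      by (intro integral_mono integrable_abs ki ii inner_le_sum_squares)
    also have "\<dots> = k 0" using h2s[of s] h2 by (simp add: h2s_eq k0)
    finally show ?thesis .
  qed
  have kb: "\<bar>k s\<bar> \<le> k 0" for s
    using integral_abs_bound[of lborel "\<lambda>t. inner (h (s + t)) (h t)"] absk[of s] unfolding k_def by linarith
  have km [measurable]: "k \<in> borel_measurable borel"
    unfolding k_def[abs_def]
    by (intro lborel.borel_measurable_lebesgue_integral) (use hs in \<open>simp add: case_prod_beta'\<close>)
  \<comment> \<open>Polarisation reduces continuity of \<open>k\<close> at 0 to continuity of
    translation in L2.\<close>
  have kd: "k s = k 0 - (LINT t|lborel. (norm (h (s + t) - h t))\<^sup>2) / 2" for s
  proof -
    have "(LINT t|lborel. (norm (h (s + t) - h t))\<^sup>2)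
       = (LINT t|lborel. (norm (h (s + t)))\<^sup>2 + (norm (h t))\<^sup>2 - 2 * inner (h (s + t)) (h t))"
      by (intro Bochner_Integration.integral_cong refl)
         (simp add: power2_norm_eq_inner inner_diff_left inner_diff_right inner_commute)
    also have "\<dots> = k 0 + k 0 - 2 * k s"
      using h2s[of s] h2 ki[of s] by (simp add: h2s_eq k0[symmetric] k_def[symmetric])
    finally show ?thesis by (simp add: field_simps)
  qed
  have klim: "(\<lambda>n. k (c n *\<^sub>R y)) \<longlonglongrightarrow> k 0" if "c \<longlonglongrightarrow> 0" for c and y :: "'a \<times> 'b"
  proof -
    have "(\<lambda>n. c n *\<^sub>R y) \<longlonglongrightarrow> 0" using tendsto_scaleR[OF that tendsto_const[of y]] by simp
    from L2_translation_continuous[OF h h2 this]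
    have "(\<lambda>n. k 0 - (LINT t|lborel. (norm (h (c n *\<^sub>R y + t) - h t))\<^sup>2) / 2) \<longlonglongrightarrow> k 0 - 0 / 2"
      by (intro tendsto_intros) simp_all
    then show ?thesis by (simp only: kd[symmetric]) simp
  qed
  have I: "(LINT w|lborel. G \<delta> w * (norm (qft h w))\<^sup>2)
      = sqrt (2 * pi) ^ ?D * (LINT y|lborel. exp (- 1 * (norm y)\<^sup>2 / 2) * k (sqrt \<delta> *\<^sub>R y))" if \<delta>: "\<delta> > 0" for \<delta>
  proof -
    have \<Gamma>0: "\<Gamma> \<delta> s \<ge> 0" for s using \<delta> by (simp add: \<Gamma>_def)
    have \<Gamma>m [measurable]: "\<Gamma> \<delta> \<in> borel_measurable borel" unfolding \<Gamma>_def by measurable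
    have \<Gamma>i: "integrable lborel (\<Gamma> \<delta>)"
    proof -
      have "\<Gamma> \<delta> = (\<lambda>s. sqrt (2 * pi / \<delta>) ^ ?D * exp (- (1 / \<delta>) * (norm s)\<^sup>2 / 2))"
        by (simp add: \<Gamma>_def fun_eq_iff)
      then show ?thesis using gaussian_fourier(1)[of "1 / \<delta>", where 'a="'a \<times> 'b"] \<delta> by (simp only:) simp
    qed
    have "(LINT w|lborel. G \<delta> w * (norm (qft h w))\<^sup>2) = (LINT t'|lborel. LINT t|lborel. \<Gamma> \<delta> (t - t') * inner (h t) (h t'))"
      unfolding G_def \<Gamma>_def by (rule gaussian_qft_sq[OF h h1 \<delta>])
    also have "\<dots> = (LINT t'|lborel. LINT s|lborel. \<Gamma> \<delta> s * inner (h (s + t')) (h t'))"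
    proof (rule Bochner_Integration.integral_cong[OF refl])
      fix t' :: "'a \<times> 'b"
      have "(LINT t|lborel. \<Gamma> \<delta> (t - t') * inner (h t) (h t')) = (LINT s|lborel. \<Gamma> \<delta> (t' + s - t') * inner (h (t' + s)) (h t'))"
        by (rule integral_lborel_translate[symmetric]) measurable
      then show "(LINT t|lborel. \<Gamma> \<delta> (t - t') * inner (h t) (h t')) = (LINT s|lborel. \<Gamma> \<delta> s * inner (h (s + t')) (h t'))"
        by (simp add: add.commute)
    qed
    also have "\<dots> = (LINT s|lborel. LINT t'|lborel. \<Gamma> \<delta> s * inner (h (s + t')) (h t'))"
    proof (rule lborel_pair.Fubini_integral)
      show "integrable (lborel \<Otimes>\<^sub>M lborel) (\<lambda>(s, t'). \<Gamma> \<delta> s * inner (h (s + t')) (h t'))"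
      proof (rule lborel_pair.Fubini_integrable)
        show "(\<lambda>(s, t'). \<Gamma> \<delta> s * inner (h (s + t')) (h t')) \<in> borel_measurable (lborel \<Otimes>\<^sub>M lborel)"
          using hs by (simp add: case_prod_beta')
        show "AE s in lborel. integrable lborel (\<lambda>t'. case (s, t') of (s, t') \<Rightarrow> \<Gamma> \<delta> s * inner (h (s + t')) (h t'))"
          using ki by simp
        have m: "(\<lambda>s. LINT t|lborel. \<bar>inner (h (s + t)) (h t)\<bar>) \<in> borel_measurable borel"
          by (intro lborel.borel_measurable_lebesgue_integral) (use hs in \<open>simp add: case_prod_beta'\<close>)
        have "integrable lborel (\<lambda>s. \<Gamma> \<delta> s * (LINT t|lborel. \<bar>inner (h (s + t)) (h t)\<bar>))"
        proof (rule Bochner_Integration.integrable_bound)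
          show "integrable lborel (\<lambda>s. \<Gamma> \<delta> s * k 0)" by (intro integrable_mult_left \<Gamma>i)
          show "AE s in lborel. norm (\<Gamma> \<delta> s * (LINT t|lborel. \<bar>inner (h (s + t)) (h t)\<bar>)) \<le> norm (\<Gamma> \<delta> s * k 0)"
            using absk k0_nonneg by (intro AE_I2) (auto simp: abs_mult intro!: mult_left_mono)
        qed (use m in measurable)
        then show "integrable lborel (\<lambda>s. LINT t'|lborel. norm (case (s, t') of (s, t') \<Rightarrow> \<Gamma> \<delta> s * inner (h (s + t')) (h t')))"
          using \<Gamma>0 by (simp add: abs_mult)
      qed
    qed
    also have "\<dots> = (LINT s|lborel. \<Gamma> \<delta> s * k s)" by (simp add: k_def)
    \<comment> \<open>With s = sqrt(\<delta>) y the concentrating Gaussian becomes a fixed one and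
      \<delta> survives only in the argument of \<open>k\<close>, ready for dominated convergence
      with the bound \<open>k 0\<close>.\<close>
    also have "\<dots> = sqrt \<delta> ^ ?D * (LINT y|lborel. \<Gamma> \<delta> (sqrt \<delta> *\<^sub>R y) * k (sqrt \<delta> *\<^sub>R y))"
      using \<delta> by (intro integral_lborel_scaleR) auto
    also have "\<dots> = (LINT y|lborel. sqrt (2 * pi) ^ ?D * (exp (- 1 * (norm y)\<^sup>2 / 2) * k (sqrt \<delta> *\<^sub>R y)))"
    proof -
      have "sqrt \<delta> ^ ?D * \<Gamma> \<delta> (sqrt \<delta> *\<^sub>R y) = sqrt (2 * pi) ^ ?D * exp (- 1 * (norm y)\<^sup>2 / 2)" for y
        using \<delta> by (simp add: \<Gamma>_def power_mult_distrib[symmetric] real_sqrt_mult[symmetric] mult.assoc[symmetric] del: DIM_prod)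
           (simp add: power_mult_distrib)
      then show ?thesis by (simp only: integral_mult_right_zero[symmetric] mult.assoc[symmetric])
    qed
    finally show ?thesis by simp
  qed
  have lim1: "(\<lambda>n. LINT w|lborel. G (1 / real (Suc n)) w * (norm (qft h w))\<^sup>2) \<longlonglongrightarrow> (2 * pi) ^ ?D * k 0"
  proof -
    have "(\<lambda>n. LINT y|lborel. exp (- 1 * (norm y)\<^sup>2 / 2) * k (sqrt (1 / real (Suc n)) *\<^sub>R y))
       \<longlonglongrightarrow> (LINT y|lborel. exp (- 1 * (norm (y :: 'a \<times> 'b))\<^sup>2 / 2) * k 0)"
    proof (rule integral_dominated_convergence[where w="\<lambda>y. exp (- 1 * (norm y)\<^sup>2 / 2) * k 0"])
      show "integrable lborel (\<lambda>y::'a \<times> 'b. exp (- 1 * (norm y)\<^sup>2 / 2) * k 0)"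
        by (intro integrable_mult_left gaussian_fourier) simp
      have "(\<lambda>n. sqrt (1 / real (Suc n))) \<longlonglongrightarrow> sqrt 0"
        by (intro tendsto_real_sqrt lim_const_over_n[THEN LIMSEQ_Suc])
      then have "(\<lambda>n. sqrt (1 / real (Suc n))) \<longlonglongrightarrow> 0" by simp
      from klim[OF this]
      show "AE y in lborel. (\<lambda>n. exp (- 1 * (norm y)\<^sup>2 / 2) * k (sqrt (1 / real (Suc n)) *\<^sub>R y)) \<longlonglongrightarrow> exp (- 1 * (norm y)\<^sup>2 / 2) * k 0"
        by (intro AE_I2 tendsto_intros)
      show "AE y in lborel. norm (exp (- 1 * (norm y)\<^sup>2 / 2) * k (sqrt (1 / real (Suc n)) *\<^sub>R y)) \<le> exp (- 1 * (norm y)\<^sup>2 / 2) * k 0" for n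
        using kb by (intro AE_I2) (simp add: abs_mult)
    qed measurable
    also have "(LINT y|lborel. exp (- 1 * (norm (y :: 'a \<times> 'b))\<^sup>2 / 2) * k 0) = sqrt (2 * pi) ^ ?D * k 0"
      using gaussian_fourier(2)[of 1 "0 :: 'a \<times> 'b"] by simp
    finally have "(\<lambda>n. sqrt (2 * pi) ^ ?D * (LINT y|lborel. exp (- 1 * (norm y)\<^sup>2 / 2) * k (sqrt (1 / real (Suc n)) *\<^sub>R y)))
       \<longlonglongrightarrow> sqrt (2 * pi) ^ ?D * (sqrt (2 * pi) ^ ?D * k 0)" by (intro tendsto_intros)
    moreover have "sqrt (2 * pi) ^ ?D * (sqrt (2 * pi) ^ ?D * k 0) = (2 * pi) ^ ?D * k 0"
    proof -
      have "sqrt (2 * pi) ^ ?D * sqrt (2 * pi) ^ ?D = (2 * pi) ^ ?D"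
        by (subst power_mult_distrib[symmetric]) simp
      then show ?thesis by (simp only: mult.assoc[symmetric])
    qed
    moreover have "(LINT w|lborel. G (1 / real (Suc n)) w * (norm (qft h w))\<^sup>2) = sqrt (2 * pi) ^ ?D *
        (LINT y|lborel. exp (- 1 * (norm y)\<^sup>2 / 2) * k (sqrt (1 / real (Suc n)) *\<^sub>R y))" for n
      by (rule I) simp
    ultimately show ?thesis by (simp only:)
  qed
  have Gi: "integrable lborel (\<lambda>w. G \<delta> w * (norm (qft h w))\<^sup>2)" if "\<delta> > 0" for \<delta>
  proof (rule Bochner_Integration.integrable_bound)
    show "integrable lborel (\<lambda>w. G \<delta> w * (LINT t|lborel. norm (h t))\<^sup>2)"
      unfolding G_def by (intro integrable_mult_left gaussian_fourier that)
    show "AE w in lborel. norm (G \<delta> w * (norm (qft h w))\<^sup>2) \<le> norm (G \<delta> w * (LINT t|lborel. norm (h t))\<^sup>2)"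
      using power_mono[OF norm_qft_le[OF h h1], where n=2] by (intro AE_I2) (auto simp: abs_mult G_def)
  qed (unfold G_def, measurable)
  have "(\<lambda>n. \<integral>\<^sup>+w. ennreal (G (1 / real (Suc n)) w * (norm (qft h w))\<^sup>2) \<partial>lborel)
      \<longlonglongrightarrow> (\<integral>\<^sup>+w. ennreal ((norm (qft h w))\<^sup>2) \<partial>lborel)"
  proof (rule nn_integral_LIMSEQ)
    \<comment> \<open>The weights increase as \<delta> decreases, so monotone convergence applies
      before the energy is known to be finite.\<close>
    show "incseq (\<lambda>n w. ennreal (G (1 / real (Suc n)) w * (norm (qft h w))\<^sup>2))"
    proof (intro incseq_SucI le_funI ennreal_leI mult_right_mono)
      show "G (1 / real (Suc n)) w \<le> G (1 / real (Suc (Suc n))) w" for n w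
      proof -
        have anti: "G b w \<le> G a w" if "a \<le> b" for a b
          using that by (simp add: G_def mult_right_mono)
        show ?thesis by (rule anti, rule frac_le) auto
      qed
    qed simp
    show "(\<lambda>n. ennreal (G (1 / real (Suc n)) w * (norm (qft h w))\<^sup>2)) \<longlonglongrightarrow> ennreal ((norm (qft h w))\<^sup>2)" for w
    proof -
      have "(\<lambda>n. G (1 / real (Suc n)) w * (norm (qft h w))\<^sup>2) \<longlonglongrightarrow> exp (- 0 * (norm w)\<^sup>2 / 2) * (norm (qft h w))\<^sup>2"
        unfolding G_def by (intro tendsto_intros lim_const_over_n[THEN LIMSEQ_Suc]) simp
      then show ?thesis by (intro tendsto_ennrealI) simp
    qed
  qed (unfold G_def, measurable)
  moreover have "(\<integral>\<^sup>+w. ennreal (G (1 / real (Suc n)) w * (norm (qft h w))\<^sup>2) \<partial>lborel)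
     = ennreal (LINT w|lborel. G (1 / real (Suc n)) w * (norm (qft h w))\<^sup>2)" for n
    by (intro nn_integral_eq_integral Gi) (auto simp: G_def)
  ultimately have "(\<lambda>n. ennreal (LINT w|lborel. G (1 / real (Suc n)) w * (norm (qft h w))\<^sup>2))
      \<longlonglongrightarrow> (\<integral>\<^sup>+w. ennreal ((norm (qft h w))\<^sup>2) \<partial>lborel)" by simp
  from LIMSEQ_unique[OF this tendsto_ennrealI[OF lim1]] show ?thesis by (simp add: k0)
qed

section \<open>Local uncertainty\<close>

lemma nn_integral_Holder:
  fixes F G :: "'a \<Rightarrow> real"
  assumes \<theta>: "0 < \<theta>" "\<theta> < 1" and F: "integrable M F" "\<And>x. 0 \<le> F x" and G: "integrable M G" "\<And>x. 0 \<le> G x"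
  shows "(\<integral>\<^sup>+x. ennreal (F x powr \<theta> * G x powr (1 - \<theta>)) \<partial>M)
    \<le> ennreal (integral\<^sup>L M F powr \<theta> * integral\<^sup>L M G powr (1 - \<theta>))"
proof -
  define A B where "A = integral\<^sup>L M F" and "B = integral\<^sup>L M G"
  have AB: "A \<ge> 0" "B \<ge> 0" unfolding A_def B_def using F G by auto
  note [measurable] = borel_measurable_integrable[OF F(1)] borel_measurable_integrable[OF G(1)]
  show ?thesis
  proof (cases "A = 0 \<or> B = 0")
    case True
    then have "(AE x in M. F x = 0) \<or> (AE x in M. G x = 0)"
      using F G by (auto simp: A_def B_def integral_nonneg_eq_0_iff_AE)
    then have "AE x in M. ennreal (F x powr \<theta> * G x powr (1 - \<theta>)) = 0"
      by (elim disjE; elim eventually_mono; simp)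
    then have "(\<integral>\<^sup>+x. ennreal (F x powr \<theta> * G x powr (1 - \<theta>)) \<partial>M) = 0"
      by (subst nn_integral_0_iff_AE) auto
    then show ?thesis by simp
  next
    case False
    then have pos: "A > 0" "B > 0" using AB by auto
    define c where "c = A powr \<theta> * B powr (1 - \<theta>)"
    have c: "c \<ge> 0" by (simp add: c_def)
    have le: "F x powr \<theta> * G x powr (1 - \<theta>) \<le> c * (\<theta> * (F x / A) + (1 - \<theta>) * (G x / B))" for x
    proof (cases "F x = 0 \<or> G x = 0")
      case True
      then have "F x powr \<theta> * G x powr (1 - \<theta>) = 0" by auto
      also have "0 \<le> c * (\<theta> * (F x / A) + (1 - \<theta>) * (G x / B))"
        using \<theta> c pos F(2)[of x] G(2)[of x] by (intro mult_nonneg_nonneg add_nonneg_nonneg) auto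
      finally show ?thesis .
    next
      case False
      then have p: "F x > 0" "G x > 0" using F(2)[of x] G(2)[of x] by auto
      have "F x powr \<theta> * G x powr (1 - \<theta>) = c * ((F x / A) powr \<theta> * (G x / B) powr (1 - \<theta>))"
        using p pos by (simp add: c_def powr_divide)
      also have "\<dots> \<le> c * (\<theta> * (F x / A) + (1 - \<theta>) * (G x / B))"
        using \<theta> p pos c by (intro mult_left_mono Youngs_inequality_0) auto
      finally show ?thesis .
    qed
    have i: "integrable M (\<lambda>x. c * (\<theta> * (F x / A) + (1 - \<theta>) * (G x / B)))"
      by (intro integrable_mult_right Bochner_Integration.integrable_add integrable_divide F G)
    have "(\<integral>\<^sup>+x. ennreal (F x powr \<theta> * G x powr (1 - \<theta>)) \<partial>M)
      \<le> (\<integral>\<^sup>+x. ennreal (c * (\<theta> * (F x / A) + (1 - \<theta>) * (G x / B))) \<partial>M)"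
      by (intro nn_integral_mono ennreal_leI le)
    also have "\<dots> = ennreal (LINT x|M. c * (\<theta> * (F x / A) + (1 - \<theta>) * (G x / B)))"
      by (intro nn_integral_eq_integral i AE_I2 mult_nonneg_nonneg add_nonneg_nonneg)
         (use \<theta> c pos F(2) G(2) in auto)
    also have "(LINT x|M. c * (\<theta> * (F x / A) + (1 - \<theta>) * (G x / B))) = c * (\<theta> * (A / A) + (1 - \<theta>) * (B / B))"
      using F(1) G(1) by (simp add: A_def B_def)
    also have "\<dots> = c" using pos by simp
    finally show ?thesis by (simp add: c_def A_def B_def)
  qed
qed

lemma conjugate_exponent_bounds:
  fixes p q :: real
  assumes "p > 2" "1 / p + 1 / q = 1"
  shows "1 < q" "q < 2" "q - 1 = q / p"
proof -
  have e: "1 / q = 1 - 1 / p" using assms by simp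
  have "1 / p < 1 / 2" "1 / p > 0" using assms by (auto simp: field_simps)
  then have b: "1/2 < 1 / q" "1 / q < 1" using e by auto
  then have "0 < 1 / q" by linarith
  then have q0: "q > 0" by (simp only: zero_less_divide_1_iff)
  show "1 < q" "q < 2" using b q0 by (simp_all add: field_simps)
  have "q = q * (1 / p + 1 / q)" using assms by simp
  also have "\<dots> = q / p + 1" unfolding distrib_left using q0 by simp
  finally show "q - 1 = q / p" by simp
qed

text \<open>Pairing \<open>qft h\<close> with \<open>k = 1\<^sub>V qft h\<close> and moving the transform onto \<open>k\<close> leaves only the norm of the
  transform of \<open>k\<close> in \<open>L\<^sup>p\<close>, which is controlled by its norms in \<open>L\<^sup>2\<close> and \<open>L\<^sup>\<infinity>\<close>; so no interpolation
  theorem is needed.\<close>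

lemma qft_local_uncertainty:
  fixes h :: "'a::euclidean_space \<times> 'b::euclidean_space \<Rightarrow> quat"
  assumes h [measurable]: "h \<in> borel_measurable borel" and h1: "integrable lborel h"
    and hq: "integrable lborel (\<lambda>t. norm (h t) powr q)"
    and pq: "p > 2" "1 / p + 1 / q = 1"
    and V [measurable]: "V \<in> sets borel" and Vfin: "emeasure lborel V < \<infinity>"
  shows "(\<integral>\<^sup>+w. ennreal (indicator V w * (norm (qft h w))\<^sup>2) \<partial>lborel)
    \<le> ennreal (measure lborel V powr (1 - 2 / p) * (2 * pi) powr (2 * DIM('a \<times> 'b) / p) *
        (LINT t|lborel. norm (h t) powr q) powr (2 / q))"
proof -
  let ?D = "DIM('a \<times> 'b)"
  note q = conjugate_exponent_bounds[OF pq]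
  define N where "N = (LINT t|lborel. norm (h t))"
  \<comment> \<open>Since \<open>V\<close> has finite measure and \<open>qft h\<close> is bounded,
    \<open>k\<close> is integrable and square integrable: its energy \<open>J\<close> is finite, and
    Plancherel's theorem applies to it.\<close>
  define k where "k w = indicator V w *\<^sub>R qft h w" for w
  have k_meas [measurable]: "k \<in> borel_measurable borel" unfolding k_def[abs_def] by measurable
  have N0: "N \<ge> 0" unfolding N_def by (intro integral_nonneg_AE) auto
  have kN: "norm (k w) \<le> N * indicator V w" for w
    using norm_qft_le[OF h h1, of w] by (auto simp: k_def N_def indicator_def)
  have iV: "integrable lborel (indicator V :: _ \<Rightarrow> real)"
    using Vfin by (auto simp: integrable_indicator_iff)
  have k1: "integrable lborel k"
    by (rule Bochner_Integration.integrable_bound[OF integrable_mult_right[OF iV, of N]])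
       (use kN N0 in \<open>auto simp: abs_mult\<close>)
  have k2: "integrable lborel (\<lambda>w. (norm (k w))\<^sup>2)"
  proof (rule Bochner_Integration.integrable_bound[OF integrable_mult_right[OF iV, of "N\<^sup>2"]])
    have "(norm (k w))\<^sup>2 \<le> N\<^sup>2 * indicator V w" for w
      using power_mono[OF kN[of w] norm_ge_zero, where n=2] by (cases "w \<in> V") auto
    then show "AE w in lborel. norm ((norm (k w))\<^sup>2) \<le> norm (N\<^sup>2 * indicator V w)"
      by (intro AE_I2) simp
  qed measurable
  define J where "J = (LINT w|lborel. (norm (k w))\<^sup>2)"
  have J0: "J \<ge> 0" unfolding J_def by (intro integral_nonneg_AE) auto
  have sq: "indicator V w * (norm (qft h w))\<^sup>2 = (norm (k w))\<^sup>2" for w by (auto simp: k_def indicator_def)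
  have Jnn: "(\<integral>\<^sup>+w. ennreal (indicator V w * (norm (qft h w))\<^sup>2) \<partial>lborel) = ennreal J"
    unfolding sq J_def by (intro nn_integral_eq_integral k2) auto
  \<comment> \<open>The transform at -t is the adjoint transform, with both angles negated as in
    \<open>inner_qrot_left\<close>.\<close>
  define K where "K t = qft k (- t)" for t
  have K_eq: "K t = (LINT w|lborel. qrot (- (fst t \<bullet> fst w)) (- (snd t \<bullet> snd w)) (k w))" for t
    by (simp add: K_def qft_def inner_commute)
  have K_meas [measurable]: "K \<in> borel_measurable borel" unfolding K_def[abs_def] by measurable
  have "J = (LINT w|lborel. LINT t|lborel. inner (k w) (qker t w (h t)))"
  proof -
    have "(norm (k w))\<^sup>2 = (LINT t|lborel. inner (k w) (qker t w (h t)))" for w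
    proof -
      have "(norm (k w))\<^sup>2 = inner (k w) (qft h w)" by (simp add: k_def power2_norm_eq_inner indicator_def)
      then show ?thesis unfolding qft_def using integrable_qrot[OF h h1, of w] by simp
    qed
    then show ?thesis by (simp add: J_def)
  qed
  also have "\<dots> = (LINT t|lborel. LINT w|lborel. inner (k w) (qker t w (h t)))"
  proof (rule lborel_pair.Fubini_integral)
    have [measurable]: "(\<lambda>z::('a \<times> 'b) \<times> ('a \<times> 'b). fst (fst z) \<bullet> fst (snd z)) \<in> borel_measurable (lborel \<Otimes>\<^sub>M lborel)"
      "(\<lambda>z::('a \<times> 'b) \<times> ('a \<times> 'b). snd (fst z) \<bullet> snd (snd z)) \<in> borel_measurable (lborel \<Otimes>\<^sub>M lborel)"
      by (intro borel_measurable_pair_continuous continuous_intros; simp)+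
    have "integrable (lborel \<Otimes>\<^sub>M lborel) (\<lambda>z. inner (k (snd z)) (qker (fst z) (snd z) (h (fst z))))"
    proof (rule integrable_lborel_Pair[of "\<lambda>t w. inner (k w) (qker t w (h t))"])
      show "\<bar>inner (k w) (qker t w (h t))\<bar> \<le> norm (h t) * norm (k w)" for t w
        using Cauchy_Schwarz_ineq2[of "k w" "qker t w (h t)"] by (simp add: mult.commute)
    qed (use h1 k1 in auto)
    then show "integrable (lborel \<Otimes>\<^sub>M lborel) (\<lambda>(t, w). inner (k w) (qker t w (h t)))"
      by (simp add: case_prod_beta')
  qed
  also have "\<dots> = (LINT t|lborel. inner (K t) (h t))"
  proof (rule Bochner_Integration.integral_cong[OF refl])
    fix t
    have "integrable lborel (\<lambda>w. qker (- t) w (k w))"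
      using integrable_qrot[OF k_meas k1, of "- t"] by (simp add: inner_commute)
    then have i: "integrable lborel (\<lambda>w. qrot (- (fst t \<bullet> fst w)) (- (snd t \<bullet> snd w)) (k w))" by simp
    have "inner (k w) (qker t w (h t)) = inner (qrot (- (fst t \<bullet> fst w)) (- (snd t \<bullet> snd w)) (k w)) (h t)" for w
      by (simp add: inner_qrot_left)
    then show "(LINT w|lborel. inner (k w) (qker t w (h t))) = inner (K t) (h t)"
      unfolding K_eq using i by simp
  qed
  finally have J_dual: "J = (LINT t|lborel. inner (K t) (h t))" .
  \<comment> \<open>Cauchy-Schwarz over \<open>V\<close> bounds the integral of |k|, and hence the
    supremum of |K|, by this square root.\<close>
  define B where "B = (measure lborel V * J) powr (1/2)"
  have B0: "B \<ge> 0" by (simp add: B_def)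
  have KB: "norm (K t) \<le> B" for t
  proof -
    have "ennreal (norm (K t)) \<le> ennreal (LINT w|lborel. norm (k w))"
      unfolding K_def using norm_qft_le[OF k_meas k1, of "- t"] by (intro ennreal_leI)
    also have "\<dots> = (\<integral>\<^sup>+w. ennreal (norm (k w)) \<partial>lborel)"
      by (intro nn_integral_eq_integral[symmetric] integrable_norm k1) auto
    also have "\<dots> = (\<integral>\<^sup>+w. ennreal (indicator V w powr (1/2) * ((norm (k w))\<^sup>2) powr (1 - 1/2)) \<partial>lborel)"
      by (intro nn_integral_cong) (auto simp: k_def indicator_def powr_half_sqrt)
    also have "\<dots> \<le> ennreal (integral\<^sup>L lborel (indicator V) powr (1/2) * J powr (1 - 1/2))"
      unfolding J_def by (intro nn_integral_Holder iV k2) auto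
    also have "\<dots> = ennreal B" using J0 by (simp add: B_def powr_mult)
    finally show ?thesis using B0 by (simp add: ennreal_le_iff)
  qed
  have K2: "(\<integral>\<^sup>+t. ennreal ((norm (K t))\<^sup>2) \<partial>lborel) = ennreal ((2 * pi) ^ ?D * J)"
  proof -
    have "(\<integral>\<^sup>+t. ennreal ((norm (K t))\<^sup>2) \<partial>lborel) = (\<integral>\<^sup>+t. ennreal ((norm (qft k t))\<^sup>2) \<partial>lborel)"
    proof -
      have "(lborel :: ('a \<times> 'b) measure) = distr lborel borel uminus"
        using lborel_affine[of "-1" "0::'a \<times> 'b"] by (simp add: density_1)
      then have "(\<integral>\<^sup>+t. ennreal ((norm (qft k t))\<^sup>2) \<partial>lborel) = (\<integral>\<^sup>+t. ennreal ((norm (qft k t))\<^sup>2) \<partial>distr lborel borel uminus)"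
        by simp
      also have "\<dots> = (\<integral>\<^sup>+t. ennreal ((norm (K t))\<^sup>2) \<partial>lborel)" by (subst nn_integral_distr) (auto simp: K_def)
      finally show ?thesis by simp
    qed
    then show ?thesis using qft_plancherel[OF k_meas k1 k2] by (simp add: J_def)
  qed
  have K2i: "integrable lborel (\<lambda>t. (norm (K t))\<^sup>2)"
    by (rule integrableI_nonneg) (auto simp: K2)
  have K2I: "(LINT t|lborel. (norm (K t))\<^sup>2) = (2 * pi) ^ ?D * J"
    using K2 nn_integral_eq_integral[OF K2i] J0 by (simp add: ennreal_inj integral_nonneg_AE)
  \<comment> \<open>A majorant of |K|^p that is a multiple of |K|^2: the factor |K|^(p - 2) is
    replaced by its supremum bound.\<close>
  define W where "W t = B powr (p - 2) * (norm (K t))\<^sup>2" for t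
  have Kp: "norm (K t) powr p \<le> W t" for t
  proof (cases "K t = 0")
    case False
    have "norm (K t) powr p = norm (K t) powr (p - 2) * norm (K t) powr 2" by (subst powr_add[symmetric]) simp
    also have "\<dots> \<le> B powr (p - 2) * norm (K t) powr 2"
      using KB[of t] pq by (intro mult_right_mono powr_mono2) auto
    finally show ?thesis using False by (simp add: W_def)
  qed (simp add: W_def)
  have "ennreal J \<le> (\<integral>\<^sup>+t. ennreal (norm (K t) * norm (h t)) \<partial>lborel)"
  proof -
    have i: "integrable lborel (\<lambda>t. norm (K t) * norm (h t))"
      by (rule Bochner_Integration.integrable_bound[OF integrable_mult_right[OF integrable_norm[OF h1], of B]])
         (use KB B0 in \<open>auto intro!: AE_I2 mult_right_mono simp: abs_mult\<close>)
    have "J \<le> (LINT t|lborel. norm (K t) * norm (h t))" unfolding J_dual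
    proof (rule integral_mono'[OF i])
      show "inner (K t) (h t) \<le> norm (K t) * norm (h t)" for t by (rule norm_cauchy_schwarz)
    qed auto
    then show ?thesis by (subst nn_integral_eq_integral[OF i]) (auto intro: ennreal_leI)
  qed
  also have "\<dots> \<le> (\<integral>\<^sup>+t. ennreal ((norm (h t) powr q) powr (1/q) * W t powr (1 - 1/q)) \<partial>lborel)"
  proof (intro nn_integral_mono ennreal_leI)
    fix t
    have e: "1 - 1 / q = 1 / p" using pq by simp
    have "norm (K t) = (norm (K t) powr p) powr (1 / p)" using pq by (simp add: powr_powr)
    also have "\<dots> \<le> W t powr (1 - 1 / q)" unfolding e using pq Kp by (intro powr_mono2) auto
    finally have "norm (K t) * norm (h t) \<le> W t powr (1 - 1 / q) * norm (h t)" by (rule mult_right_mono) simp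
    then show "norm (K t) * norm (h t) \<le> (norm (h t) powr q) powr (1/q) * W t powr (1 - 1/q)"
      using q by (simp add: powr_powr mult.commute)
  qed
  also have "\<dots> \<le> ennreal ((LINT t|lborel. norm (h t) powr q) powr (1/q) * integral\<^sup>L lborel W powr (1 - 1/q))"
  proof (rule nn_integral_Holder)
    show "integrable lborel W" unfolding W_def by (intro integrable_mult_right K2i)
  qed (use q hq in \<open>auto simp: W_def\<close>)
  also have "integral\<^sup>L lborel W = B powr (p - 2) * ((2 * pi) ^ ?D * J)"
    unfolding W_def by (simp add: K2I)
  finally have main: "J \<le> (LINT t|lborel. norm (h t) powr q) powr (1/q) * (B powr (p - 2) * ((2 * pi) ^ ?D * J)) powr (1 - 1/q)"
    by (simp add: ennreal_le_iff)
  define Q v where "Q = (LINT t|lborel. norm (h t) powr q)" and "v = measure lborel V"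
  have Q0: "Q \<ge> 0" unfolding Q_def by (intro integral_nonneg_AE) auto
  have "J \<le> v powr (1 - 2 / p) * (2 * pi) powr (2 * ?D / p) * Q powr (2 / q)"
  proof (cases "J = 0")
    case False
    then have Jp: "J > 0" using J0 by simp
    have e: "1 - 1 / q = 1 / p" using pq by simp
    \<comment> \<open>The factor \<open>B\<close> contributes J^(1/2 - 1/p) and Plancherel's theorem
      J^(1/p). Thus \<open>J\<close> returns on the right to the power 1/2 and can be absorbed;
      squaring \<open>c\<close> gives the claimed constant.\<close>
    define c where "c = v powr (1/2 - 1/p) * (2 * pi) powr (?D / p) * Q powr (1 / q)"
    have "(B powr (p - 2) * ((2 * pi) ^ ?D * J)) powr (1 / p)
      = v powr (1/2 - 1/p) * (2 * pi) powr (?D / p) * J powr (1/2)"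
    proof -
      have "(B powr (p - 2)) powr (1 / p) = (v * J) powr (1/2 - 1/p)"
        using pq by (simp add: B_def v_def powr_powr field_simps)
      moreover have "((2 * pi) ^ ?D) powr (1 / p) = (2 * pi) powr (?D / p)"
      proof -
        have "((2 * pi) ^ ?D) powr (1 / p) = ((2 * pi) powr ?D) powr (1 / p)" by (subst powr_realpow) simp_all
        then show ?thesis by (simp only: powr_powr times_divide_eq_right mult_1_right)
      qed
      moreover have "J powr (1/2 - 1/p) * J powr (1/p) = J powr (1/2)" by (simp flip: powr_add)
      ultimately show ?thesis using J0 by (simp add: powr_mult v_def mult_ac)
    qed
    then have "J \<le> c * J powr (1/2)" using main unfolding e c_def Q_def[symmetric] by (simp add: mult_ac)
    moreover have "J = J powr (1/2) * J powr (1/2)" using Jp by (simp flip: powr_add)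
    ultimately have "J powr (1/2) * J powr (1/2) \<le> c * J powr (1/2)" by simp
    then have "J powr (1/2) \<le> c" using Jp by simp
    then have "J powr (1/2) * J powr (1/2) \<le> c * c" using Jp by (intro mult_mono) (auto simp: c_def)
    also have "c * c = (v powr (1/2 - 1/p) * v powr (1/2 - 1/p)) * ((2 * pi) powr (?D / p) * (2 * pi) powr (?D / p)) * (Q powr (1/q) * Q powr (1/q))"
      by (simp only: c_def mult_ac)
    also have "\<dots> = v powr (1 - 2 / p) * (2 * pi) powr (2 * ?D / p) * Q powr (2 / q)"
    proof -
      have dbl: "x powr a * x powr a = x powr (2 * a)" for x a :: real by (simp flip: powr_add)
      show ?thesis unfolding dbl by (simp add: right_diff_distrib del: DIM_prod)
    qed
    finally show ?thesis using \<open>J = J powr (1/2) * J powr (1/2)\<close> by simp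
  qed simp
  then show ?thesis unfolding Jnn Q_def v_def by (rule ennreal_leI)
qed

section \<open>The ambiguity function\<close>

lemma norm_qcnj [simp]: "norm (qcnj x) = norm x"
  by (simp add: qcnj_def norm_quat_def)

lemma borel_measurable_qcnj [measurable (raw)]:
  assumes "f \<in> borel_measurable M"
  shows "(\<lambda>x. qcnj (f x)) \<in> borel_measurable M"
proof -
  have "linear qcnj" by (rule linearI) (auto simp: qcnj_def quat_eq_iff)
  then have "continuous_on UNIV qcnj" by (rule linear_continuous_on[OF linear_conv_bounded_linear[THEN iffD1]])
  from measurable_compose[OF assms borel_measurable_continuous_onI[OF this]] show ?thesis .
qed

definition shifted_product :: "('a::euclidean_space \<Rightarrow> quat) \<Rightarrow> ('a \<Rightarrow> quat) \<Rightarrow> 'a \<Rightarrow> 'a \<Rightarrow> quat" where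
  "shifted_product f g x t = f (t + x /\<^sub>R 2) * qcnj (g (t - x /\<^sub>R 2))"

text \<open>Unnormalised and for arbitrary Euclidean factors; \<open>ambiguity_eq_qamb\<close>
  restores the constant of the measure.\<close>

definition qamb :: "('a::euclidean_space \<times> 'b::euclidean_space \<Rightarrow> quat) \<Rightarrow> ('a \<times> 'b \<Rightarrow> quat) \<Rightarrow>
    ('a \<times> 'b) \<times> ('a \<times> 'b) \<Rightarrow> quat" where
  "qamb f g z = qft (shifted_product f g (fst z)) (snd z)"

lemma norm_shifted_product: "norm (shifted_product f g x t) = norm (f (t + x /\<^sub>R 2)) * norm (g (t - x /\<^sub>R 2))"
  by (simp add: shifted_product_def norm_mult)

text \<open>Moving the origin by x/2 turns the symmetric shifts into the one-sided form of a
  correlation, as in \<open>young_convolution\<close>.\<close>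

lemma shifted_product_translate: "shifted_product f g x (x /\<^sub>R 2 + t) = f (t + x) * qcnj (g t)"
proof -
  have "x /\<^sub>R 2 + x /\<^sub>R 2 = x" by (simp flip: scaleR_add_left)
  then have e: "x /\<^sub>R 2 + t + x /\<^sub>R 2 = t + x" by (metis add.assoc add.commute)
  show ?thesis unfolding shifted_product_def e by (simp only: add_diff_cancel_left')
qed

lemma measurable_shifted_product_pair:
  fixes f g :: "'a::euclidean_space \<Rightarrow> quat"
  assumes f: "f \<in> borel_measurable borel" and g: "g \<in> borel_measurable borel"
  shows "(\<lambda>z. shifted_product f g (fst z) (snd z)) \<in> borel_measurable (lborel \<Otimes>\<^sub>M lborel)"
proof -
  have [measurable]: "(\<lambda>z::'a \<times> 'a. f (snd z + fst z /\<^sub>R 2)) \<in> borel_measurable (lborel \<Otimes>\<^sub>M lborel)"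
    by (rule measurable_compose[OF borel_measurable_pair_continuous f]) (auto intro!: continuous_intros)
  have [measurable]: "(\<lambda>z::'a \<times> 'a. g (snd z - fst z /\<^sub>R 2)) \<in> borel_measurable (lborel \<Otimes>\<^sub>M lborel)"
    by (rule measurable_compose[OF borel_measurable_pair_continuous g]) (auto intro!: continuous_intros)
  show ?thesis unfolding shifted_product_def by measurable
qed

lemma measurable_shifted_product [measurable]:
  fixes f g :: "'a::euclidean_space \<Rightarrow> quat"
  assumes [measurable]: "f \<in> borel_measurable borel" "g \<in> borel_measurable borel"
  shows "shifted_product f g x \<in> borel_measurable borel"
  unfolding shifted_product_def[abs_def] by measurable

lemma measurable_qamb [measurable]:
  fixes f g :: "'a::euclidean_space \<times> 'b::euclidean_space \<Rightarrow> quat"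
  assumes f: "f \<in> borel_measurable borel" and g: "g \<in> borel_measurable borel"
  shows "qamb f g \<in> borel_measurable borel"
  unfolding qamb_def[abs_def] qft_def
proof (intro lborel.borel_measurable_lebesgue_integral)
  have [measurable]: "(\<lambda>z::(('a \<times> 'b) \<times> ('a \<times> 'b)) \<times> ('a \<times> 'b). fst (snd z) \<bullet> fst (snd (fst z))) \<in> borel_measurable (borel \<Otimes>\<^sub>M lborel)"
    "(\<lambda>z::(('a \<times> 'b) \<times> ('a \<times> 'b)) \<times> ('a \<times> 'b). snd (snd z) \<bullet> snd (snd (fst z))) \<in> borel_measurable (borel \<Otimes>\<^sub>M lborel)"
    by (intro borel_measurable_pair_continuous continuous_intros; simp)+
  have [measurable]: "(\<lambda>z::(('a \<times> 'b) \<times> ('a \<times> 'b)) \<times> ('a \<times> 'b). f (snd z + fst (fst z) /\<^sub>R 2)) \<in> borel_measurable (borel \<Otimes>\<^sub>M lborel)"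
    by (rule measurable_compose[OF borel_measurable_pair_continuous f]) (auto intro!: continuous_intros)
  have [measurable]: "(\<lambda>z::(('a \<times> 'b) \<times> ('a \<times> 'b)) \<times> ('a \<times> 'b). g (snd z - fst (fst z) /\<^sub>R 2)) \<in> borel_measurable (borel \<Otimes>\<^sub>M lborel)"
    by (rule measurable_compose[OF borel_measurable_pair_continuous g]) (auto intro!: continuous_intros)
  show "(\<lambda>(z, t). qker t (snd z) (shifted_product f g (fst z) t))
      \<in> borel_measurable (borel \<Otimes>\<^sub>M lborel)"
    unfolding shifted_product_def case_prod_beta' by measurable
qed

lemma integrable_shifted_product:
  fixes f g :: "'a::euclidean_space \<Rightarrow> quat"
  assumes [measurable]: "f \<in> borel_measurable borel" "g \<in> borel_measurable borel"
    and f2: "integrable lborel (\<lambda>t. (norm (f t))\<^sup>2)" and g2: "integrable lborel (\<lambda>t. (norm (g t))\<^sup>2)"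
  shows "integrable lborel (shifted_product f g x)"
proof (rule Bochner_Integration.integrable_bound)
  show "integrable lborel (\<lambda>t. ((norm (f (x /\<^sub>R 2 + t)))\<^sup>2 + (norm (g (- (x /\<^sub>R 2) + t)))\<^sup>2) / 2)"
    by (intro integrable_divide Bochner_Integration.integrable_add integrable_lborel_translate[OF f2] integrable_lborel_translate[OF g2])
  show "AE t in lborel. norm (shifted_product f g x t) \<le> norm (((norm (f (x /\<^sub>R 2 + t)))\<^sup>2 + (norm (g (- (x /\<^sub>R 2) + t)))\<^sup>2) / 2)"
    unfolding norm_shifted_product
    using sum_squares_bound[of "norm (f (x /\<^sub>R 2 + t))" "norm (g (- (x /\<^sub>R 2) + t))" for t]
    by (intro AE_I2) (simp add: add.commute mult_ac)
qed measurable

lemma nn_integral_shifted_product_sq: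
  fixes f g :: "'a::euclidean_space \<Rightarrow> quat"
  assumes f [measurable]: "f \<in> borel_measurable borel" and g [measurable]: "g \<in> borel_measurable borel"
  shows "(\<integral>\<^sup>+x. \<integral>\<^sup>+t. ennreal ((norm (shifted_product f g x t))\<^sup>2) \<partial>lborel \<partial>lborel)
    = (\<integral>\<^sup>+t. ennreal ((norm (f t))\<^sup>2) \<partial>lborel) * (\<integral>\<^sup>+t. ennreal ((norm (g t))\<^sup>2) \<partial>lborel)"
proof -
  have [measurable]: "(\<lambda>z::'a \<times> 'a. f (snd z + fst z)) \<in> borel_measurable (lborel \<Otimes>\<^sub>M lborel)"
    by (rule measurable_compose[OF borel_measurable_pair_continuous f]) (auto intro!: continuous_intros)
  have "(\<integral>\<^sup>+x. \<integral>\<^sup>+t. ennreal ((norm (shifted_product f g x t))\<^sup>2) \<partial>lborel \<partial>lborel)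
    = (\<integral>\<^sup>+x. \<integral>\<^sup>+t. ennreal ((norm (f (t + x)))\<^sup>2) * ennreal ((norm (g t))\<^sup>2) \<partial>lborel \<partial>lborel)"
  proof (rule nn_integral_cong)
    fix x :: 'a
    have "(\<integral>\<^sup>+t. ennreal ((norm (shifted_product f g x t))\<^sup>2) \<partial>lborel)
      = (\<integral>\<^sup>+t. ennreal ((norm (shifted_product f g x (x /\<^sub>R 2 + t)))\<^sup>2) \<partial>lborel)"
      by (rule nn_integral_lborel_translate[symmetric]) measurable
    then show "(\<integral>\<^sup>+t. ennreal ((norm (shifted_product f g x t))\<^sup>2) \<partial>lborel)
      = (\<integral>\<^sup>+t. ennreal ((norm (f (t + x)))\<^sup>2) * ennreal ((norm (g t))\<^sup>2) \<partial>lborel)"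
      unfolding shifted_product_translate by (simp add: norm_mult power_mult_distrib ennreal_mult)
  qed
  also have "\<dots> = (\<integral>\<^sup>+t. \<integral>\<^sup>+x. ennreal ((norm (f (t + x)))\<^sup>2) * ennreal ((norm (g t))\<^sup>2) \<partial>lborel \<partial>lborel)"
    by (rule lborel_pair.Fubini') (simp add: case_prod_beta')
  also have "\<dots> = (\<integral>\<^sup>+t. (\<integral>\<^sup>+x. ennreal ((norm (f x))\<^sup>2) \<partial>lborel) * ennreal ((norm (g t))\<^sup>2) \<partial>lborel)"
    by (simp add: nn_integral_multc nn_integral_lborel_translate[of "\<lambda>x. ennreal ((norm (f x))\<^sup>2)"])
  also have "\<dots> = (\<integral>\<^sup>+t. ennreal ((norm (f t))\<^sup>2) \<partial>lborel) * (\<integral>\<^sup>+t. ennreal ((norm (g t))\<^sup>2) \<partial>lborel)"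
    by (simp add: nn_integral_cmult)
  finally show ?thesis .
qed

lemma qamb_plancherel:
  fixes f g :: "'a::euclidean_space \<times> 'b::euclidean_space \<Rightarrow> quat"
  assumes f [measurable]: "f \<in> borel_measurable borel" and g [measurable]: "g \<in> borel_measurable borel"
    and f2: "integrable lborel (\<lambda>t. (norm (f t))\<^sup>2)" and g2: "integrable lborel (\<lambda>t. (norm (g t))\<^sup>2)"
  shows "(\<integral>\<^sup>+z. ennreal ((norm (qamb f g z))\<^sup>2) \<partial>lborel)
    = ennreal ((2 * pi) ^ DIM('a \<times> 'b) * ((LINT t|lborel. (norm (f t))\<^sup>2) * (LINT t|lborel. (norm (g t))\<^sup>2)))"
proof -
  let ?s = "\<lambda>x t. ennreal ((norm (shifted_product f g x t))\<^sup>2)"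
  have s: "(\<integral>\<^sup>+x. \<integral>\<^sup>+t. ?s x t \<partial>lborel \<partial>lborel) = ennreal ((LINT t|lborel. (norm (f t))\<^sup>2) * (LINT t|lborel. (norm (g t))\<^sup>2))"
    unfolding nn_integral_shifted_product_sq[OF f g] nn_integral_eq_integral[OF f2 AE_I2[OF zero_le_power2]]
      nn_integral_eq_integral[OF g2 AE_I2[OF zero_le_power2]]
    by (rule ennreal_mult[symmetric]) auto
  have sm: "(\<lambda>x. \<integral>\<^sup>+t. ?s x t \<partial>lborel) \<in> borel_measurable borel"
    using lborel.borel_measurable_nn_integral[of "?s" lborel] measurable_shifted_product_pair[OF f g] by (simp add: case_prod_beta')
  \<comment> \<open>The shifted product is integrable for every x, but its square integrability is
    known only for almost every x; Plancherel's theorem is used slice by slice off a null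
    set.\<close>
  have "AE x in lborel. (\<integral>\<^sup>+t. ?s x t \<partial>lborel) \<noteq> \<infinity>"
    by (rule nn_integral_PInf_AE) (use sm s in auto)
  then have inner: "AE x in lborel. (\<integral>\<^sup>+w. ennreal ((norm (qamb f g (x, w)))\<^sup>2) \<partial>lborel) = ennreal ((2 * pi) ^ DIM('a \<times> 'b)) * (\<integral>\<^sup>+t. ?s x t \<partial>lborel)"
  proof eventually_elim
    fix x assume fin: "(\<integral>\<^sup>+t. ?s x t \<partial>lborel) \<noteq> \<infinity>"
    have i2: "integrable lborel (\<lambda>t. (norm (shifted_product f g x t))\<^sup>2)"
      by (rule integrableI_nonneg) (use fin in \<open>auto simp: less_top\<close>)
    have "(\<integral>\<^sup>+t. ?s x t \<partial>lborel) = ennreal (LINT t|lborel. (norm (shifted_product f g x t))\<^sup>2)"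
      by (intro nn_integral_eq_integral i2) auto
    then show "(\<integral>\<^sup>+w. ennreal ((norm (qamb f g (x, w)))\<^sup>2) \<partial>lborel) = ennreal ((2 * pi) ^ DIM('a \<times> 'b)) * (\<integral>\<^sup>+t. ?s x t \<partial>lborel)"
      using qft_plancherel[OF measurable_shifted_product[OF f g] integrable_shifted_product[OF f g f2 g2] i2]
      by (simp only: qamb_def fst_conv snd_conv) (simp add: ennreal_mult'' del: DIM_prod)
  qed
  have "(\<integral>\<^sup>+z. ennreal ((norm (qamb f g z))\<^sup>2) \<partial>lborel) = (\<integral>\<^sup>+x. \<integral>\<^sup>+w. ennreal ((norm (qamb f g (x, w)))\<^sup>2) \<partial>lborel \<partial>lborel)"
    using measurable_qamb[OF f g] by (subst lborel_prod[symmetric], subst lborel.nn_integral_fst[symmetric]) (auto simp: lborel_prod)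
  also have "\<dots> = (\<integral>\<^sup>+x. ennreal ((2 * pi) ^ DIM('a \<times> 'b)) * (\<integral>\<^sup>+t. ?s x t \<partial>lborel) \<partial>lborel)"
    by (rule nn_integral_cong_AE[OF inner])
  also have "\<dots> = ennreal ((2 * pi) ^ DIM('a \<times> 'b)) * ennreal ((LINT t|lborel. (norm (f t))\<^sup>2) * (LINT t|lborel. (norm (g t))\<^sup>2))"
    unfolding s[symmetric] using sm by (intro nn_integral_cmult) simp
  also have "\<dots> = ennreal ((2 * pi) ^ DIM('a \<times> 'b) * ((LINT t|lborel. (norm (f t))\<^sup>2) * (LINT t|lborel. (norm (g t))\<^sup>2)))"
    by (rule ennreal_mult[symmetric]) auto
  finally show ?thesis .
qed

lemma qamb_concentration_bounded:
  fixes f g :: "'a::euclidean_space \<times> 'b::euclidean_space \<Rightarrow> quat"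
  assumes f [measurable]: "f \<in> borel_measurable borel" and g [measurable]: "g \<in> borel_measurable borel"
    and bdd: "\<And>t. norm (f t) \<le> M" "\<And>t. norm (g t) \<le> M"
    and supp: "\<And>t. norm t > R \<Longrightarrow> f t = 0" "\<And>t. norm t > R \<Longrightarrow> g t = 0"
    and U: "U \<in> sets borel" "emeasure lborel U < \<infinity>"
    and pq: "p > 2" "1 / p + 1 / q = 1"
  shows "(\<integral>\<^sup>+z. ennreal (indicator U z * (norm (qamb f g z))\<^sup>2) \<partial>lborel)
    \<le> ennreal (measure lborel U powr (1 - 2 / p) * (2 * pi) powr (2 * DIM('a \<times> 'b) / p) *
        (young_const (q / 2) ^ DIM('a \<times> 'b)) powr (2 / q) *
        ((LINT t|lborel. (norm (f t))\<^sup>2) * (LINT t|lborel. (norm (g t))\<^sup>2)))"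
proof -
  note q = conjugate_exponent_bounds[OF pq]
  let ?D = "DIM('a \<times> 'b)"
  define \<Phi> where "\<Phi> = (LINT t|lborel. (norm (f t))\<^sup>2) * (LINT t|lborel. (norm (g t))\<^sup>2)"
  have \<Phi>0: "\<Phi> \<ge> 0" unfolding \<Phi>_def by (intro mult_nonneg_nonneg integral_nonneg_AE) auto
  have M0: "M \<ge> 0" using bdd(1)[of 0] norm_ge_zero order_trans by blast
  have sqb: "(norm (f t))\<^sup>2 \<le> M\<^sup>2" "(norm (g t))\<^sup>2 \<le> M\<^sup>2" for t
    by (intro power_mono bdd norm_ge_zero)+
  have f2: "integrable lborel (\<lambda>t. (norm (f t))\<^sup>2)"
    by (rule integrable_bounded_support[of _ "M\<^sup>2" R]) (simp_all add: sqb supp)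
  have g2: "integrable lborel (\<lambda>t. (norm (g t))\<^sup>2)"
    by (rule integrable_bounded_support[of _ "M\<^sup>2" R]) (simp_all add: sqb supp)
  \<comment> \<open>The integral of |h_x|^q, rewritten through the integrable functions |f|^2 and
    |g|^2 so that \<open>young_convolution\<close> applies with \<kappa> = q/2.\<close>
  define P where "P x = (LINT t|lborel. ((norm (f (t + x)))\<^sup>2 * (norm (g t))\<^sup>2) powr (q / 2))" for x
  have hP: "integrable lborel (\<lambda>t. norm (shifted_product f g x t) powr q)"
    "(LINT t|lborel. norm (shifted_product f g x t) powr q) = P x" for x
  proof -
    let ?F = "\<lambda>t. norm (shifted_product f g x t) powr q"
    have Fm: "?F \<in> borel_measurable borel" by measurable
    have eq: "?F (x /\<^sub>R 2 + t) = ((norm (f (t + x)))\<^sup>2 * (norm (g t))\<^sup>2) powr (q / 2)" for t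
    proof -
      have "((norm (f (t + x)))\<^sup>2 * (norm (g t))\<^sup>2) powr (q / 2) = ((norm (f (t + x)) * norm (g t)) powr 2) powr (q / 2)"
        by (simp add: power_mult_distrib)
      then show ?thesis unfolding shifted_product_translate powr_powr by (simp add: norm_mult)
    qed
    show "(LINT t|lborel. ?F t) = P x"
      unfolding P_def eq[symmetric] by (rule integral_lborel_translate[OF Fm, symmetric])
    define B where "B = (M\<^sup>2 * M\<^sup>2) powr (q / 2)"
    have Mb: "((norm (f (t + x)))\<^sup>2 * (norm (g t))\<^sup>2) powr (q / 2) \<le> B" for t
      unfolding B_def using q by (intro powr_mono2 mult_mono sqb) auto
    have "integrable lborel (\<lambda>t. ?F (x /\<^sub>R 2 + t))" unfolding eq
      by (rule integrable_bounded_support[of _ B R]) (simp_all add: Mb supp)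
    from integrable_lborel_translate[OF this, of "- (x /\<^sub>R 2)"] show "integrable lborel ?F" by simp
  qed
  have P0: "P x \<ge> 0" for x unfolding P_def by (intro integral_nonneg_AE) auto
  have ff: "(\<lambda>z::('a \<times> 'b) \<times> ('a \<times> 'b). f (snd z + fst z)) \<in> borel_measurable (lborel \<Otimes>\<^sub>M lborel)"
    by (rule measurable_compose[OF borel_measurable_pair_continuous f]) (auto intro!: continuous_intros)
  have Pm [measurable]: "P \<in> borel_measurable borel"
    unfolding P_def[abs_def]
    by (intro lborel.borel_measurable_lebesgue_integral) (use ff in \<open>simp add: case_prod_beta'\<close>)
  \<comment> \<open>Because q - 1 = q/p, this is the exponent 1/(2\<kappa> - 1) of
    \<open>young_convolution\<close> at \<kappa> = q/2.\<close>
  define r where "r = p / q"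
  have r: "r > 0" "1 / (2 * (q / 2) - 1) = r" using pq q by (auto simp: r_def)
  define Y where "Y = (young_const (q / 2) ^ ?D * \<Phi> powr (q / 2)) powr r"
  have young: "(\<integral>\<^sup>+x. ennreal (P x powr r) \<partial>lborel) \<le> ennreal Y"
    unfolding P_def Y_def \<Phi>_def r(2)[symmetric]
    by (rule young_convolution[of "q/2" "\<lambda>t. (norm (f t))\<^sup>2" "\<lambda>t. (norm (g t))\<^sup>2" "M\<^sup>2" R])
       (use q in \<open>simp_all add: sqb supp\<close>)
  have Pi: "integrable lborel (\<lambda>x. P x powr r)"
    by (rule integrableI_nonneg) (use le_less_trans[OF young] in auto)
  have PI: "(LINT x|lborel. P x powr r) \<le> Y"
  proof -
    have "ennreal (LINT x|lborel. P x powr r) \<le> ennreal Y"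
      using young by (subst nn_integral_eq_integral[OF Pi, symmetric]) auto
    then show ?thesis by (simp add: Y_def ennreal_le_iff)
  qed
  have U': "U \<in> sets (lborel \<Otimes>\<^sub>M lborel)" using U(1) by (simp only: lborel_prod sets_lborel)
  define S where "S x = Pair x -` U" for x
  have S [measurable]: "S x \<in> sets borel" for x using sets_Pair1[OF U', of x] by (simp add: S_def)
  have Sm: "(\<lambda>x. emeasure lborel (S x)) \<in> borel_measurable borel"
    using lborel.measurable_emeasure_Pair[OF U'] by (simp add: S_def)
  have SU: "emeasure lborel U = (\<integral>\<^sup>+x. emeasure lborel (S x) \<partial>lborel)"
    using lborel.emeasure_pair_measure_alt[OF U'] by (simp add: S_def lborel_prod)
  \<comment> \<open>Slices of a set of finite measure can have infinite measure, but only over a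
    null set of x; elsewhere the local bound is available.\<close>
  have Sfin: "AE x in lborel. emeasure lborel (S x) \<noteq> \<infinity>"
    by (rule nn_integral_PInf_AE) (use Sm SU U(2) in auto)
  define m where "m x = measure lborel (S x)" for x
  have [measurable]: "m \<in> borel_measurable borel" unfolding m_def[abs_def] measure_def using Sm by simp
  have m_nn: "(\<integral>\<^sup>+x. ennreal (m x) \<partial>lborel) = emeasure lborel U"
    unfolding SU by (rule nn_integral_cong_AE, use Sfin in eventually_elim) (simp add: m_def emeasure_eq_ennreal_measure)
  have mi: "integrable lborel m"
    by (rule integrableI_nonneg) (use m_nn U(2) in \<open>auto simp: m_def\<close>)
  have mI: "integral\<^sup>L lborel m = measure lborel U"
  proof -
    have "ennreal (integral\<^sup>L lborel m) = emeasure lborel U"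
      using nn_integral_eq_integral[OF mi] m_nn by (simp add: m_def)
    then show ?thesis using mi by (simp add: measure_def m_def flip: \<open>ennreal (integral\<^sup>L lborel m) = emeasure lborel U\<close>)
  qed
  define c where "c = (2 * pi) powr (2 * ?D / p)"
  have c0: "c \<ge> 0" by (simp add: c_def)
  have "(\<integral>\<^sup>+z. ennreal (indicator U z * (norm (qamb f g z))\<^sup>2) \<partial>lborel)
     = (\<integral>\<^sup>+x. \<integral>\<^sup>+w. ennreal (indicator (S x) w * (norm (qft (shifted_product f g x) w))\<^sup>2) \<partial>lborel \<partial>lborel)"
  proof -
    have meas: "(\<lambda>z. ennreal (indicator U z * (norm (qamb f g z))\<^sup>2)) \<in> borel_measurable (lborel \<Otimes>\<^sub>M lborel)"
      using U(1) measurable_qamb[OF f g] by (simp add: lborel_prod)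
    have "(\<integral>\<^sup>+z. ennreal (indicator U z * (norm (qamb f g z))\<^sup>2) \<partial>lborel)
      = (\<integral>\<^sup>+x. \<integral>\<^sup>+w. ennreal (indicator U (x, w) * (norm (qamb f g (x, w)))\<^sup>2) \<partial>lborel \<partial>lborel)"
      using lborel.nn_integral_fst[OF meas] by (simp add: lborel_prod)
    then show ?thesis by (simp add: qamb_def S_def indicator_def)
  qed
  \<comment> \<open>As r (2/p) = 2/q, the local bound is a product of the integrable functions
    \<open>P x powr r\<close> and \<open>m x\<close> to the powers 2/p and 1 - 2/p, whose sum is 1:
    the shape that Hoelder's inequality asks for.\<close>
  also have "\<dots> \<le> (\<integral>\<^sup>+x. ennreal c * ennreal ((P x powr r) powr (2 / p) * m x powr (1 - 2 / p)) \<partial>lborel)"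
  proof (rule nn_integral_mono_AE, use Sfin in eventually_elim)
    fix x assume fin: "emeasure lborel (S x) \<noteq> \<infinity>"
    have "(\<integral>\<^sup>+w. ennreal (indicator (S x) w * (norm (qft (shifted_product f g x) w))\<^sup>2) \<partial>lborel)
      \<le> ennreal (measure lborel (S x) powr (1 - 2 / p) * c * (LINT t|lborel. norm (shifted_product f g x t) powr q) powr (2 / q))"
      unfolding c_def
      by (rule qft_local_uncertainty[OF measurable_shifted_product[OF f g] integrable_shifted_product[OF f g f2 g2] hP(1) pq S])
         (use fin in \<open>simp add: less_top\<close>)
    also have "\<dots> = ennreal (c * ((P x powr r) powr (2 / p) * m x powr (1 - 2 / p)))"
    proof -
      have "r * (2 / p) = 2 / q" using pq by (simp add: r_def)
      then show ?thesis unfolding hP(2) by (simp add: m_def powr_powr mult_ac)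
    qed
    also have "\<dots> = ennreal c * ennreal ((P x powr r) powr (2 / p) * m x powr (1 - 2 / p))"
      using c0 by (rule ennreal_mult') 
    finally show "(\<integral>\<^sup>+w. ennreal (indicator (S x) w * (norm (qft (shifted_product f g x) w))\<^sup>2) \<partial>lborel)
      \<le> ennreal c * ennreal ((P x powr r) powr (2 / p) * m x powr (1 - 2 / p))" .
  qed
  also have "\<dots> = ennreal c * (\<integral>\<^sup>+x. ennreal ((P x powr r) powr (2 / p) * m x powr (1 - 2 / p)) \<partial>lborel)"
    by (rule nn_integral_cmult) measurable
  also have "\<dots> \<le> ennreal c * ennreal ((LINT x|lborel. P x powr r) powr (2 / p) * integral\<^sup>L lborel m powr (1 - 2 / p))"
    by (intro mult_left_mono nn_integral_Holder Pi mi) (use pq in \<open>auto simp: m_def\<close>)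
  also have "\<dots> \<le> ennreal c * ennreal (Y powr (2 / p) * measure lborel U powr (1 - 2 / p))"
    unfolding mI using PI pq
    by (intro mult_left_mono ennreal_leI mult_right_mono powr_mono2) (auto intro!: integral_nonneg_AE)
  also have "\<dots> = ennreal (c * (Y powr (2 / p) * measure lborel U powr (1 - 2 / p)))"
    using c0 by (simp add: ennreal_mult')
  \<comment> \<open>The energies enter Young's bound to the power \<kappa> = q/2 and the outer
    exponents combine to 2/q, so \<open>\<Phi>\<close> emerges to the first power and can later be
    cancelled against the total energy.\<close>
  also have "Y powr (2 / p) = (young_const (q / 2) ^ ?D) powr (2 / q) * \<Phi>"
  proof -
    have e: "r * (2 / p) = 2 / q" "q / 2 * (2 / q) = 1" using pq q by (auto simp: r_def)
    have "Y powr (2 / p) = (young_const (q / 2) ^ ?D * \<Phi> powr (q / 2)) powr (2 / q)"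
      by (simp only: Y_def powr_powr e)
    also have "\<dots> = (young_const (q / 2) ^ ?D) powr (2 / q) * \<Phi> powr (q / 2 * (2 / q))"
      by (simp only: powr_powr powr_mult)
    also have "\<Phi> powr (q / 2 * (2 / q)) = \<Phi>" unfolding e using \<Phi>0 by simp
    finally show ?thesis .
  qed
  also have "c * ((young_const (q / 2) ^ ?D) powr (2 / q) * \<Phi> * measure lborel U powr (1 - 2 / p))
     = measure lborel U powr (1 - 2 / p) * c * (young_const (q / 2) ^ ?D) powr (2 / q) * \<Phi>"
    by (simp only: mult_ac)
  finally show ?thesis unfolding c_def \<Phi>_def .
qed

text \<open>Compared through logarithms: at \<kappa> = q/2 the base 2\<kappa> - 1 is q - 1 = q/p,
  and with 1/p = 1 - 1/q both sides become the same combination of ln 2, ln p and ln q. The power 2d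
  is the dimension of the space on which f and g live.\<close>

lemma young_const_C_const:
  assumes "p > 2" "1 / p + 1 / q = 1"
  shows "(young_const (q / 2) ^ (2 * d)) powr (2 / q) = (C_const d p q)\<^sup>2"
proof -
  note q = conjugate_exponent_bounds[OF assms]
  have p: "1 / p = 1 - 1 / q" using assms by simp
  have pos: "young_const (q / 2) > 0" "C_const d p q > 0"
    using q assms by (simp_all add: young_const_def C_const_def)
  have lnq1: "ln (q - 1) = ln q - ln p" using q assms by (simp add: ln_div)
  have ln4: "ln 4 = 2 * ln (2::real)" using ln_realpow[of 2 2] by simp
  have y: "ln (young_const (q / 2)) = (q / 2 - 1/2) * (ln q - ln p) + (q / 2 - 1) * ln 2 - q / 2 * (ln q - ln 2)"
    using q by (simp add: young_const_def ln_mult ln_powr ln_div lnq1 algebra_simps)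
  have c: "ln (C_const d p q) = real d * ((1 / p) * (2 * ln 2 - ln p) - (1 / q) * ln q)"
    using q assms by (simp add: C_const_def ln_mult ln_powr ln_div ln4 algebra_simps)
  have "ln ((young_const (q / 2) ^ (2 * d)) powr (2 / q)) = 2 / q * (2 * real d) * ln (young_const (q / 2))"
    using pos by (simp add: ln_powr ln_realpow)
  also have "\<dots> = 2 * ln (C_const d p q)"
    unfolding y c p using q by (simp add: field_simps)
  also have "\<dots> = ln ((C_const d p q)\<^sup>2)" using pos by (simp add: ln_realpow)
  finally show ?thesis using pos by (subst (asm) ln_inj_iff) auto
qed

lemma qamb_truncation_tendsto:
  fixes f g :: "'a::euclidean_space \<times> 'b::euclidean_space \<Rightarrow> quat"
  assumes f [measurable]: "f \<in> borel_measurable borel" and g [measurable]: "g \<in> borel_measurable borel"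
    and f2: "integrable lborel (\<lambda>t. (norm (f t))\<^sup>2)" and g2: "integrable lborel (\<lambda>t. (norm (g t))\<^sup>2)"
  shows "(\<lambda>k. qamb (truncation k f) (truncation k g) z) \<longlonglongrightarrow> qamb f g z"
  unfolding qamb_def qft_def
proof (rule integral_dominated_convergence[where w="\<lambda>t. norm (shifted_product f g (fst z) t)"])
  let ?x = "fst z" and ?w = "snd z"
  have m: "(\<lambda>t. qker t ?w (h t)) \<in> borel_measurable lborel"
    if [measurable]: "h \<in> borel_measurable borel" for h :: "'a \<times> 'b \<Rightarrow> quat"
  proof -
    have [measurable]: "(\<lambda>t::'a \<times> 'b. fst t \<bullet> fst ?w) \<in> borel_measurable borel"
      "(\<lambda>t::'a \<times> 'b. snd t \<bullet> snd ?w) \<in> borel_measurable borel"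
      by (intro borel_measurable_continuous_onI continuous_intros)+
    show ?thesis by measurable
  qed
  show "(\<lambda>t. qker t ?w (shifted_product f g ?x t)) \<in> borel_measurable lborel"
    by (rule m) measurable
  show "(\<lambda>t. qker t ?w (shifted_product (truncation k f) (truncation k g) ?x t)) \<in> borel_measurable lborel" for k
    by (rule m) measurable
  show "integrable lborel (\<lambda>t. norm (shifted_product f g ?x t))"
    by (intro integrable_norm integrable_shifted_product f g f2 g2)
  show "AE t in lborel. (\<lambda>k. qker t ?w (shifted_product (truncation k f) (truncation k g) ?x t))
      \<longlonglongrightarrow> qker t ?w (shifted_product f g ?x t)"
  proof (rule AE_I2, rule tendsto_eventually)
    fix t
    show "\<forall>\<^sub>F k in sequentially. qker t ?w (shifted_product (truncation k f) (truncation k g) ?x t)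
      = qker t ?w (shifted_product f g ?x t)"
      using eventually_truncation[of f "t + ?x /\<^sub>R 2"] eventually_truncation[of g "t - ?x /\<^sub>R 2"]
      by eventually_elim (simp only: shifted_product_def)
  qed
  show "AE t in lborel. norm (qker t ?w (shifted_product (truncation k f) (truncation k g) ?x t))
      \<le> norm (shifted_product f g ?x t)" for k
    unfolding norm_qrot norm_shifted_product
    by (intro AE_I2 mult_mono norm_truncation_le) auto
qed

text \<open>Truncation does not increase the L2 norms, so one bound serves all truncations; the
  transforms converge at every point, and Fatou's lemma concludes.\<close>

theorem qamb_concentration:
  fixes f g :: "'a::euclidean_space \<times> 'b::euclidean_space \<Rightarrow> quat"
  assumes f [measurable]: "f \<in> borel_measurable borel" and g [measurable]: "g \<in> borel_measurable borel"
    and f2: "integrable lborel (\<lambda>t. (norm (f t))\<^sup>2)" and g2: "integrable lborel (\<lambda>t. (norm (g t))\<^sup>2)"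
    and U: "U \<in> sets borel" "emeasure lborel U < \<infinity>"
    and pq: "p > 2" "1 / p + 1 / q = 1"
  shows "(\<integral>\<^sup>+z. ennreal (indicator U z * (norm (qamb f g z))\<^sup>2) \<partial>lborel)
    \<le> ennreal (measure lborel U powr (1 - 2 / p) * (2 * pi) powr (2 * DIM('a \<times> 'b) / p) *
        (young_const (q / 2) ^ DIM('a \<times> 'b)) powr (2 / q) *
        ((LINT t|lborel. (norm (f t))\<^sup>2) * (LINT t|lborel. (norm (g t))\<^sup>2)))"
    (is "_ \<le> ennreal (?c * (?F * ?G))")
proof -
  let ?f = "\<lambda>k. truncation k f" and ?g = "\<lambda>k. truncation k g"
  have mono: "(LINT t|lborel. (norm (truncation k h t))\<^sup>2) \<le> (LINT t|lborel. (norm (h t))\<^sup>2)"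
    if "integrable lborel (\<lambda>t. (norm (h t))\<^sup>2)" for k and h :: "'a \<times> 'b \<Rightarrow> quat"
    by (rule integral_mono'[OF that]) (auto intro!: power_mono norm_truncation_le)
  have c0: "?c \<ge> 0" by (intro mult_nonneg_nonneg) auto
  have "(\<integral>\<^sup>+z. ennreal (indicator U z * (norm (qamb f g z))\<^sup>2) \<partial>lborel)
    = (\<integral>\<^sup>+z. liminf (\<lambda>k. ennreal (indicator U z * (norm (qamb (?f k) (?g k) z))\<^sup>2)) \<partial>lborel)"
  proof (rule nn_integral_cong)
    fix z
    have "(\<lambda>k. ennreal (indicator U z * (norm (qamb (?f k) (?g k) z))\<^sup>2)) \<longlonglongrightarrow> ennreal (indicator U z * (norm (qamb f g z))\<^sup>2)"
      by (intro tendsto_ennrealI tendsto_intros qamb_truncation_tendsto f g f2 g2)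
    from lim_imp_Liminf[OF _ this]
    show "ennreal (indicator U z * (norm (qamb f g z))\<^sup>2) = liminf (\<lambda>k. ennreal (indicator U z * (norm (qamb (?f k) (?g k) z))\<^sup>2))"
      by simp
  qed
  also have "\<dots> \<le> liminf (\<lambda>k. \<integral>\<^sup>+z. ennreal (indicator U z * (norm (qamb (?f k) (?g k) z))\<^sup>2) \<partial>lborel)"
  proof (rule nn_integral_liminf)
    fix k
    have "qamb (?f k) (?g k) \<in> borel_measurable borel" by (intro measurable_qamb measurable_truncation f g)
    then show "(\<lambda>z. ennreal (indicator U z * (norm (qamb (?f k) (?g k) z))\<^sup>2)) \<in> borel_measurable lborel"
      using U(1) by simp
  qed
  also have "\<dots> \<le> liminf (\<lambda>k. ennreal (?c * (?F * ?G)))"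
  proof (intro Liminf_mono always_eventually allI)
    fix k
    have "(\<integral>\<^sup>+z. ennreal (indicator U z * (norm (qamb (?f k) (?g k) z))\<^sup>2) \<partial>lborel)
      \<le> ennreal (?c * ((LINT t|lborel. (norm (?f k t))\<^sup>2) * (LINT t|lborel. (norm (?g k t))\<^sup>2)))"
      by (rule qamb_concentration_bounded[OF measurable_truncation[OF f] measurable_truncation[OF g]
            norm_truncation_le(2) norm_truncation_le(2) truncation_outside truncation_outside U pq])
    also have "\<dots> \<le> ennreal (?c * (?F * ?G))"
      by (intro ennreal_leI mult_left_mono mult_mono mono f2 g2 c0 integral_nonneg_AE) auto
    finally show "(\<integral>\<^sup>+z. ennreal (indicator U z * (norm (qamb (?f k) (?g k) z))\<^sup>2) \<partial>lborel) \<le> ennreal (?c * (?F * ?G))" .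
  qed
  also have "\<dots> = ennreal (?c * (?F * ?G))" by (simp add: Liminf_const)
  finally show ?thesis .
qed

section \<open>The normalised measure and Borel representatives\<close>

definition mu_const :: "'a::euclidean_space itself \<Rightarrow> real" where
  "mu_const _ = 1 / (2 * pi) powr (real DIM('a) / 2)"

lemma mu_const_pos: "mu_const TYPE('a::euclidean_space) > 0"
  by (simp add: mu_const_def)

lemma mu_eq: "(mu :: 'a measure) = density lebesgue (\<lambda>_. ennreal (mu_const TYPE('a::euclidean_space)))"
  by (simp add: mu_def mu_const_def)

lemma lebesgue_measurable_AE_eq:
  fixes F G :: "'a::euclidean_space \<Rightarrow> 'b::topological_space"
  assumes G: "G \<in> borel_measurable borel" and ae: "AE x in lborel. F x = G x"
  shows "F \<in> borel_measurable lebesgue"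
proof (rule measurableI)
  fix S :: "'b set" assume S: "S \<in> sets borel"
  have G': "G \<in> borel_measurable lebesgue" using G by (intro measurable_completion) simp
  show "F -` S \<inter> space lebesgue \<in> sets lebesgue"
  proof (rule completion.in_sets_AE)
    show "AE x in lebesgue. (x \<in> G -` S \<inter> space lebesgue) = (x \<in> F -` S \<inter> space lebesgue)"
      unfolding AE_completion_iff using ae by eventually_elim auto
  qed (use measurable_sets[OF G' S] in auto)
qed auto

text \<open>The analysis uses Borel functions and \<open>lborel\<close>, whereas \<open>mu\<close>
  lives on the Lebesgue sigma-algebra. By completeness, a function that agrees almost everywhere
  with a Borel one is Lebesgue measurable, so only the constant separates the two integrals.\<close>

lemma integral_mu:
  fixes F G :: "'a::euclidean_space \<Rightarrow> 'b::{banach, second_countable_topology}"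
  assumes G: "G \<in> borel_measurable borel" and ae: "AE x in lborel. F x = G x"
  shows "integral\<^sup>L mu F = mu_const TYPE('a) *\<^sub>R integral\<^sup>L lborel G"
    and "integrable mu F \<longleftrightarrow> integrable lborel G"
proof -
  have F: "F \<in> borel_measurable lebesgue" by (rule lebesgue_measurable_AE_eq[OF G ae])
  have G': "G \<in> borel_measurable lebesgue" using G by (intro measurable_completion) simp
  have ae': "AE x in lebesgue. F x = G x" using ae by (simp add: AE_completion_iff)
  have c: "AE x in lebesgue. 0 \<le> mu_const TYPE('a)" using mu_const_pos[where 'a='a] by simp
  have "integral\<^sup>L mu F = (LINT x|lebesgue. mu_const TYPE('a) *\<^sub>R F x)"
    unfolding mu_eq by (rule integral_density[OF F _ c]) simp
  also have "\<dots> = mu_const TYPE('a) *\<^sub>R integral\<^sup>L lebesgue F" by simp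
  also have "integral\<^sup>L lebesgue F = integral\<^sup>L lebesgue G" by (rule integral_cong_AE[OF F G' ae'])
  also have "\<dots> = integral\<^sup>L lborel G" using G by (intro integral_completion) simp
  finally show "integral\<^sup>L mu F = mu_const TYPE('a) *\<^sub>R integral\<^sup>L lborel G" .
  have "integrable mu F \<longleftrightarrow> integrable lebesgue (\<lambda>x. mu_const TYPE('a) *\<^sub>R F x)"
    unfolding mu_eq by (rule integrable_density[OF F _ c]) simp
  also have "\<dots> \<longleftrightarrow> integrable lebesgue F"
  proof
    assume i: "integrable lebesgue (\<lambda>x. mu_const TYPE('a) *\<^sub>R F x)"
    have "integrable lebesgue (\<lambda>x. (1 / mu_const TYPE('a)) *\<^sub>R (mu_const TYPE('a) *\<^sub>R F x))"
      by (intro integrable_scaleR_right i)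
    then show "integrable lebesgue F" using mu_const_pos[where 'a='a] by (simp add: less_imp_neq[symmetric])
  qed (rule integrable_scaleR_right)
  also have "\<dots> \<longleftrightarrow> integrable lebesgue G" by (rule integrable_cong_AE[OF F G' ae'])
  also have "\<dots> \<longleftrightarrow> integrable lborel G" using G by (intro integrable_completion) simp
  finally show "integrable mu F \<longleftrightarrow> integrable lborel G" .
qed

text \<open>A Lebesgue measurable function is a limit of continuous ones off a negligible set.
  Enlarging that set to a Borel null set and putting the value 0 there gives a limit of Borel
  functions at every point.\<close>

lemma borel_representative:
  fixes f :: "'a::euclidean_space \<Rightarrow> 'b::euclidean_space"
  assumes "f \<in> borel_measurable lebesgue"
  obtains f' where "f' \<in> borel_measurable borel" "AE x in lborel. f x = f' x"
proof -
  have "f measurable_on UNIV" using assms by (intro lebesgue_measurable_imp_measurable_on) auto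
  then obtain N g where N: "negligible N" and g: "\<And>n. continuous_on UNIV (g n)"
    and lim: "\<And>x. x \<notin> N \<Longrightarrow> (\<lambda>n. g n x) \<longlonglongrightarrow> f x"
    unfolding measurable_on_def by auto
  obtain N' where N': "N' \<in> null_sets lborel" "N \<subseteq> N'"
    using N by (auto simp: negligible_iff_null_sets null_sets_completion_iff2)
  have N'b [measurable]: "N' \<in> sets borel" using N'(1) by (auto dest: null_setsD2)
  show ?thesis
  proof (rule that[of "\<lambda>x. if x \<in> N' then 0 else f x"])
    show "(\<lambda>x. if x \<in> N' then 0 else f x) \<in> borel_measurable borel"
    proof (rule borel_measurable_LIMSEQ_metric)
      have [measurable]: "g n \<in> borel_measurable borel" for n using g by (rule borel_measurable_continuous_onI)
      show "(\<lambda>x. if x \<in> N' then 0 else g n x) \<in> borel_measurable borel" for n by measurable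
      show "(\<lambda>n. if x \<in> N' then 0 else g n x) \<longlonglongrightarrow> (if x \<in> N' then 0 else f x)" for x
        using lim[of x] N'(2) by auto
    qed
    show "AE x in lborel. f x = (if x \<in> N' then 0 else f x)"
      using AE_not_in[OF N'(1)] by eventually_elim auto
  qed
qed

text \<open>The predicate may be non-measurable, so its exceptional set is first covered by a Borel
  null set, and this set is what is translated.\<close>

lemma AE_lborel_translate:
  fixes c :: "'a::euclidean_space"
  assumes "AE x in lborel. P x"
  shows "AE x in lborel. P (x + c)"
proof -
  from assms obtain N where N: "{x \<in> space lborel. \<not> P x} \<subseteq> N" "emeasure lborel N = 0" "N \<in> sets lborel"
    by (rule AE_E)
  have Nb [measurable]: "N \<in> sets borel" using N(3) by simp
  have "AE x in lborel. x \<notin> N" using N by (intro AE_not_in) (auto simp: null_sets_def)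
  then have "AE x in distr lborel borel ((+) c). x \<notin> N" by (simp only: lborel_distr_plus)
  then have "AE x in lborel. c + x \<notin> N" by (subst (asm) AE_distr_iff) auto
  then show ?thesis by eventually_elim (use N(1) in \<open>auto simp: add.commute\<close>)
qed

text \<open>The equality holds at every \<open>z\<close>: for fixed \<open>z\<close>, changing
  \<open>f\<close> and \<open>g\<close> on null sets changes the integrand only on a null set of
  \<open>t\<close>.\<close>

lemma ambiguity_eq_qamb:
  fixes f g f' g' :: "(real ^ 'd) \<times> (real ^ 'd) \<Rightarrow> quat"
  assumes f': "f' \<in> borel_measurable borel" "AE t in lborel. f t = f' t"
    and g': "g' \<in> borel_measurable borel" "AE t in lborel. g t = g' t"
  shows "ambiguity f g z = mu_const TYPE((real ^ 'd) \<times> (real ^ 'd)) *\<^sub>R qamb f' g' z"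
proof -
  obtain x w where z: "z = (x, w)" by (cases z)
  let ?G = "\<lambda>t. qker t w (shifted_product f' g' x t)"
  have Gm: "?G \<in> borel_measurable borel"
  proof -
    have [measurable]: "(\<lambda>t::(real ^ 'd) \<times> (real ^ 'd). fst t \<bullet> fst w) \<in> borel_measurable borel"
      "(\<lambda>t::(real ^ 'd) \<times> (real ^ 'd). snd t \<bullet> snd w) \<in> borel_measurable borel"
      by (intro borel_measurable_continuous_onI continuous_intros)+
    note f'(1) [measurable] g'(1) [measurable]
    show ?thesis by measurable
  qed
  have ae: "AE t in lborel. exp (- ((fst t \<bullet> fst w) *\<^sub>R quat_i)) * f (t + x /\<^sub>R 2) * qcnj (g (t - x /\<^sub>R 2)) *
     exp (- ((snd t \<bullet> snd w) *\<^sub>R quat_j)) = ?G t"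
    using AE_lborel_translate[OF f'(2), of "x /\<^sub>R 2"] AE_lborel_translate[OF g'(2), of "- (x /\<^sub>R 2)"]
    by eventually_elim (simp add: qrot_def shifted_product_def mult.assoc)
  show ?thesis
    unfolding z ambiguity_def qamb_def qft_def prod.case fst_conv snd_conv
    by (rule integral_mu(1)[OF Gm ae])
qed

text \<open>The Plancherel factor (2 pi)^n is cancelled by the squared normalisation of the integral
  that defines the ambiguity function, and equally by the normalisation of the measure in dimension
  2n.\<close>

lemma mu_const_sq: "(mu_const TYPE('a::euclidean_space))\<^sup>2 * (2 * pi) ^ DIM('a) = 1"
  "mu_const TYPE('a \<times> 'a) * (2 * pi) ^ DIM('a) = 1"
proof -
  have e: "(2 * pi) powr (real DIM('a) / 2) * (2 * pi) powr (real DIM('a) / 2) = (2 * pi) ^ DIM('a)"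
    by (simp flip: powr_add) (simp add: powr_realpow)
  have "(2 * pi) powr (real DIM('a \<times> 'a) / 2) = (2 * pi) ^ DIM('a)"
    by (simp add: powr_realpow)
  then show "mu_const TYPE('a \<times> 'a) * (2 * pi) ^ DIM('a) = 1" by (simp add: mu_const_def)
  show "(mu_const TYPE('a))\<^sup>2 * (2 * pi) ^ DIM('a) = 1"
    unfolding mu_const_def power2_eq_square e[symmetric] by simp
qed

theorem corollary3:
  fixes f g :: "(real ^ 'd) \<times> (real ^ 'd) \<Rightarrow> quat"
    and U :: "(((real ^ 'd) \<times> (real ^ 'd)) \<times> ((real ^ 'd) \<times> (real ^ 'd))) set"
    and \<epsilon> p q :: real
  assumes "f \<in> L2" and "g \<in> L2"
    and "\<not> (AE t in lebesgue. f t = 0)" and "\<not> (AE t in lebesgue. g t = 0)"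
    and "U \<in> sets lebesgue"
    and "\<epsilon> \<ge> 0"
    and "concentrated \<epsilon> U (ambiguity f g)"
    and "p > 2" and "1 / p + 1 / q = 1"
  shows "emeasure mu U \<ge>
    ennreal (max 0 (1 - \<epsilon>\<^sup>2) powr (p / (p - 2)) * C_const CARD('d) p q powr (2 * p / (2 - p)))"
proof (cases "\<epsilon> < 1 \<and> emeasure mu U < \<infinity>")
  \<comment> \<open>For \<epsilon> >= 1 the base, and with it the bound, is 0; an infinite measure
    exceeds every real bound.\<close>
  case False
  then consider "\<epsilon> \<ge> 1" | "emeasure mu U = \<infinity>" by (auto simp: less_top[symmetric] not_less)
  then show ?thesis
  proof cases
    case 1
    then have "1 - \<epsilon>\<^sup>2 \<le> 0" by (simp add: one_le_power)
    then show ?thesis by (simp add: max_absorb1)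
  next
    case 2
    then show ?thesis by simp
  qed
next
  case True
  then have eps: "\<epsilon> < 1" and Ufin: "emeasure mu U < \<infinity>" by auto
  let ?E = "TYPE((real ^ 'd) \<times> (real ^ 'd))" and ?EE = "TYPE(((real ^ 'd) \<times> (real ^ 'd)) \<times> ((real ^ 'd) \<times> (real ^ 'd)))"
  let ?n = "DIM((real ^ 'd) \<times> (real ^ 'd))"
  obtain f' where f': "f' \<in> borel_measurable borel" "AE t in lborel. f t = f' t"
    using borel_representative[of f] assms(1) by (auto simp: L2_def)
  obtain g' where g': "g' \<in> borel_measurable borel" "AE t in lborel. g t = g' t"
    using borel_representative[of g] assms(2) by (auto simp: L2_def)
  have sq: "integrable lborel (\<lambda>t. (norm (h' t))\<^sup>2) \<and> (LINT t|lborel. (norm (h' t))\<^sup>2) > 0"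
    if h: "h \<in> L2" "\<not> (AE t in lebesgue. h t = 0)" and h': "h' \<in> borel_measurable borel" "AE t in lborel. h t = h' t"
    for h h' :: "(real ^ 'd) \<times> (real ^ 'd) \<Rightarrow> quat"
  proof -
    have m: "(\<lambda>t. (norm (h' t))\<^sup>2) \<in> borel_measurable borel" using h'(1) by measurable
    have ae: "AE t in lborel. (norm (h t))\<^sup>2 = (norm (h' t))\<^sup>2" using h'(2) by eventually_elim simp
    have i: "integrable lborel (\<lambda>t. (norm (h' t))\<^sup>2)"
      using integral_mu(2)[OF m ae] h(1) by (simp add: L2_def)
    have "(LINT t|lborel. (norm (h' t))\<^sup>2) \<noteq> 0"
    proof
      assume "(LINT t|lborel. (norm (h' t))\<^sup>2) = 0"
      then have "AE t in lborel. (norm (h' t))\<^sup>2 = 0" using i by (subst (asm) integral_nonneg_eq_0_iff_AE) auto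
      then have "AE t in lborel. h t = 0" using h'(2) by eventually_elim simp
      then show False using h(2) by (simp add: AE_completion_iff)
    qed
    moreover have "(LINT t|lborel. (norm (h' t))\<^sup>2) \<ge> 0" by (intro integral_nonneg_AE) auto
    ultimately show ?thesis using i by linarith
  qed
  note f2 = conjunct1[OF sq[OF assms(1,3) f']] and g2 = conjunct1[OF sq[OF assms(2,4) g']]
  define \<Phi> where "\<Phi> = (LINT t|lborel. (norm (f' t))\<^sup>2) * (LINT t|lborel. (norm (g' t))\<^sup>2)"
  have \<Phi>: "\<Phi> > 0"
    unfolding \<Phi>_def using sq[OF assms(1,3) f'] sq[OF assms(2,4) g'] by (intro mult_pos_pos) auto
  define B where "B z = (norm (qamb f' g' z))\<^sup>2" for z
  have Bm [measurable]: "B \<in> borel_measurable borel"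
    unfolding B_def[abs_def] using measurable_qamb[OF f'(1) g'(1)] by measurable
  have B0: "B z \<ge> 0" for z by (simp add: B_def)
  have Bnn: "(\<integral>\<^sup>+z. ennreal (B z) \<partial>lborel) = ennreal ((2 * pi) ^ ?n * \<Phi>)"
    unfolding B_def \<Phi>_def by (rule qamb_plancherel[OF f'(1) g'(1) f2 g2])
  have Bi: "integrable lborel B" by (rule integrableI_nonneg) (use B0 Bnn in auto)
  have BI: "integral\<^sup>L lborel B = (2 * pi) ^ ?n * \<Phi>"
    using nn_integral_eq_integral[OF Bi] Bnn B0 \<Phi> by (simp add: ennreal_inj integral_nonneg_AE del: DIM_prod)
  \<comment> \<open>The main part of \<open>U\<close> is a Borel set that agrees with it up to a
    null set and has the same measure, so energies inside and outside \<open>U\<close> can be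
    computed with it.\<close>
  obtain U' where U': "U' \<in> sets borel" "AE z in lborel. z \<in> U \<longleftrightarrow> z \<in> U'" "emeasure lborel U' = emeasure lebesgue U"
  proof (rule that[of "main_part lborel U"])
    show "main_part lborel U \<in> sets borel" using main_part_sets[OF assms(5)] by simp
    show "AE z in lborel. z \<in> U \<longleftrightarrow> z \<in> main_part lborel U" using AE_in_main_part[OF assms(5)] by (simp add: eq_commute)
    show "emeasure lborel (main_part lborel U) = emeasure lebesgue U" using emeasure_completion[OF assms(5)] by simp
  qed
  note U'(1) [measurable]
  define c where "c = mu_const ?E"
  define c2 where "c2 = mu_const ?EE"
  have c: "c > 0" "c2 > 0" "c\<^sup>2 * (2 * pi) ^ ?n = 1" "c2 * (2 * pi) ^ ?n = 1"
    unfolding c_def c2_def by (rule mu_const_pos mu_const_sq)+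
  have A: "(norm (ambiguity f g z))\<^sup>2 = c\<^sup>2 * B z" for z
    using c by (simp add: ambiguity_eq_qamb[OF f' g'] B_def c_def power_mult_distrib)
  have total: "(norm2 (ambiguity f g))\<^sup>2 = c2 * (c\<^sup>2 * integral\<^sup>L lborel B)"
  proof -
    have "(LINT z|mu. (norm (ambiguity f g z))\<^sup>2) = c2 *\<^sub>R (LINT z|lborel. c\<^sup>2 * B z)"
      unfolding A c2_def by (rule integral_mu(1)) auto
    moreover have "(LINT z|mu. (norm (ambiguity f g z))\<^sup>2) \<ge> 0" by (intro integral_nonneg_AE) auto
    ultimately show ?thesis by (simp add: norm2_def)
  qed
  have outside: "(LINT z:-U|mu. (norm (ambiguity f g z))\<^sup>2) = c2 * (c\<^sup>2 * (LINT z|lborel. indicator (-U') z * B z))"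
  proof -
    have "(LINT z:-U|mu. (norm (ambiguity f g z))\<^sup>2) = c2 *\<^sub>R (LINT z|lborel. c\<^sup>2 * (indicator (-U') z * B z))"
      unfolding set_lebesgue_integral_def A c2_def
    proof (rule integral_mu(1))
      show "AE z in lborel. indicat_real (- U) z *\<^sub>R (c\<^sup>2 * B z) = c\<^sup>2 * (indicator (- U') z * B z)"
        using U'(2) by eventually_elim (auto simp: indicator_def)
    qed measurable
    then show ?thesis by simp
  qed
  have iU: "integrable lborel (\<lambda>z. indicator U' z * B z)" "integrable lborel (\<lambda>z. indicator (-U') z * B z)"
    by (rule Bochner_Integration.integrable_bound[OF Bi]; simp add: indicator_def abs_mult)+
  have split: "integral\<^sup>L lborel B = (LINT z|lborel. indicator U' z * B z) + (LINT z|lborel. indicator (-U') z * B z)"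
    unfolding Bochner_Integration.integral_add[OF iU, symmetric]
    by (intro Bochner_Integration.integral_cong) (auto simp: indicator_def)
  have "sqrt (c2 * (c\<^sup>2 * (LINT z|lborel. indicator (-U') z * B z))) \<le> \<epsilon> * norm2 (ambiguity f g)"
    using assms(7) unfolding concentrated_def outside .
  moreover have out0: "(LINT z|lborel. indicator (-U') z * B z) \<ge> 0" using B0 by (intro integral_nonneg_AE) auto
  ultimately have "c2 * (c\<^sup>2 * (LINT z|lborel. indicator (-U') z * B z)) \<le> (\<epsilon> * norm2 (ambiguity f g))\<^sup>2"
    using c by (intro sqrt_le_D)
  then have "c2 * (c\<^sup>2 * (LINT z|lborel. indicator (-U') z * B z)) \<le> c2 * (c\<^sup>2 * (\<epsilon>\<^sup>2 * integral\<^sup>L lborel B))"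
    unfolding power_mult_distrib total by (simp add: mult_ac)
  then have "(LINT z|lborel. indicator (-U') z * B z) \<le> \<epsilon>\<^sup>2 * integral\<^sup>L lborel B"
    using c(1,2) by simp
  \<comment> \<open>At most the fraction \<epsilon>^2 of the energy lies outside, so at least 1 -
    \<epsilon>^2 lies inside, and Plancherel's theorem evaluates the total.\<close>
  then have low: "(1 - \<epsilon>\<^sup>2) * ((2 * pi) ^ ?n * \<Phi>) \<le> (LINT z|lborel. indicator U' z * B z)"
    using split unfolding BI by (simp add: left_diff_distrib del: DIM_prod)
  have emU: "emeasure mu U = ennreal c2 * emeasure lborel U'"
    unfolding mu_eq U'(3) c2_def using assms(5) by (subst emeasure_density_const) auto
  have U'fin: "emeasure lborel U' < \<infinity>"
    using Ufin c(2) unfolding emU by (auto simp: less_top[symmetric] ennreal_mult_eq_top_iff)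
  define v where "v = measure lborel U'"
  define C where "C = C_const CARD('d) p q"
  have C: "C > 0" unfolding C_def C_const_def using assms(8) conjugate_exponent_bounds[OF assms(8,9)] by simp
  have n: "?n = 2 * CARD('d)" by simp
  have up: "(LINT z|lborel. indicator U' z * B z) \<le> v powr (1 - 2 / p) * (2 * pi) powr (2 * ?n / p) * C\<^sup>2 * \<Phi>"
  proof -
    have "ennreal (LINT z|lborel. indicator U' z * B z) = (\<integral>\<^sup>+z. ennreal (indicator U' z * B z) \<partial>lborel)"
      using B0 by (intro nn_integral_eq_integral[symmetric] iU) auto
    also have "\<dots> \<le> ennreal (v powr (1 - 2 / p) * (2 * pi) powr (2 * ?n / p) * (young_const (q / 2) ^ ?n) powr (2 / q) * \<Phi>)"
      unfolding v_def B_def \<Phi>_def by (rule qamb_concentration[OF f'(1) g'(1) f2 g2 U'(1) U'fin assms(8,9)])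
    also have "(young_const (q / 2) ^ ?n) powr (2 / q) = C\<^sup>2"
      unfolding n C_def by (rule young_const_C_const[OF assms(8,9)])
    finally show ?thesis using \<Phi> by (subst (asm) ennreal_le_iff) (auto intro!: mult_nonneg_nonneg)
  qed
  define u where "u = c2 * v"
  have u0: "u \<ge> 0" using c by (simp add: u_def v_def)
  \<comment> \<open>Passing to the normalised measure \<open>u\<close> of \<open>U\<close> produces
    T^(1 - 2/p) with T = (2 pi)^n. Together with T^(2/p) from the local bound this is exactly the
    Plancherel factor T on the left, so no power of 2 pi remains.\<close>
  have "(2 * pi) ^ ?n * u = c2 * (2 * pi) ^ ?n * v" by (simp only: u_def mult_ac)
  then have v: "v = (2 * pi) ^ ?n * u" by (simp only: c(4) mult_1_left)
  define e where "e = 1 - \<epsilon>\<^sup>2"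
  have e0: "e > 0" unfolding e_def using eps assms(6) by (simp add: power_less_one_iff)
  define T where "T = (2 * pi) ^ ?n"
  have T: "T > 0" by (simp add: T_def)
  have "(2 * pi) powr (2 * ?n / p) = T powr (2 / p)"
  proof -
    have "T = (2 * pi) powr ?n" unfolding T_def by (rule powr_realpow[symmetric]) simp
    then show ?thesis by (simp only: powr_powr) (simp add: mult.commute)
  qed
  then have "e * (T * \<Phi>) \<le> (T * u) powr (1 - 2 / p) * T powr (2 / p) * C\<^sup>2 * \<Phi>"
    using order_trans[OF low up] unfolding v T_def[symmetric] e_def by simp
  also have "\<dots> = u powr (1 - 2 / p) * C\<^sup>2 * (T * \<Phi>)"
  proof -
    have "T powr (1 - 2 / p) * T powr (2 / p) = T" using T by (simp flip: powr_add)
    then show ?thesis using T u0 by (simp add: powr_mult mult_ac) 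
  qed
  finally have "e \<le> u powr (1 - 2 / p) * C\<^sup>2" using T \<Phi> by simp
  then have "e * C powr (- 2) \<le> u powr (1 - 2 / p)"
    using C by (simp add: powr_minus powr_numeral field_simps)
  \<comment> \<open>The exponent p/(p - 2) is the reciprocal of 1 - 2/p and isolates
    \<open>u\<close>; it also turns the power -2 of \<open>C\<close> into 2p/(2 - p).\<close>
  then have "(e * C powr (- 2)) powr (p / (p - 2)) \<le> (u powr (1 - 2 / p)) powr (p / (p - 2))"
    using e0 assms(8) by (intro powr_mono2) auto
  also have "\<dots> = u"
  proof -
    have "(1 - 2 / p) * (p / (p - 2)) = 1" using assms(8) by (simp add: field_simps)
    then show ?thesis using u0 by (simp only: powr_powr powr_one)
  qed
  also have "(e * C powr (- 2)) powr (p / (p - 2)) = e powr (p / (p - 2)) * C powr (2 * p / (2 - p))"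
  proof -
    have "- 2 * (p / (p - 2)) = 2 * p / (2 - p)" using assms(8) by (simp add: field_simps)
    then show ?thesis by (simp only: powr_mult powr_powr)
  qed
  finally have "e powr (p / (p - 2)) * C powr (2 * p / (2 - p)) \<le> u" .
  moreover have "emeasure mu U = ennreal u"
    unfolding emU u_def v_def using c(2) U'fin by (simp add: ennreal_mult emeasure_eq_ennreal_measure less_top)
  moreover have "max 0 (1 - \<epsilon>\<^sup>2) = e" using e0 by (simp add: e_def)
  ultimately show ?thesis by (simp add: C_def ennreal_leI)
qed

end
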